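(* Let $n\ge 3$ be an odd integer and let $D_{2n}=\langle x,y : x^2=y^n=1,\ xy=y^{-1}x\rangle$ be the dihedral group of order $2n$. Then $$\mathsf{s}_{n\mathbb{N}}(D_{2n})=2n+\lfloor \log_2 n\rfloor.$$
   Context: A sequence over a finite group $G$ is a finite unordered list of elements of $G$ with repetition allowed; its length is the number of terms counted with multiplicity, and a subsequence is a sub-multiset. A sequence $g_1,\dots,g_\ell$ is a $1$-product sequence if $g_{\tau(1)}\cdots g_{\tau(\ell)}=1$ for some permutation $\tau$ of $\{1,\dots,\ell\}$. For a positive integer $d$, $\mathsf{s}_{d\mathbb{N}}(G)$ denotes the smallest $\ell\in\mathbb{N}_0\cup\{+\infty\}$ such that every sequence over $G$ of length at least $\ell$ has a nonempty $1$-product subsequence $T$ with $|T|\equiv 0\pmod d$. $\lfloor t\rfloor$ denotes the largest integer not exceeding $t$. *)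

theory Defs
  imports
    Complex_Main
    "HOL-Library.Multiset"
    "HOL-Library.Extended_Nat"
    "HOL-Number_Theory.Cong"
    "HOL-Algebra.Generated_Groups"
begin

definition one_product_seq :: "('a, 'b) monoid_scheme \<Rightarrow> 'a multiset \<Rightarrow> bool" where
  "one_product_seq G S \<longleftrightarrow>
     (\<exists>gs. mset gs = S \<and> foldr (mult G) gs \<one>\<^bsub>G\<^esub> = \<one>\<^bsub>G\<^esub>)"

text \<open>The least element is taken in \<^typ>\<open>enat\<close>, so it always exists: the condition holds
  vacuously for \<open>\<infinity>\<close>.\<close>

definition s_dN :: "nat \<Rightarrow> ('a, 'b) monoid_scheme \<Rightarrow> enat" where
  "s_dN d G =
     (LEAST l::enat. \<forall>S. set_mset S \<subseteq> carrier G \<and> l \<le> enat (size S) \<longrightarrow>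
        (\<exists>T. T \<subseteq># S \<and> T \<noteq> {#} \<and> one_product_seq G T \<and> [size T = 0] (mod d)))"

locale dihedral_relations = group G for G (structure) +
  fixes n :: nat and x y
  assumes x_closed [simp, intro]: "x \<in> carrier G"
    and y_closed [simp, intro]: "y \<in> carrier G"
    and x_pow: "x [^] (2::nat) = \<one>"
    and y_pow: "y [^] n = \<one>"
    and xy: "x \<otimes> y = inv y \<otimes> x"

text \<open>A group is the dihedral group of order \<open>2n\<close>, presented as
  \<open>\<langle>x, y : x^2 = y^n = 1, xy = y^{-1}x\<rangle>\<close>, iff it is generated by elements \<open>x\<close>, \<open>y\<close> satisfying
  these relations and has the full order \<open>2n\<close>. That the order excludes further relations is the
  universal property \<open>dihedral_group.universal\<close> below; existence is
  \<open>dihedral_group_dihedral_model\<close>.\<close>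

locale dihedral_group = dihedral_relations G n x y for G (structure) and n x y +
  assumes generated: "generate G {x, y} = carrier G"
    and order_eq: "order G = 2 * n"

context dihedral_relations
begin

definition nf :: "int \<Rightarrow> bool \<Rightarrow> 'a" where
  "nf i s = y [^] i \<otimes> (if s then x else \<one>)"

lemma nf_closed [simp, intro]: "nf i s \<in> carrier G"
  by (simp add: nf_def)

lemma xx: "x \<otimes> x = \<one>"
  using x_pow by (simp add: numeral_2_eq_2)

lemma x_y_nat_pow: "x \<otimes> y [^] (k::nat) = inv (y [^] k) \<otimes> x"
proof (induction k)
  case (Suc k)
  have "x \<otimes> y [^] Suc k = (x \<otimes> y [^] k) \<otimes> y" by (simp add: m_assoc)
  also have "\<dots> = inv (y [^] k) \<otimes> (x \<otimes> y)" using Suc by (simp add: m_assoc)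
  also have "\<dots> = (inv (y [^] k) \<otimes> inv y) \<otimes> x" by (simp add: xy m_assoc)
  also have "inv (y [^] k) \<otimes> inv y = inv (y \<otimes> y [^] k)" by (simp add: inv_mult_group)
  also have "y \<otimes> y [^] k = y [^] Suc k" by (metis nat_pow_Suc2 y_closed)
  finally show ?case .
qed simp

lemma x_y_pow: "x \<otimes> y [^] (j::int) = y [^] (- j) \<otimes> x"
proof (cases j)
  case (nonneg k)
  then show ?thesis
    using x_y_nat_pow[of k] by (simp add: int_pow_neg int_pow_int)
next
  case (neg k)
  let ?p = "y [^] Suc k"
  have p: "?p \<in> carrier G" by (rule nat_pow_closed[OF y_closed])
  have "?p \<otimes> x \<otimes> ?p = x"
    using x_y_nat_pow[of "Suc k"] p by (metis inv_closed m_assoc r_inv l_one x_closed)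
  then have "x \<otimes> inv ?p = ?p \<otimes> x"
    using p by (metis inv_solve_right m_closed x_closed)
  then show ?thesis
    unfolding neg by (simp only: int_pow_neg_int[OF y_closed] minus_minus int_pow_int)
qed

lemma nf_mult: "nf i s \<otimes> nf j t = nf (if s then i - j else i + j) (s \<noteq> t)"
proof (cases s)
  case True
  have "nf i s \<otimes> nf j t = y [^] i \<otimes> ((x \<otimes> y [^] j) \<otimes> (if t then x else \<one>))"
    using True by (simp add: nf_def m_assoc)
  also have "\<dots> = (y [^] i \<otimes> y [^] (- j)) \<otimes> (x \<otimes> (if t then x else \<one>))"
    by (simp add: x_y_pow m_assoc)
  also have "y [^] i \<otimes> y [^] (- j) = y [^] (i - j)"
    using int_pow_mult[OF y_closed, of i "- j"] by simp
  finally show ?thesis using True by (simp add: nf_def xx)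
next
  case False
  then show ?thesis by (simp add: nf_def int_pow_mult[OF y_closed] m_assoc)
qed

lemma nf_simps: "nf 0 False = \<one>" "nf 0 True = x" "nf 1 False = y"
  by (simp_all add: nf_def)

lemma nf_mod: "nf (i mod int n) s = nf i s"
proof -
  have "y [^] (int n * (i div int n)) = \<one>"
    using y_pow by (metis int_pow_pow int_pow_int int_pow_one y_closed)
  moreover have "y [^] i = y [^] (int n * (i div int n)) \<otimes> y [^] (i mod int n)"
    using int_pow_mult[OF y_closed, of "int n * (i div int n)" "i mod int n"] by simp
  ultimately show ?thesis by (simp add: nf_def)
qed

lemma generate_imp_nf:
  assumes "g \<in> generate G {x, y}"
  shows "\<exists>i s. g = nf i s"
  using assms
proof (induction rule: generate.induct)
  case one
  show ?case using nf_simps(1)[symmetric] by blast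
next
  case (incl h)
  then show ?case using nf_simps(2,3)[symmetric] by blast
next
  case (inv h)
  have "inv x = nf 0 True" using xx by (simp add: nf_simps inv_equality)
  moreover have "inv y = nf (- 1) False" by (simp add: nf_def int_pow_neg)
  ultimately show ?case using inv by blast
next
  case (eng g h)
  then obtain i s j t where "g = nf i s" "h = nf j t" by blast
  then show ?case using nf_mult[of i s j t] by blast
qed

end

context dihedral_group
begin

lemma bij_betw_nf:
  assumes "n > 0"
  shows "bij_betw (\<lambda>(i, s). nf i s) ({0..<int n} \<times> UNIV) (carrier G)"
proof -
  let ?A = "{0..<int n} \<times> (UNIV :: bool set)" and ?f = "\<lambda>(i, s). nf i s"
  have "carrier G \<subseteq> ?f ` ?A"
  proof
    fix g assume "g \<in> carrier G"
    then obtain i s where "g = nf i s" using generate_imp_nf generated by blast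
    then have "g = ?f (i mod int n, s)" by (simp add: nf_mod)
    moreover have "(i mod int n, s) \<in> ?A" using assms by simp
    ultimately show "g \<in> ?f ` ?A" by blast
  qed
  then have img: "?f ` ?A = carrier G" by auto
  have "card ?A = 2 * n" by (simp add: card_cartesian_product)
  then have "inj_on ?f ?A"
    using img order_eq by (intro eq_card_imp_inj_on) (simp_all add: order_def)
  with img show ?thesis by (simp add: bij_betw_def)
qed

theorem universal:
  assumes "n > 0" and "dihedral_relations H n a b"
  shows "\<exists>h \<in> hom G H. h x = a \<and> h y = b"
proof -
  interpret H: dihedral_relations H n a b by fact
  let ?A = "{0..<int n} \<times> (UNIV :: bool set)"
  define r where "r = the_inv_into ?A (\<lambda>(i, s). nf i s)"
  define h where "h g = (case r g of (i, s) \<Rightarrow> H.nf i s)" for g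
  have inj: "inj_on (\<lambda>(i, s). nf i s) ?A"
    using bij_betw_nf[OF assms(1)] by (simp add: bij_betw_def)
  have h_nf: "h (nf i s) = H.nf i s" for i s
  proof -
    have "r (nf (i mod int n) s) = (i mod int n, s)"
      using the_inv_into_f_f[OF inj, of "(i mod int n, s)"] assms(1) by (simp add: r_def)
    then have "h (nf (i mod int n) s) = H.nf (i mod int n) s" by (simp add: h_def)
    then show ?thesis by (simp add: nf_mod H.nf_mod)
  qed
  have rep: "\<exists>i s. g = nf i s" if "g \<in> carrier G" for g
    using that generate_imp_nf generated by blast
  have "h \<in> hom G H"
  proof (rule homI)
    fix g assume "g \<in> carrier G"
    then show "h g \<in> carrier H" using rep h_nf by fastforce
  next
    fix g g' assume "g \<in> carrier G" "g' \<in> carrier G"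
    then obtain i s j t where "g = nf i s" "g' = nf j t" using rep by blast
    then show "h (g \<otimes> g') = h g \<otimes>\<^bsub>H\<^esub> h g'"
      by (simp add: nf_mult H.nf_mult h_nf)
  qed
  moreover have "h x = a" "h y = b"
    using h_nf[of 0 True] h_nf[of 1 False] by (simp_all add: nf_simps H.nf_simps)
  ultimately show ?thesis by blast
qed

end

text \<open>The pair \<open>(i, s)\<close> stands for \<open>y^i\<close> if \<open>s\<close> is false and for \<open>y^i x\<close> otherwise.\<close>

definition dihedral_model :: "nat \<Rightarrow> (int \<times> bool) monoid" where
  "dihedral_model n =
     \<lparr>carrier = {0..<int n} \<times> UNIV,
      mult = (\<lambda>(i, s) (j, t). ((if s then i - j else i + j) mod int n, s \<noteq> t)),
      one = (0, False)\<rparr>"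

lemma dihedral_model_assoc:
  "(g \<otimes>\<^bsub>dihedral_model n\<^esub> h) \<otimes>\<^bsub>dihedral_model n\<^esub> k =
    g \<otimes>\<^bsub>dihedral_model n\<^esub> (h \<otimes>\<^bsub>dihedral_model n\<^esub> k)"
  by (cases g; cases h; cases k)
     (simp add: dihedral_model_def mod_simps diff_diff_eq add_diff_eq add.assoc diff_diff_eq2 diff_add_eq)

lemma group_dihedral_model:
  assumes "n > 0"
  shows "group (dihedral_model n)"
proof (rule groupI)
  fix g assume g: "g \<in> carrier (dihedral_model n)"
  obtain i s where gi: "g = (i, s)" by fastforce
  show "\<exists>h\<in>carrier (dihedral_model n). h \<otimes>\<^bsub>dihedral_model n\<^esub> g = \<one>\<^bsub>dihedral_model n\<^esub>"
    using g assms unfolding gi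
    by (intro bexI[of _ "if s then (i, s) else ((- i) mod int n, s)"])
       (auto simp: dihedral_model_def mod_simps)
next
  fix g h k
  show "(g \<otimes>\<^bsub>dihedral_model n\<^esub> h) \<otimes>\<^bsub>dihedral_model n\<^esub> k =
    g \<otimes>\<^bsub>dihedral_model n\<^esub> (h \<otimes>\<^bsub>dihedral_model n\<^esub> k)"
    by (rule dihedral_model_assoc)
qed (use assms in \<open>auto simp: dihedral_model_def\<close>)

lemma dihedral_group_dihedral_model:
  assumes "n > 0"
  shows "dihedral_group (dihedral_model n) n (0, True) (1 mod int n, False)"
proof -
  interpret group "dihedral_model n" by (rule group_dihedral_model[OF assms])
  let ?M = "dihedral_model n" and ?x = "(0 :: int, True)" and ?y = "(1 mod int n, False)"
  have x: "?x \<in> carrier ?M" and y: "?y \<in> carrier ?M"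
    using assms by (auto simp: dihedral_model_def)
  have ypow: "?y [^]\<^bsub>?M\<^esub> k = (int k mod int n, False)" for k :: nat
    by (induction k) (auto simp: dihedral_model_def mod_simps, simp_all add: algebra_simps)
  have inv_y: "inv\<^bsub>?M\<^esub> ?y = ((- 1) mod int n, False)"
    using assms by (intro inv_equality) (auto simp: dihedral_model_def mod_simps)
  interpret dihedral_relations ?M n ?x ?y
    using assms x y ypow[of n]
    by unfold_locales
       (auto simp: inv_y numeral_2_eq_2, auto simp: dihedral_model_def mod_simps)
  have "g \<in> generate ?M {?x, ?y}" if gM: "g \<in> carrier ?M" for g
  proof -
    obtain i s where g: "g = (i, s)" and i: "0 \<le> i" "i < int n"
      using gM by (auto simp: dihedral_model_def)
    have gen: "?y [^]\<^bsub>?M\<^esub> k \<in> generate ?M {?x, ?y}" for k :: nat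
      by (induction k) (auto intro: generate.intros)
    have y_in: "(i, False) \<in> generate ?M {?x, ?y}"
      using gen[of "nat i"] i by (simp add: ypow)
    show ?thesis
    proof (cases s)
      case True
      have "(i, False) \<otimes>\<^bsub>?M\<^esub> ?x \<in> generate ?M {?x, ?y}"
        using y_in by (auto intro: generate.intros)
      then show ?thesis using True g i by (simp add: dihedral_model_def)
    qed (use y_in g in simp)
  qed
  moreover have "generate ?M {?x, ?y} \<subseteq> carrier ?M"
    using x y by (intro generate_incl) auto
  moreover have "order ?M = 2 * n"
    by (simp add: order_def dihedral_model_def card_cartesian_product)
  ultimately show ?thesis
    by unfold_locales auto
qed

end

theory Submission
  imports Defs
begin

text \<open>
  Write \<open>(v, False)\<close> for the rotation \<open>y^v\<close> and \<open>(v, True)\<close> for the reflection \<open>y^v x\<close>. Moving a factor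
  past a reflection inverts rotations, so a sequence containing a reflection has product one in some
  order iff its exponents can be given signs with sum divisible by \<open>n\<close>, the reflections carrying
  equally many plus and minus signs; rotation signs are free.

  Lower bound: with \<open>2n - 1\<close> copies of \<open>x\<close> and the rotations \<open>y^(2^i)\<close>, \<open>i < k = \<lfloor>log 2 n\<rfloor>\<close>, no nonempty
  set of rotations has a vanishing signed sum, and \<open>n\<close> is odd.

  Upper bound: the subgroups of the cyclic group are the \<open>l Z\<close> with \<open>l\<close> dividing \<open>n\<close>. A set of signed sums
  grows with every new sign choice unless the new element lies in its stabilizer. This yields a
  subgroup \<open>l Z\<close>, all of whose elements are signed sums of a short subsequence \<open>U\<close>, together with at least
  \<open>k + 1\<close> further reflections in one coset \<open>b + l Z\<close>. Modulo \<open>l\<close> the latter are equal, so they correct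
  any small imbalance of signs, and it remains to find signed zero sums modulo \<open>l\<close> among the other
  elements. By the pigeonhole principle any \<open>k + 1\<close> of them contain a block with signed sum zero; adding
  such blocks and pairs of equal elements leaves out at most \<open>k\<close> elements and reaches length \<open>2 n\<close>. If a
  block has an odd number of rotations, or if there are many rotations (then by the
  Erdos-Ginzburg-Ziv theorem), one aims at length \<open>n\<close> instead.\<close>

subsection \<open>Signed sums\<close>

text \<open>Parity is the obstacle. Balanced signs force an even number of reflections; as
  \<open>n\<close> is odd, a subsequence of length \<open>n\<close> that contains reflections needs
  an odd number of rotations, and one of length \<open>2 * n\<close> an even number. The reserve of
  \<open>k + 1\<close> reflections is dictated by the blocks: at most \<open>k + 1\<close> terms
  have imbalance at most \<open>k + 1\<close>, and blocks can be joined without exceeding this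
  bound, so one reserve pays for all of them. Oddness of \<open>n\<close> also drives the growth of
  the sums: reversing the sign of \<open>v\<close> moves a sum by \<open>2 * v\<close>, and 2 is
  invertible modulo every divisor of \<open>n\<close>. The cases are split by the largest subgroup
  that few rotations cover, because its maximality bounds the number of rotations outside it. The
  hard case is the trivial subgroup: there the pigeonhole count has no spare factor two for parity,
  since \<open>2 * n\<close> is at least \<open>2 ^ (k + 1)\<close>. Trivial rotations, if present,
  then serve as fillers of either parity; without them the parity of the blocks found decides
  between the two lengths.\<close>

definition wt :: "(int \<times> bool) multiset \<Rightarrow> int" where
  "wt T = (\<Sum>e\<in>#T. fst e)"

definition refls :: "(int \<times> bool) multiset \<Rightarrow> nat" where
  "refls T = size (filter_mset snd T)"

lemma wt_simps [simp]: "wt {#} = 0" "wt (add_mset e T) = fst e + wt T" "wt (T + T') = wt T + wt T'"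
  by (simp_all add: wt_def)

lemma refls_simps [simp]:
  "refls {#} = 0" "refls (add_mset e T) = (if snd e then Suc (refls T) else refls T)"
  "refls (T + T') = refls T + refls T'"
  by (simp_all add: refls_def)

lemma refls_le_size: "refls T \<le> size T"
  by (simp add: refls_def size_filter_mset_lesseq)

lemma refls_mono: "T \<subseteq># T' \<Longrightarrow> refls T \<le> refls T'"
  by (auto simp: refls_def intro!: size_mset_mono multiset_filter_mono)

lemma refls_eq_0_iff: "refls T = 0 \<longleftrightarrow> (\<forall>e\<in>#T. \<not> snd e)"
  by (auto simp: refls_def filter_mset_eq_conv)

lemma refls_eq_size: "\<forall>e\<in>#T. snd e \<Longrightarrow> refls T = size T"
  by (induction T) auto

text \<open>\<open>s\<close> is a signed sum of all exponents in \<open>T\<close>, and \<open>t\<close> is the excess of positive over negative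
  signs among the reflections.\<close>

definition signed_sum :: "(int \<times> bool) multiset \<Rightarrow> int \<Rightarrow> int \<Rightarrow> bool" where
  "signed_sum T s t \<longleftrightarrow>
     (\<exists>T1 T2. T = T1 + T2 \<and> s = wt T1 - wt T2 \<and> t = int (refls T1) - int (refls T2))"

lemma signed_sum_empty [simp]: "signed_sum {#} s t \<longleftrightarrow> s = 0 \<and> t = 0"
  by (auto simp: signed_sum_def)

lemma signed_sum_self: "signed_sum T (wt T) (int (refls T))"
  unfolding signed_sum_def by (rule exI[of _ T], rule exI[of _ "{#}"]) simp

lemma signed_sum_uminus: "signed_sum T s t \<Longrightarrow> signed_sum T (- s) (- t)"
  unfolding signed_sum_def by (metis add.commute minus_diff_eq)

lemma signed_sum_add:
  assumes "signed_sum T s t" "signed_sum T' s' t'"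
  shows "signed_sum (T + T') (s + s') (t + t')"
proof -
  obtain T1 T2 U1 U2 where "T = T1 + T2" "s = wt T1 - wt T2" "t = int (refls T1) - int (refls T2)"
    "T' = U1 + U2" "s' = wt U1 - wt U2" "t' = int (refls U1) - int (refls U2)"
    using assms unfolding signed_sum_def by blast
  then show ?thesis unfolding signed_sum_def
    by (intro exI[of _ "T1 + U1"] exI[of _ "T2 + U2"]) simp
qed

lemma signed_sum_diff:
  assumes "signed_sum T s t" "signed_sum T' s' t'"
  shows "signed_sum (T + T') (s - s') (t - t')"
  using signed_sum_add[OF assms(1) signed_sum_uminus[OF assms(2)]] by simp

lemma signed_sum_single: "signed_sum {#e#} (fst e) (if snd e then 1 else 0)"
  using signed_sum_self[of "{#e#}"] by (auto split: if_splits)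

lemma signed_sum_pair:
  assumes "snd e = snd e'"
  shows "signed_sum {#e, e'#} (fst e - fst e') 0"
  using signed_sum_diff[OF signed_sum_single[of e] signed_sum_single[of e']] assms
  by (simp add: add_mset_commute)

lemma signed_sum_parity: "signed_sum T s t \<Longrightarrow> even t \<longleftrightarrow> even (refls T)"
  by (auto simp: signed_sum_def)

lemma signed_sum_abs_le: "signed_sum T s t \<Longrightarrow> \<bar>t\<bar> \<le> int (refls T)"
  by (auto simp: signed_sum_def)

lemma signed_sum_add_mset_rotation:
  assumes "\<not> snd e"
  shows "signed_sum (add_mset e T) s t \<longleftrightarrow> signed_sum T (s - fst e) t \<or> signed_sum T (s + fst e) t"
proof
  assume "signed_sum (add_mset e T) s t"
  then obtain T1 T2 where T: "add_mset e T = T1 + T2" and s: "s = wt T1 - wt T2"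
    and t: "t = int (refls T1) - int (refls T2)" unfolding signed_sum_def by blast
  have "e \<in># T1 \<or> e \<in># T2" using T by (metis union_iff union_single_eq_member)
  then show "signed_sum T (s - fst e) t \<or> signed_sum T (s + fst e) t"
  proof
    assume "e \<in># T1"
    then obtain U where U: "T1 = add_mset e U" by (metis insert_DiffM)
    then have "T = U + T2" using T by simp
    then have "signed_sum T (s - fst e) t" unfolding signed_sum_def
      using U s t assms by (intro exI[of _ U] exI[of _ T2]) simp
    then show ?thesis ..
  next
    assume "e \<in># T2"
    then obtain U where U: "T2 = add_mset e U" by (metis insert_DiffM)
    then have "T = T1 + U" using T by simp
    then have "signed_sum T (s + fst e) t" unfolding signed_sum_def
      using U s t assms by (intro exI[of _ T1] exI[of _ U]) simp
    then show ?thesis ..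
  qed
next
  assume "signed_sum T (s - fst e) t \<or> signed_sum T (s + fst e) t"
  then show "signed_sum (add_mset e T) s t"
    using signed_sum_add[of T "s - fst e" t, OF _ signed_sum_single[of e]]
      signed_sum_diff[of T "s + fst e" t, OF _ signed_sum_single[of e]] assms by auto
qed

text \<open>Without reflections the group elements commute and no signs are available.\<close>

definition solvable :: "nat \<Rightarrow> (int \<times> bool) multiset \<Rightarrow> bool" where
  "solvable n T \<longleftrightarrow>
     (if refls T = 0 then int n dvd wt T else \<exists>s. signed_sum T s 0 \<and> int n dvd s)"

lemma solvableI: "refls T > 0 \<Longrightarrow> signed_sum T s 0 \<Longrightarrow> int n dvd s \<Longrightarrow> solvable n T"
  by (auto simp: solvable_def)

section \<open>Words evaluated in the infinite dihedral group\<close>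

fun word_value :: "(int \<times> bool) list \<Rightarrow> int \<times> bool" where
  "word_value [] = (0, False)"
| "word_value ((v, s) # w) =
     (if s then v - fst (word_value w) else v + fst (word_value w), s \<noteq> snd (word_value w))"

lemma word_value_append:
  "word_value (u @ w) =
     (if snd (word_value u) then fst (word_value u) - fst (word_value w)
      else fst (word_value u) + fst (word_value w), snd (word_value u) \<noteq> snd (word_value w))"
  by (induction u rule: word_value.induct) auto

lemma snd_word_value: "snd (word_value w) \<longleftrightarrow> odd (refls (mset w))"
  by (induction w rule: word_value.induct) auto

text \<open>Prepending a reflection negates the exponent of the whole tail. The excess
  \<open>t\<close> stays unspecified, since the lower bound only uses the parity of the number of
  reflections.\<close>

lemma signed_sum_word_value: "\<exists>t. signed_sum (mset w) (fst (word_value w)) t"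
proof (induction w rule: word_value.induct)
  case (2 v s w)
  then obtain t where t: "signed_sum (mset w) (fst (word_value w)) t" by blast
  show ?case
    using signed_sum_add[OF signed_sum_single[of "(v, s)"] t]
      signed_sum_diff[OF signed_sum_single[of "(v, s)"] t] by auto
qed simp

lemma word_value_rotations:
  "refls (mset w) = 0 \<Longrightarrow> word_value w = (wt (mset w), False)"
  by (induction w rule: word_value.induct) (auto split: if_splits)

text \<open>Elements of \<open>P\<close> and \<open>Q\<close> alternate, because a product of two
  reflections is the rotation by the difference of their exponents.\<close>

lemma word_value_reflections:
  assumes "size P = size Q" "\<forall>e\<in>#P. snd e" "\<forall>e\<in>#Q. snd e"
  shows "\<exists>w. mset w = P + Q \<and> word_value w = (wt P - wt Q, False)"
  using assms
proof (induction P arbitrary: Q)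
  case (add p P)
  obtain q Q' where Q: "Q = add_mset q Q'" using add.prems(1) by (metis size_eq_Suc_imp_eq_union size_add_mset)
  then obtain w where w: "mset w = P + Q'" "word_value w = (wt P - wt Q', False)"
    using add.IH[of Q'] add.prems Q by auto
  show ?case
    using w Q add.prems by (intro exI[of _ "p # q # w"]) (cases p; cases q; auto)
qed (auto intro: exI[of _ "[]"])

lemma ex_word_value_0:
  assumes "solvable n T"
  shows "\<exists>w. mset w = T \<and> int n dvd fst (word_value w) \<and> \<not> snd (word_value w)"
proof (cases "refls T = 0")
  case True
  obtain w where "mset w = T" using ex_mset by blast
  then show ?thesis using True assms word_value_rotations[of w] by (auto simp: solvable_def)
next
  case False
  then obtain T1 T2 where T: "T = T1 + T2" and s: "int n dvd wt T1 - wt T2"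
    and t: "refls T1 = refls T2"
    using assms unfolding solvable_def signed_sum_def by (auto split: if_splits)
  define P where "P = filter_mset snd T1"
  define Q where "Q = filter_mset snd T2"
  define A where "A = filter_mset (\<lambda>e. \<not> snd e) T1"
  define B where "B = filter_mset (\<lambda>e. \<not> snd e) T2"
  have T1: "T1 = A + P" and T2: "T2 = B + Q"
    by (auto simp: A_def P_def B_def Q_def)
  have "size P = size Q" using t by (simp add: refls_def P_def Q_def)
  moreover have "refls T1 \<noteq> 0" using False T t by auto
  then have "size P \<noteq> 0" unfolding P_def refls_def .
  then have "P \<noteq> {#}" by auto
  ultimately obtain p P' where P: "P = add_mset p P'"
    by (metis multiset_cases)
  obtain q Q' where Q: "Q = add_mset q Q'"
    using \<open>size P = size Q\<close> P by (metis size_eq_Suc_imp_eq_union size_add_mset)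
  have "size P' = size Q'" using \<open>size P = size Q\<close> P Q by simp
  moreover have pq: "\<forall>e\<in>#P. snd e" "\<forall>e\<in>#Q. snd e" by (auto simp: P_def Q_def)
  ultimately obtain w where w: "mset w = P' + Q'" "word_value w = (wt P' - wt Q', False)"
    using word_value_reflections[of P' Q'] P Q by auto
  obtain a b where a: "mset a = A" and b: "mset b = B" using ex_mset by metis
  have va: "word_value a = (wt A, False)" and vb: "word_value b = (wt B, False)"
    using word_value_rotations[of a] word_value_rotations[of b] a b
    by (auto simp: refls_def A_def B_def)
  \<comment> \<open>Rotations count positively before \<open>p\<close> and negatively between
    \<open>p\<close> and \<open>q\<close>, so \<open>A\<close> goes in front and \<open>B\<close> in
    between.\<close>
  define u where "u = a @ [p] @ b @ [q] @ w"
  have "word_value u = (wt A + (fst p - (wt B + (fst q - (wt P' - wt Q')))), False)"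
    using va vb w pq P Q unfolding u_def by (cases p; cases q) (simp add: word_value_append)
  then have "fst (word_value u) = wt T1 - wt T2" "\<not> snd (word_value u)"
    by (simp_all add: T1 T2 P Q)
  moreover have "mset u = T" using a b w by (simp add: u_def T T1 T2 P Q)
  ultimately show ?thesis using s by metis
qed

lemma mset_eq_image_mset_obtain:
  assumes "mset gs = image_mset f T"
  obtains w where "mset w = T" "gs = map f w"
proof -
  have "\<exists>w. mset w = T \<and> gs = map f w"
    using assms
  proof (induction gs arbitrary: T)
    case (Cons g gs)
    then obtain e T' where T: "T = add_mset e T'" "f e = g" "image_mset f T' = mset gs"
      using msed_map_invR[of f T g "mset gs"] by (metis mset.simps(2))
    then obtain w where "mset w = T'" "gs = map f w" using Cons.IH[of T'] by auto
    then show ?case using T by (intro exI[of _ "e # w"]) auto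
  qed auto
  then show ?thesis using that by blast
qed

context dihedral_relations
begin

lemma foldr_mult_nf:
  "foldr (mult G) (map (\<lambda>e. nf (fst e) (snd e)) w) \<one> =
     nf (fst (word_value w)) (snd (word_value w))"
  by (induction w rule: word_value.induct) (auto simp: nf_simps nf_mult)

lemma nf_eq_one: "int n dvd i \<Longrightarrow> nf i False = \<one>"
  using nf_mod[of i False] by (simp add: nf_simps)

lemma one_product_seq_of_solvable:
  assumes "solvable n T"
  shows "one_product_seq G (image_mset (\<lambda>e. nf (fst e) (snd e)) T)"
proof -
  obtain w where w: "mset w = T" "int n dvd fst (word_value w)" "\<not> snd (word_value w)"
    using ex_word_value_0[OF assms] by blast
  then show ?thesis
    unfolding one_product_seq_def
    using foldr_mult_nf[of w] nf_eq_one[of "fst (word_value w)"]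
    by (intro exI[of _ "map (\<lambda>e. nf (fst e) (snd e)) w"]) auto
qed

end

context dihedral_group
begin

lemma nf_eq_one_iff:
  assumes "n > 0"
  shows "nf i s = \<one> \<longleftrightarrow> int n dvd i \<and> \<not> s"
proof
  assume "nf i s = \<one>"
  then have "nf (i mod int n) s = nf 0 False" by (simp add: nf_mod nf_simps)
  moreover have "inj_on (\<lambda>(i, s). nf i s) ({0..<int n} \<times> UNIV)"
    using bij_betw_nf[OF assms] by (simp add: bij_betw_def)
  ultimately have "(i mod int n, s) = (0, False)"
    using assms by (auto dest!: inj_onD[where x = "(i mod int n, s)" and y = "(0, False)"])
  then show "int n dvd i \<and> \<not> s" by auto
qed (use nf_eq_one in auto)

lemma signed_sum_of_one_product_seq:
  assumes "n > 0" "one_product_seq G (image_mset (\<lambda>e. nf (fst e) (snd e)) T)"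
  shows "even (refls T) \<and> (\<exists>s t. signed_sum T s t \<and> int n dvd s)"
proof -
  obtain gs where gs: "mset gs = image_mset (\<lambda>e. nf (fst e) (snd e)) T"
    and one: "foldr (mult G) gs \<one> = \<one>" using assms(2) unfolding one_product_seq_def by blast
  obtain w where w: "mset w = T" "gs = map (\<lambda>e. nf (fst e) (snd e)) w"
    using gs by (rule mset_eq_image_mset_obtain)
  show ?thesis
    using one unfolding w foldr_mult_nf nf_eq_one_iff[OF assms(1)]
    using signed_sum_word_value[of w] snd_word_value[of w] w by auto
qed

end

subsection \<open>Periods and growth of sets of residues\<close>

definition residues_in :: "nat \<Rightarrow> int set \<Rightarrow> int set" where
  "residues_in M A = (\<lambda>a. a mod int M) ` A"

lemma finite_residues_in: "M > 0 \<Longrightarrow> finite (residues_in M A)"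
  by (rule finite_subset[of _ "{0..<int M}"]) (auto simp: residues_in_def)

lemma residues_in_subset: "M > 0 \<Longrightarrow> residues_in M A \<subseteq> {0..<int M}"
  by (auto simp: residues_in_def)

lemma card_residues_in_le: "M > 0 \<Longrightarrow> card (residues_in M A) \<le> M"
  using card_mono[OF _ residues_in_subset, of M A] by simp

text \<open>Membership in the stabilizer of \<open>A\<close> modulo \<open>M\<close>. Requiring only
  an inclusion loses nothing, because a translation permutes the finitely many residues.\<close>

definition period :: "nat \<Rightarrow> int set \<Rightarrow> int \<Rightarrow> bool" where
  "period M A x \<longleftrightarrow> (\<lambda>a. a + x) ` A \<subseteq> {b. \<exists>a\<in>A. int M dvd b - a}"

lemma periodD: "period M A x \<Longrightarrow> a \<in> A \<Longrightarrow> \<exists>b\<in>A. int M dvd a + x - b"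
  by (auto simp: period_def)

lemma periodI: "(\<And>a. a \<in> A \<Longrightarrow> \<exists>b\<in>A. int M dvd a + x - b) \<Longrightarrow> period M A x"
  by (auto simp: period_def)

lemma period_self: "period M A (int M)"
proof (rule periodI)
  fix a assume "a \<in> A"
  then show "\<exists>b\<in>A. int M dvd a + int M - b" by (intro bexI[of _ a]) auto
qed

lemma period_0: "period M A 0"
  by (auto intro!: periodI bexI)

lemma period_add:
  assumes "period M A x" "period M A y"
  shows "period M A (x + y)"
proof (rule periodI)
  fix a assume "a \<in> A"
  then obtain b where b: "b \<in> A" "int M dvd a + x - b" using periodD[OF assms(1)] by blast
  then obtain c where c: "c \<in> A" "int M dvd b + y - c" using periodD[OF assms(2)] by blast
  have "a + (x + y) - c = (a + x - b) + (b + y - c)" by simp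
  then show "\<exists>b\<in>A. int M dvd a + (x + y) - b" using b c by (metis dvd_add)
qed

lemma period_times_nat: "period M A x \<Longrightarrow> period M A (int j * x)"
  by (induction j) (auto simp: period_0 algebra_simps intro: period_add)

lemma period_cong:
  assumes "period M A x" "int M dvd x - y"
  shows "period M A y"
proof (rule periodI)
  fix a assume "a \<in> A"
  then obtain b where b: "b \<in> A" "int M dvd a + x - b" using periodD[OF assms(1)] by blast
  have "a + y - b = (a + x - b) - (x - y)" by simp
  then show "\<exists>b\<in>A. int M dvd a + y - b" using b assms(2) by (metis dvd_diff)
qed

text \<open>\<open>- x\<close> is congruent to the nonnegative multiple \<open>(M - 1) * x\<close>,
  so closure under addition is enough.\<close>

lemma period_uminus:
  assumes "M > 0" "period M A x"
  shows "period M A (- x)"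
proof (rule period_cong)
  show "period M A (int (M - 1) * x)" by (rule period_times_nat[OF assms(2)])
  have "int (M - 1) * x - - x = int M * x" using assms(1) by (simp add: algebra_simps)
  then show "int M dvd int (M - 1) * x - - x" by simp
qed

lemma period_mult:
  assumes "M > 0" "period M A x" "x dvd y"
  shows "period M A y"
proof -
  obtain c where c: "y = x * c" using assms(3) by blast
  show ?thesis
  proof (cases "c \<ge> 0")
    case True
    then show ?thesis using period_times_nat[OF assms(2), of "nat c"] c by (simp add: mult.commute)
  next
    case False
    then show ?thesis
      using period_times_nat[OF period_uminus[OF assms(1,2)], of "nat (- c)"] c
      by (simp add: mult.commute)
  qed
qed

text \<open>The stabilizer is a subgroup of the integers containing \<open>M\<close>; division with
  remainder shows that its least positive element generates it.\<close>

lemma ex_least_period: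
  assumes "M > 0"
  obtains h where "h > 0" "h dvd M" "\<And>x. period M A x \<longleftrightarrow> int h dvd x"
proof -
  define h where "h = (LEAST h. h > 0 \<and> period M A (int h))"
  have ex: "\<exists>h. h > 0 \<and> period M A (int h)" using assms period_self by blast
  have h: "h > 0" "period M A (int h)" using LeastI_ex[OF ex] by (auto simp: h_def)
  have "int h dvd x" if x: "period M A x" for x
  proof (rule ccontr)
    assume "\<not> int h dvd x"
    then have pos: "x mod int h \<noteq> 0" by auto
    have "x mod int h = x + - (int h * (x div int h))" by (simp add: minus_mult_div_eq_mod)
    moreover have "period M A (- (int h * (x div int h)))"
      by (rule period_mult[OF assms h(2)]) simp
    ultimately have "period M A (x mod int h)" using period_add[OF x] by metis
    moreover have "x mod int h \<ge> 0" "x mod int h < int h" using h(1) by auto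
    ultimately have "nat (x mod int h) > 0 \<and> period M A (int (nat (x mod int h)))"
      using pos by auto
    then have "h \<le> nat (x mod int h)" unfolding h_def by (rule Least_le)
    then show False using \<open>x mod int h < int h\<close> \<open>x mod int h \<ge> 0\<close> by linarith
  qed
  then have iff: "period M A x \<longleftrightarrow> int h dvd x" for x using period_mult[OF assms h(2)] by blast
  then have "h dvd M" using period_self[of M A] by simp
  then show ?thesis using that h(1) iff by blast
qed

text \<open>A set with period \<open>h\<close> is a union of full classes modulo \<open>h\<close>,
  and each class splits into \<open>M div h\<close> residues modulo \<open>M\<close>.\<close>

lemma residues_in_card_periodic:
  assumes "M > 0" "h dvd M" "period M A (int h)"
  shows "card (residues_in M A) = (M div h) * card (residues_in h A)"
proof -
  have h0: "h > 0" using assms(1,2) by (auto intro: Nat.gr0I)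
  obtain q where M: "M = h * q" using assms(2) by blast
  have q: "M div h = q" using M h0 by simp
  define f where "f = (\<lambda>(i, a). a + int h * i)"
  have "bij_betw f ({0..<int q} \<times> residues_in h A) (residues_in M A)"
    unfolding bij_betw_def
  proof
    show "inj_on f ({0..<int q} \<times> residues_in h A)"
    proof (rule inj_onI, clarify)
      fix i a j b
      assume *: "a \<in> residues_in h A" "b \<in> residues_in h A" "f (i, a) = f (j, b)"
      then have ab: "0 \<le> a" "a < int h" "0 \<le> b" "b < int h"
        using residues_in_subset[OF h0, of A] by auto
      have "(a + int h * i) mod int h = (b + int h * j) mod int h"
        using * by (simp add: f_def)
      then have "a = b" using ab by simp
      then show "i = j \<and> a = b" using * h0 by (simp add: f_def)
    qed
    show "f ` ({0..<int q} \<times> residues_in h A) = residues_in M A"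
    proof
      show "f ` ({0..<int q} \<times> residues_in h A) \<subseteq> residues_in M A"
      proof clarify
        fix i b assume i: "i \<in> {0..<int q}" and "b \<in> residues_in h A"
        then obtain a where a: "a \<in> A" "b = a mod int h" by (auto simp: residues_in_def)
        have b: "0 \<le> b" "b < int h" using a h0 by auto
        have "int h dvd b + int h * i - a" using a(2)
          by (metis add_diff_eq dvd_add dvd_triv_left mod_eq_dvd_iff mod_mod_trivial add.commute)
        then have "period M A (b + int h * i - a)" by (rule period_mult[OF assms(1,3)])
        then obtain c where c: "c \<in> A" "int M dvd b + int h * i - c"
          using periodD[OF _ a(1)] by fastforce
        have "b + int h * i < int M"
        proof -
          have "int h * i \<le> int h * (int q - 1)" using i by (intro mult_left_mono) auto
          then show ?thesis using b(2) M by (simp add: algebra_simps)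
        qed
        moreover have "0 \<le> b + int h * i" using b i by auto
        ultimately have "b + int h * i = c mod int M"
          using c(2) by (metis mod_eq_dvd_iff mod_pos_pos_trivial)
        then show "f (i, b) \<in> residues_in M A" using c(1) by (auto simp: f_def residues_in_def)
      qed
      show "residues_in M A \<subseteq> f ` ({0..<int q} \<times> residues_in h A)"
      proof
        fix b assume "b \<in> residues_in M A"
        then obtain a where a: "a \<in> A" "b = a mod int M" by (auto simp: residues_in_def)
        have b: "0 \<le> b" "b < int M" using a assms(1) by auto
        have "b mod int h = a mod int h" using a(2) assms(2) by (simp add: mod_mod_cancel)
        then have "b mod int h \<in> residues_in h A" using a(1) by (auto simp: residues_in_def)
        moreover have "b div int h \<in> {0..<int q}"
        proof -
          have "int h * (b div int h) = b - b mod int h" by (simp add: minus_mod_eq_mult_div)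
          then have "int h * (b div int h) \<le> b" using h0 by simp
          also have "b < int h * int q" using b M by simp
          finally show ?thesis using h0 b(1) by (simp add: pos_imp_zdiv_nonneg_iff)
        qed
        moreover have "b = f (b div int h, b mod int h)" by (simp add: f_def)
        ultimately show "b \<in> f ` ({0..<int q} \<times> residues_in h A)" by blast
      qed
    qed
  qed
  then have "card (residues_in M A) = card ({0..<int q} \<times> residues_in h A)"
    by (simp add: bij_betw_same_card)
  then show ?thesis by (simp add: card_cartesian_product q)
qed

lemma card_residues_in_shift:
  assumes "M > 0"
  shows "card (residues_in M ((\<lambda>a. a + x) ` A)) = card (residues_in M A)"
proof -
  have "residues_in M ((\<lambda>a. a + x) ` A) = (\<lambda>r. (r + x) mod int M) ` residues_in M A"
    by (auto simp: residues_in_def image_image mod_simps)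
  moreover have "inj_on (\<lambda>r. (r + x) mod int M) (residues_in M A)"
  proof (rule inj_onI)
    fix r s assume rs: "r \<in> residues_in M A" "s \<in> residues_in M A"
      "(r + x) mod int M = (s + x) mod int M"
    then have "int M dvd r - s" by (simp add: mod_eq_dvd_iff)
    moreover have "r mod int M = r" "s mod int M = s"
      using rs residues_in_subset[OF assms, of A] by auto
    ultimately show "r = s" by (metis mod_eq_dvd_iff)
  qed
  ultimately show ?thesis by (simp add: card_image)
qed

text \<open>If the translate by \<open>u\<close> lay inside the one by \<open>v\<close>, then
  \<open>u - v\<close> would be a period. Hence \<open>B\<close> contains the translate by
  \<open>v\<close> and a further residue.\<close>

lemma card_residues_in_expand:
  assumes "M > 0" "\<not> period M A (u - v)"
    and "(\<lambda>a. a + u) ` A \<subseteq> B" "(\<lambda>a. a + v) ` A \<subseteq> B"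
  shows "card (residues_in M A) < card (residues_in M B)"
proof -
  let ?P = "residues_in M ((\<lambda>a. a + u) ` A)" and ?Q = "residues_in M ((\<lambda>a. a + v) ` A)"
  have sub: "?P \<subseteq> residues_in M B" "?Q \<subseteq> residues_in M B"
    using assms(3,4) by (auto simp: residues_in_def)
  have fin: "finite (residues_in M B)" by (rule finite_residues_in[OF assms(1)])
  have "card ?P = card (residues_in M A)" "card ?Q = card (residues_in M A)"
    by (simp_all only: card_residues_in_shift[OF assms(1)])
  moreover have "\<not> ?P \<subseteq> ?Q"
  proof
    assume PQ: "?P \<subseteq> ?Q"
    have "period M A (u - v)"
    proof (rule periodI)
      fix a assume "a \<in> A"
      then have "(a + u) mod int M \<in> ?P" by (auto simp: residues_in_def)
      then obtain b where "b \<in> A" "(a + u) mod int M = (b + v) mod int M"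
        using PQ by (auto simp: residues_in_def)
      then have "b \<in> A" "int M dvd a + u - (b + v)" by (simp_all add: mod_eq_dvd_iff)
      then show "\<exists>b\<in>A. int M dvd a + (u - v) - b" by (auto simp: algebra_simps)
    qed
    then show False using assms(2) by simp
  qed
  then obtain p where "p \<in> ?P" "p \<notin> ?Q" by blast
  then have "insert p ?Q \<subseteq> residues_in M B" using sub by blast
  then have "card (insert p ?Q) \<le> card (residues_in M B)" by (rule card_mono[OF fin])
  moreover have "card (insert p ?Q) = Suc (card ?Q)"
    using \<open>p \<notin> ?Q\<close> finite_residues_in[OF assms(1)] by simp
  ultimately show ?thesis by simp
qed

section \<open>Growth of the set of signed sums\<close>

definition balanced_sums :: "(int \<times> bool) multiset \<Rightarrow> int set" where
  "balanced_sums T = {s. signed_sum T s 0}"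

lemma balanced_sums_add_mset_rotation:
  assumes "\<not> snd e"
  shows "balanced_sums (add_mset e T) = (\<lambda>a. a + fst e) ` balanced_sums T \<union> (\<lambda>a. a - fst e) ` balanced_sums T"
proof -
  have "s \<in> balanced_sums (add_mset e T) \<longleftrightarrow> s - fst e \<in> balanced_sums T \<or> s + fst e \<in> balanced_sums T" for s
    using signed_sum_add_mset_rotation[OF assms] by (simp add: balanced_sums_def)
  moreover have "s \<in> (\<lambda>a. a + fst e) ` balanced_sums T \<longleftrightarrow> s - fst e \<in> balanced_sums T"
    "s \<in> (\<lambda>a. a - fst e) ` balanced_sums T \<longleftrightarrow> s + fst e \<in> balanced_sums T" for s
    by (force simp: image_iff)+
  ultimately show ?thesis by blast
qed

lemma balanced_sums_nonempty: "refls T = 0 \<Longrightarrow> balanced_sums T \<noteq> {}"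
  using signed_sum_self[of T] by (auto simp: balanced_sums_def)

lemma balanced_sums_add: "a \<in> balanced_sums T \<Longrightarrow> b \<in> balanced_sums T' \<Longrightarrow> a + b \<in> balanced_sums (T + T')"
  using signed_sum_add[of T a 0 T' b 0] by (simp add: balanced_sums_def)

text \<open>A period of the sums stays a period when an element is added, so the absence of nonzero
  periods modulo \<open>h\<close> passes to all sub-multisets. The translates by
  \<open>fst e\<close> and \<open>- fst e\<close> differ by \<open>2 * fst e\<close>, which is no
  period for odd \<open>h\<close> unless \<open>h\<close> divides \<open>fst e\<close>; every other
  element therefore gains a residue.\<close>

lemma card_balanced_sums_ge:
  assumes "h > 0" "odd h" "refls Q = 0"
    and "\<And>x. period h (balanced_sums Q) x \<Longrightarrow> int h dvd x"
  shows "card (residues_in h (balanced_sums Q)) \<ge> Suc (size (filter_mset (\<lambda>e. \<not> int h dvd fst e) Q))"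
  using assms(3,4)
proof (induction Q)
  case empty
  have "balanced_sums {#} = {0}" by (auto simp: balanced_sums_def)
  then show ?case by (simp add: residues_in_def)
next
  case (add e Q)
  then have e: "\<not> snd e" and Q: "refls Q = 0" by (auto split: if_splits)
  note S = balanced_sums_add_mset_rotation[OF e]
  have per: "period h (balanced_sums (add_mset e Q)) x" if px: "period h (balanced_sums Q) x" for x
  proof (rule periodI)
    fix a assume "a \<in> balanced_sums (add_mset e Q)"
    then obtain c where c: "c \<in> balanced_sums Q" "a = c + fst e \<or> a = c - fst e" by (auto simp: S)
    obtain b where b: "b \<in> balanced_sums Q" "int h dvd c + x - b" using periodD[OF px c(1)] by blast
    from c(2) show "\<exists>b\<in>balanced_sums (add_mset e Q). int h dvd a + x - b"
    proof
      assume "a = c + fst e"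
      then show ?thesis using b by (intro bexI[of _ "b + fst e"]) (auto simp: S algebra_simps)
    next
      assume "a = c - fst e"
      then show ?thesis using b by (intro bexI[of _ "b - fst e"]) (auto simp: S algebra_simps)
    qed
  qed
  have IH: "card (residues_in h (balanced_sums Q)) \<ge> Suc (size (filter_mset (\<lambda>e. \<not> int h dvd fst e) Q))"
    by (rule add.IH[OF Q]) (use add.prems(2) per in blast)
  show ?case
  proof (cases "int h dvd fst e")
    case True
    have "residues_in h ((\<lambda>a. a + fst e) ` balanced_sums Q) \<subseteq> residues_in h (balanced_sums (add_mset e Q))"
      unfolding residues_in_def S by blast
    then have "card (residues_in h (balanced_sums Q)) \<le> card (residues_in h (balanced_sums (add_mset e Q)))"
      using card_mono[OF finite_residues_in[OF assms(1)]] card_residues_in_shift[OF assms(1)] by metis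
    then show ?thesis using IH True by simp
  next
    case False
    have "\<not> period h (balanced_sums Q) (2 * fst e)"
    proof
      assume "period h (balanced_sums Q) (2 * fst e)"
      then have "int h dvd 2 * fst e" using add.prems(2) per by blast
      moreover have "coprime (int h) 2" using assms(2) by simp
      ultimately show False using False coprime_dvd_mult_right_iff by blast
    qed
    then have "\<not> period h (balanced_sums Q) (fst e - - fst e)" by simp
    then have "card (residues_in h (balanced_sums Q)) < card (residues_in h (balanced_sums (add_mset e Q)))"
      by (rule card_residues_in_expand[OF assms(1)]) (auto simp: S)
    then show ?thesis using IH False by simp
  qed
qed

subsection \<open>The Erdos-Ginzburg-Ziv theorem\<close>

definition egz :: "nat \<Rightarrow> bool" where
  "egz N \<longleftrightarrow>
     (\<forall>M :: int multiset. size M \<ge> 2 * N - 1 \<longrightarrow>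
        (\<exists>B. B \<subseteq># M \<and> size B = N \<and> int N dvd sum_mset B))"

text \<open>Each extraction removes \<open>N\<close> elements and needs \<open>2 * N - 1\<close> to
  be present, so \<open>(c + 1) * N - 1\<close> elements yield \<open>c\<close> disjoint
  blocks.\<close>

lemma egz_blocks:
  assumes "egz N" "N > 0"
  shows "size M \<ge> (c + 1) * N - 1 \<Longrightarrow>
    \<exists>Bs. size Bs = c \<and> sum_mset Bs \<subseteq># M \<and> (\<forall>B\<in>#Bs. size B = N \<and> int N dvd sum_mset B)"
proof (induction c arbitrary: M)
  case (Suc c)
  have "2 * N - 1 \<le> (Suc c + 1) * N - 1" by (simp add: diff_le_mono)
  then obtain B where B: "B \<subseteq># M" "size B = N" "int N dvd sum_mset B"
    using assms(1) Suc.prems unfolding egz_def by (meson le_trans)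
  have "size (M - B) \<ge> (c + 1) * N - 1"
    using Suc.prems B by (simp add: size_Diff_submset)
  then obtain Bs where Bs: "size Bs = c" "sum_mset Bs \<subseteq># M - B"
    "\<forall>B\<in>#Bs. size B = N \<and> int N dvd sum_mset B" using Suc.IH by blast
  then have "sum_mset (add_mset B Bs) \<subseteq># M"
    using subset_mset.le_diff_conv2[OF B(1)] by (simp add: add.commute)
  then show ?case using Bs B by (intro exI[of _ "add_mset B Bs"]) auto
qed (auto intro: exI[of _ "{#}"])

lemma sum_mset_sum_mset: "sum_mset (sum_mset Bs) = (\<Sum>B\<in>#Bs. sum_mset B)"
  for Bs :: "int multiset multiset"
  by (induction Bs) auto

lemma size_sum_mset_const: "\<forall>B\<in>#Bs. size B = N \<Longrightarrow> size (sum_mset Bs) = size Bs * N"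
  for Bs :: "'a multiset multiset"
  by (induction Bs) auto

lemma sum_mset_mono_subset: "Y \<subseteq># X \<Longrightarrow> sum_mset Y \<subseteq># sum_mset X"
  for X :: "'a multiset multiset"
  by (metis mset_subset_eq_exists_conv sum_mset.union mset_subset_eq_add_left)

lemma subset_image_mset_obtain:
  assumes "B \<subseteq># image_mset g X"
  obtains Y where "Y \<subseteq># X" "B = image_mset g Y"
proof -
  obtain C where "image_mset g X = B + C" using assms by (metis mset_subset_eq_exists_conv)
  then obtain B' C' where "X = B' + C'" "B = image_mset g B'"
    using image_mset_eq_plusD by blast
  then show ?thesis using that[of B'] by simp
qed

text \<open>The property for \<open>N'\<close> is applied to the block sums divided by
  \<open>N\<close>; the union of the \<open>N'\<close> selected blocks is the required
  multiset.\<close>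

lemma egz_mult:
  assumes "egz N" "egz N'" "N > 0" "N' > 0"
  shows "egz (N * N')"
  unfolding egz_def
proof (intro allI impI)
  fix M :: "int multiset" assume M: "size M \<ge> 2 * (N * N') - 1"
  have "(2 * N' - 1 + 1) * N - 1 = 2 * (N * N') - 1" using assms(4) by (simp add: ac_simps)
  then obtain Bs where Bs: "size Bs = 2 * N' - 1" "sum_mset Bs \<subseteq># M"
    "\<forall>B\<in>#Bs. size B = N \<and> int N dvd sum_mset B"
    using egz_blocks[OF assms(1,3), of "2 * N' - 1" M] M by auto
  define g where "g B = sum_mset B div int N" for B :: "int multiset"
  have "size (image_mset g Bs) \<ge> 2 * N' - 1" using Bs(1) by simp
  then obtain D where D: "D \<subseteq># image_mset g Bs" "size D = N'" "int N' dvd sum_mset D"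
    using assms(2) unfolding egz_def by blast
  then obtain Cs where Cs: "Cs \<subseteq># Bs" "D = image_mset g Cs"
    using subset_image_mset_obtain by blast
  have CsB: "\<forall>B\<in>#Cs. size B = N \<and> int N dvd sum_mset B"
    using Bs(3) Cs(1) by (meson mset_subset_eqD)
  have "sum_mset (sum_mset Cs) = (\<Sum>B\<in>#Cs. int N * g B)"
    unfolding sum_mset_sum_mset
    by (intro arg_cong[where f = sum_mset] image_mset_cong) (use CsB in \<open>auto simp: g_def\<close>)
  also have "\<dots> = int N * sum_mset D" by (simp add: Cs(2) sum_mset_distrib_left)
  finally have "int (N * N') dvd sum_mset (sum_mset Cs)" using D(3) by simp
  moreover have "size (sum_mset Cs) = N * N'"
    using size_sum_mset_const[of Cs N] CsB D(2) Cs(2) by simp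
  moreover have "sum_mset Cs \<subseteq># M"
    using sum_mset_mono_subset[OF Cs(1)] Bs(2) by (rule subset_mset.order_trans)
  ultimately show "\<exists>B. B \<subseteq># M \<and> size B = N * N' \<and> int (N * N') dvd sum_mset B" by blast
qed

lemma image_nth_subset:
  assumes "I \<subseteq> {..<length xs}"
  shows "image_mset (nth xs) (mset_set I) \<subseteq># mset xs"
proof -
  have "mset xs = image_mset (nth xs) (mset_set {..<length xs})"
    by (metis map_nth mset_map mset_upt lessThan_atLeast0)
  moreover have "mset_set I \<subseteq># mset_set {..<length xs}"
    using assms by (simp add: finite_subset subset_imp_msubset_mset_set)
  ultimately show ?thesis by (simp add: image_mset_subseteq_mono)
qed

text \<open>The stabilizer is a subgroup of a group of prime order. Were it the whole group, the
  nonempty \<open>A\<close> would meet every residue class.\<close>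

lemma prime_not_period:
  assumes "prime p" "A \<noteq> {}" "card (residues_in p A) < p" "\<not> int p dvd x"
  shows "\<not> period p A x"
proof
  assume per: "period p A x"
  have p0: "p > 0" using assms(1) prime_gt_0_nat by blast
  obtain h where h: "h > 0" "h dvd p" "\<And>x. period p A x \<longleftrightarrow> int h dvd x"
    using ex_least_period[OF p0, of A] by blast
  have "h = 1 \<or> h = p" using assms(1) h(2) by (auto simp: prime_nat_iff)
  then show False
  proof
    assume "h = 1"
    then have "card (residues_in p A) = p * card (residues_in 1 A)"
      using residues_in_card_periodic[OF p0 h(2)] h(3) by simp
    moreover have "residues_in 1 A = {0}" using assms(2) by (auto simp: residues_in_def)
    ultimately show False using assms(3) by simp
  next
    assume "h = p"
    then show False using h(3) per assms(4) by blast
  qed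
qed

lemma egz_prime:
  assumes p: "prime p"
  shows "egz p"
  unfolding egz_def
proof (intro allI impI)
  fix M :: "int multiset" assume M: "size M \<ge> 2 * p - 1"
  have p2: "p \<ge> 2" using p prime_ge_2_nat by blast
  define f where "f = (\<lambda>x. x mod int p)"
  define xs where "xs = sort_key f (sorted_list_of_multiset M)"
  have mset: "mset xs = M" by (simp add: xs_def)
  then have len: "length xs \<ge> 2 * p - 1" using M by (metis size_mset)
  have mono: "f (xs ! i) \<le> f (xs ! j)" if "i \<le> j" "j < length xs" for i j
    using sorted_nth_mono[of "map f xs" i j] that by (simp add: xs_def)
  show "\<exists>B. B \<subseteq># M \<and> size B = p \<and> int p dvd sum_mset B"
  \<comment> \<open>In the order of residues, equal residues at distance \<open>p - 1\<close>
    enclose \<open>p\<close> equal ones. Otherwise the \<open>p - 1\<close> disjoint pairs of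
    positions \<open>i\<close> and \<open>i + (p - 1)\<close> each offer two different
    residues.\<close>
  proof (cases "\<exists>i<p - 1. f (xs ! i) = f (xs ! (i + (p - 1)))")
    case True
    then obtain i where i: "i < p - 1" "f (xs ! i) = f (xs ! (i + (p - 1)))" by blast
    define B where "B = image_mset (nth xs) (mset_set {i..<i + p})"
    have "f (xs ! j) = f (xs ! i)" if "j \<in> {i..<i + p}" for j
      using mono[of i j] mono[of j "i + (p - 1)"] that i len by (intro antisym) auto
    then have "int p dvd xs ! j - xs ! i" if "j \<in> {i..<i + p}" for j
      using that by (simp add: f_def mod_eq_dvd_iff)
    then have "int p dvd (\<Sum>j\<in>{i..<i + p}. xs ! j - xs ! i)" by (intro dvd_sum) auto
    moreover have "sum_mset B = (\<Sum>j\<in>{i..<i + p}. xs ! j)"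
      by (simp add: B_def sum_unfold_sum_mset)
    ultimately have "int p dvd sum_mset B - int p * xs ! i" by (simp add: sum_subtractf)
    then have "int p dvd sum_mset B" by (metis dvd_diff_left_iff dvd_triv_left)
    moreover have "B \<subseteq># M" unfolding B_def mset[symmetric]
      using i len p2 by (intro image_nth_subset) auto
    ultimately show ?thesis by (intro exI[of _ B]) (simp add: B_def)
  next
    case False
    \<comment> \<open>\<open>A j\<close> contains all sums taking one entry from each of the first
      \<open>j\<close> pairs. Prescribing only the cardinality of \<open>I\<close> suffices, as only
      the number of summands matters in the end.\<close>
    define ok where "ok j I \<longleftrightarrow> I \<subseteq> {..<j} \<union> {p - 1..<j + (p - 1)} \<and> card I = j" for j I
    define A where "A j = {\<Sum>i\<in>I. xs ! i |I. ok j I}" for j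
    have A_Suc: "(\<lambda>a. a + xs ! i) ` A j \<subseteq> A (Suc j)"
      if "i = j \<or> i = j + (p - 1)" "j < p - 1" for i j
    proof
      fix a assume "a \<in> (\<lambda>a. a + xs ! i) ` A j"
      then obtain I where I: "ok j I" "a = (\<Sum>i\<in>I. xs ! i) + xs ! i" by (auto simp: A_def)
      have "finite I" using I(1) by (auto simp: ok_def intro: finite_subset)
      moreover have "i \<notin> I" using I(1) that by (auto simp: ok_def)
      ultimately have "a = (\<Sum>i\<in>insert i I. xs ! i)" "card (insert i I) = Suc j"
        using I by (auto simp: ok_def)
      moreover have "insert i I \<subseteq> {..<Suc j} \<union> {p - 1..<Suc j + (p - 1)}"
        using I(1) that by (auto simp: ok_def)
      ultimately show "a \<in> A (Suc j)" by (auto simp: A_def ok_def)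
    qed
    have ne: "A j \<noteq> {}" if "j \<le> p - 1" for j
      unfolding A_def ok_def by (auto intro!: exI[of _ "{..<j}"])
    have grow: "card (residues_in p (A j)) \<ge> Suc j" if "j \<le> p - 1" for j
      using that
    proof (induction j)
      case 0
      have "A 0 = {0}" by (auto simp: A_def ok_def)
      then show ?case by (simp add: residues_in_def)
    next
      case (Suc j)
      then have j: "j < p - 1" and IH: "Suc j \<le> card (residues_in p (A j))" by auto
      have p0: "p > 0" using p2 by simp
      show ?case
      proof (cases "card (residues_in p (A j)) < p")
        case True
        have "f (xs ! j) \<noteq> f (xs ! (j + (p - 1)))" using False j by blast
        then have "\<not> int p dvd xs ! j - xs ! (j + (p - 1))" by (simp add: f_def mod_eq_dvd_iff)
        then have "\<not> period p (A j) (xs ! j - xs ! (j + (p - 1)))"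
          using prime_not_period[OF p ne True] j by auto
        then have "card (residues_in p (A j)) < card (residues_in p (A (Suc j)))"
          by (rule card_residues_in_expand[OF p0]) (use A_Suc j in auto)
        then show ?thesis using IH by simp
      next
        case False
        have "residues_in p ((\<lambda>a. a + xs ! j) ` A j) \<subseteq> residues_in p (A (Suc j))"
          using A_Suc[of j j] j unfolding residues_in_def by (intro image_mono) auto
        then have "card (residues_in p (A j)) \<le> card (residues_in p (A (Suc j)))"
          using card_mono[OF finite_residues_in[OF p0]] card_residues_in_shift[OF p0] by metis
        then show ?thesis using False j by simp
      qed
    qed
    \<comment> \<open>This entry belongs to no pair, and some sum in \<open>A (p - 1)\<close> is
      congruent to \<open>- e\<close>, as these sums meet every residue.\<close>
    define e where "e = xs ! (2 * p - 2)"
    have "residues_in p (A (p - 1)) = {0..<int p}"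
      using grow[of "p - 1"] p2 residues_in_subset[of p "A (p - 1)"] card_residues_in_le[of p "A (p - 1)"]
      by (intro card_subset_eq) auto
    then have "(- e) mod int p \<in> residues_in p (A (p - 1))" using p2 by simp
    then obtain I where I: "ok (p - 1) I" "(- e) mod int p = (\<Sum>i\<in>I. xs ! i) mod int p"
      by (auto simp: residues_in_def A_def)
    have fin: "finite I" using I(1) by (auto simp: ok_def intro: finite_subset)
    have I_lt: "i < 2 * p - 2" if "i \<in> I" for i
    proof -
      have "i < p - 1 \<or> i < (p - 1) + (p - 1)" using I(1) that by (auto simp: ok_def)
      then show ?thesis using p2 by linarith
    qed
    then have nin: "2 * p - 2 \<notin> I" by blast
    define B where "B = image_mset (nth xs) (mset_set (insert (2 * p - 2) I))"
    have "sum_mset B = e + (\<Sum>i\<in>I. xs ! i)"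
      using fin nin by (simp add: B_def e_def sum_unfold_sum_mset)
    moreover have "int p dvd - e - (\<Sum>i\<in>I. xs ! i)" using I(2) by (simp add: mod_eq_dvd_iff)
    then have "int p dvd - (- e - (\<Sum>i\<in>I. xs ! i))" by (simp only: dvd_minus_iff)
    ultimately have "int p dvd sum_mset B" by (simp add: add.commute)
    moreover have "size B = p" using I(1) fin nin p2 by (simp add: B_def ok_def)
    moreover have "insert (2 * p - 2) I \<subseteq> {..<length xs}"
      using I_lt len p2 by fastforce
    then have "B \<subseteq># M" unfolding B_def mset[symmetric] by (rule image_nth_subset)
    ultimately show ?thesis by blast
  qed
qed

theorem erdos_ginzburg_ziv: "N > 0 \<Longrightarrow> egz N"
proof (induction N rule: less_induct)
  case (less N)
  show ?case
  proof (cases "N = 1")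
    case True
    have "\<exists>B. B \<subseteq># M \<and> size B = 1" if "size M \<ge> 1" for M :: "int multiset"
    proof -
      have "M \<noteq> {#}" using that by auto
      then obtain a where "a \<in># M" by blast
      then show ?thesis by (intro exI[of _ "{#a#}"]) simp
    qed
    then show ?thesis using True by (auto simp: egz_def)
  next
    case False
    then obtain p where p: "prime p" "p dvd N" using prime_factor_nat by blast
    then obtain q where q: "N = p * q" by blast
    have "q > 0" "q < N" using q less.prems p(1) prime_gt_1_nat[of p] by (auto intro: Nat.gr0I)
    then have "egz q" using less.IH by blast
    then show ?thesis unfolding q
      using egz_mult[OF egz_prime[OF p(1)]] p(1) \<open>q > 0\<close> prime_gt_0_nat by blast
  qed
qed

text \<open>After division of the exponents by \<open>g\<close>, the \<open>(g + 1) * N - 1\<close>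
  elements yield \<open>g\<close> disjoint blocks of length \<open>N\<close> with sums divisible by
  \<open>N\<close>. Multiplying back supplies the missing factor \<open>g\<close>.\<close>

lemma solvable_of_many_rotations:
  assumes "refls Q = 0" "g > 0" "N > 0" "\<forall>e\<in>#Q. int g dvd fst e"
    and "size Q \<ge> g * N + N - 1"
  shows "\<exists>T. T \<subseteq># Q \<and> size T = g * N \<and> solvable (g * N) T"
proof -
  define f where "f e = fst e div int g" for e :: "int \<times> bool"
  have "size (image_mset f Q) \<ge> (g + 1) * N - 1" using assms(5) by (simp add: algebra_simps)
  then obtain Bs where Bs: "size Bs = g" "sum_mset Bs \<subseteq># image_mset f Q"
    "\<forall>B\<in>#Bs. size B = N \<and> int N dvd sum_mset B"
    using egz_blocks[OF erdos_ginzburg_ziv[OF assms(3)] assms(3)] by blast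
  obtain T where T: "T \<subseteq># Q" "sum_mset Bs = image_mset f T"
    using subset_image_mset_obtain[OF Bs(2)] by blast
  have "size T = g * N"
    using size_sum_mset_const[of Bs N] Bs(1,3) T(2) by (metis size_image_mset)
  have "fst e = int g * f e" if "e \<in># T" for e
    using that T(1) assms(4) by (metis dvd_mult_div_cancel f_def mset_subset_eqD)
  then have "wt T = (\<Sum>e\<in>#T. int g * f e)"
    unfolding wt_def by (intro arg_cong[where f = sum_mset] image_mset_cong)
  also have "\<dots> = int g * sum_mset (sum_mset Bs)" by (simp add: T(2) sum_mset_distrib_left)
  also have "\<dots> = int g * (\<Sum>B\<in>#Bs. sum_mset B)" by (simp add: sum_mset_sum_mset)
  finally have "wt T = int g * (\<Sum>B\<in>#Bs. sum_mset B)" .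
  moreover have "int N dvd (\<Sum>B\<in>#Bs. sum_mset B)" using Bs(3) by (induction Bs) auto
  ultimately have "int (g * N) dvd wt T" by simp
  moreover have "refls T = 0" using refls_mono[OF T(1)] assms(1) by simp
  ultimately have "solvable (g * N) T" by (simp add: solvable_def)
  then show ?thesis using T(1) \<open>size T = g * N\<close> by blast
qed

subsection \<open>Covered subgroups\<close>

lemma ex_submset_size:
  assumes "j \<le> size M"
  obtains N where "N \<subseteq># M" "size N = j"
proof -
  obtain xs where xs: "mset xs = M" using ex_mset by blast
  have "mset (take j xs) \<subseteq># mset (take j xs) + mset (drop j xs)" by simp
  then have "mset (take j xs) \<subseteq># mset xs" by (metis append_take_drop_id mset_append)
  moreover have "size (mset (take j xs)) = j" using assms xs by auto
  ultimately show ?thesis using that xs by blast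
qed

lemma submset_union_filter:
  assumes "A \<subseteq># filter_mset P S" "B \<subseteq># filter_mset (\<lambda>e. \<not> P e) S"
  shows "A + B \<subseteq># S"
  using subset_mset.add_mono[OF assms] by (simp flip: multiset_partition)

lemma submset_add_diff: "A \<subseteq># S \<Longrightarrow> B \<subseteq># S - A \<Longrightarrow> A + B \<subseteq># S"
  using subset_mset.le_diff_conv2[of A S B] by (simp add: add.commute)

text \<open>Modulo \<open>l\<close> rotations contribute nothing and each reflection plus or minus
  \<open>b\<close>, so only the excess \<open>t\<close> is visible.\<close>

lemma signed_sum_dvd:
  assumes "\<forall>e\<in>#T. l dvd fst e - (if snd e then b else 0)" "signed_sum T s t"
  shows "l dvd s - b * t"
proof -
  have wt: "l dvd wt T' - b * int (refls T')"
    if "\<forall>e\<in>#T'. l dvd fst e - (if snd e then b else 0)" for T'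
    using that
  proof (induction T')
    case (add e T')
    have "wt (add_mset e T') - b * int (refls (add_mset e T')) =
      (fst e - (if snd e then b else 0)) + (wt T' - b * int (refls T'))"
      by (simp add: algebra_simps)
    moreover have "l dvd (fst e - (if snd e then b else 0)) + (wt T' - b * int (refls T'))"
      using add by (intro dvd_add) auto
    ultimately show ?case by (simp only:)
  qed simp
  obtain T1 T2 where T: "T = T1 + T2" "s = wt T1 - wt T2" "t = int (refls T1) - int (refls T2)"
    using assms(2) unfolding signed_sum_def by blast
  have "s - b * t = (wt T1 - b * int (refls T1)) - (wt T2 - b * int (refls T2))"
    by (simp add: T algebra_simps)
  moreover have "l dvd (wt T1 - b * int (refls T1)) - (wt T2 - b * int (refls T2))"
    using assms(1) by (intro dvd_diff wt) (auto simp: T(1))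
  ultimately show ?thesis by simp
qed

lemma balanced_sums_dvd:
  assumes "\<forall>e\<in>#T. l dvd fst e - (if snd e then b else 0)" "s \<in> balanced_sums T"
  shows "l dvd s"
  using signed_sum_dvd[OF assms(1), of s 0] assms(2) by (simp add: balanced_sums_def)

definition covers :: "nat \<Rightarrow> nat \<Rightarrow> (int \<times> bool) multiset \<Rightarrow> bool" where
  "covers M l U \<longleftrightarrow> (\<forall>x. int l dvd x \<longrightarrow> (\<exists>s\<in>balanced_sums U. int M dvd s - x))"

lemma covers_refl: "covers M M {#}"
  by (auto simp: covers_def balanced_sums_def)

lemma covers_of_period:
  assumes "period M (balanced_sums U) (int l)" "M > 0" "balanced_sums U \<noteq> {}"
    and "\<And>s. s \<in> balanced_sums U \<Longrightarrow> int l dvd s"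
  shows "covers M l U"
  unfolding covers_def
proof (intro allI impI)
  fix x assume x: "int l dvd x"
  obtain a where a: "a \<in> balanced_sums U" using assms(3) by blast
  have "period M (balanced_sums U) (x - a)"
    using period_mult[OF assms(2,1)] x assms(4)[OF a] by simp
  then obtain b where "b \<in> balanced_sums U" "int M dvd x - b"
    using periodD[OF _ a] by fastforce
  then show "\<exists>s\<in>balanced_sums U. int M dvd s - x" by (metis dvd_diff_commute)
qed

text \<open>\<open>V\<close> meets a multiple of \<open>l\<close> up to a multiple of
  \<open>M\<close>, and \<open>U\<close> meets that error modulo \<open>n\<close>.\<close>

lemma covers_trans:
  assumes "covers n M U" "covers M l V"
  shows "covers n l (U + V)"
  unfolding covers_def
proof (intro allI impI)
  fix x assume "int l dvd x"
  then obtain s where s: "s \<in> balanced_sums V" "int M dvd s - x" using assms(2) by (auto simp: covers_def)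
  then have "int M dvd x - s" by (metis dvd_diff_commute)
  then obtain u where u: "u \<in> balanced_sums U" "int n dvd u - (x - s)"
    using assms(1) by (auto simp: covers_def)
  then show "\<exists>s\<in>balanced_sums (U + V). int n dvd s - x"
    using balanced_sums_add[OF u(1) s(1)] by (intro bexI[of _ "u + s"]) (auto simp: algebra_simps)
qed

lemma covers_add:
  assumes "covers n l U" "s \<in> balanced_sums V" "int l dvd s"
  shows "covers n l (U + V)"
  unfolding covers_def
proof (intro allI impI)
  fix x assume "int l dvd x"
  then have "int l dvd x - s" using assms(3) by simp
  then obtain u where u: "u \<in> balanced_sums U" "int n dvd u - (x - s)"
    using assms(1) by (auto simp: covers_def)
  then show "\<exists>s\<in>balanced_sums (U + V). int n dvd s - x"
    using balanced_sums_add[OF u(1) assms(2)] by (intro bexI[of _ "u + s"]) (auto simp: algebra_simps)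
qed

lemma multiples_below:
  assumes "l dvd h" "h > 0"
  shows "{0..<int h} \<inter> {x. int l dvd x} = (\<lambda>i. int (l * i)) ` {..<h div l}"
proof -
  obtain q where q: "h = l * q" using assms(1) by blast
  have l: "l > 0" using q assms(2) by (auto intro: Nat.gr0I)
  show ?thesis
  proof
    show "{0..<int h} \<inter> {x. int l dvd x} \<subseteq> (\<lambda>i. int (l * i)) ` {..<h div l}"
    proof clarify
      fix x assume x: "x \<in> {0..<int h}" "int l dvd x"
      then obtain j where j: "x = int l * j" by blast
      have "j \<ge> 0" using x(1) j l by (simp add: zero_le_mult_iff)
      moreover have "j < int q" using x(1) j l q by simp
      ultimately show "x \<in> (\<lambda>i. int (l * i)) ` {..<h div l}"
        using j q l by (intro image_eqI[of _ _ "nat j"]) auto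
    qed
    show "(\<lambda>i. int (l * i)) ` {..<h div l} \<subseteq> {0..<int h} \<inter> {x. int l dvd x}"
      using q l by auto
  qed
qed

lemma residues_in_multiples_subset:
  assumes "l dvd h" "h > 0" "\<And>a. a \<in> A \<Longrightarrow> int l dvd a"
  shows "residues_in h A \<subseteq> (\<lambda>i. int (l * i)) ` {..<h div l}"
  unfolding multiples_below[OF assms(1,2), symmetric]
  using assms by (auto simp: residues_in_def dvd_mod)

lemma card_residues_in_multiples:
  assumes "l dvd h" "h > 0" "\<And>a. a \<in> A \<Longrightarrow> int l dvd a"
  shows "card (residues_in h A) \<le> h div l"
  using card_mono[OF _ residues_in_multiples_subset[OF assms]] card_image_le[of "{..<h div l}"]
  by (metis (no_types, lifting) card_lessThan finite_imageI finite_lessThan order_trans)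

text \<open>As \<open>h\<close> is a period modulo \<open>M\<close>, a match modulo \<open>h\<close>
  can be corrected within \<open>A\<close> to a match modulo \<open>M\<close>.\<close>

lemma period_lift:
  assumes "M > 0" "period M A (int h)" "period h A x"
  shows "period M A x"
proof (rule periodI)
  fix a assume "a \<in> A"
  then obtain b where b: "b \<in> A" "int h dvd a + x - b" using periodD[OF assms(3)] by blast
  then obtain c where "c \<in> A" "int M dvd b + (a + x - b) - c"
    using periodD[OF period_mult[OF assms(1,2) b(2)] b(1)] by blast
  then show "\<exists>b\<in>A. int M dvd a + x - b" by auto
qed

text \<open>Modulo \<open>M\<close> the period \<open>h\<close> is a difference of two multiples of
  \<open>l\<close>, which gives \<open>l dvd h\<close>. If \<open>A\<close> met all
  \<open>h div l\<close> classes of multiples of \<open>l\<close> modulo \<open>h\<close>, then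
  \<open>l\<close> itself would be a period, against \<open>h \<noteq> l\<close>.\<close>

lemma stabilizer_index_bound:
  assumes "M > 0" "h > 0" "\<And>x. period M A x \<longleftrightarrow> int h dvd x" "A \<noteq> {}"
    and "l dvd M" "\<forall>a\<in>A. int l dvd a" "h \<noteq> l"
  shows "l dvd h" "card (residues_in h A) < h div l"
proof -
  obtain a where a: "a \<in> A" using assms(4) by blast
  have per: "period M A (int h)" using assms(3) by simp
  obtain b where b: "b \<in> A" "int M dvd a + int h - b" using periodD[OF per a] by blast
  have "int l dvd a + int h - b" using b(2) assms(5) dvd_trans int_dvd_int_iff by blast
  moreover have "int h = (a + int h - b) - a + b" by simp
  ultimately show lh: "l dvd h" using bspec[OF assms(6) a] bspec[OF assms(6) b(1)]
    by (metis dvd_add dvd_diff int_dvd_int_iff)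
  show "card (residues_in h A) < h div l"
  proof (rule ccontr)
    assume neg: "\<not> card (residues_in h A) < h div l"
    let ?I = "(\<lambda>i. int (l * i)) ` {..<h div l}"
    note sub = residues_in_multiples_subset[OF lh assms(2) bspec[OF assms(6)]]
    have "card ?I \<le> h div l" using card_image_le[of "{..<h div l}"] by (metis card_lessThan finite_lessThan)
    then have eq: "residues_in h A = ?I"
      using sub neg by (intro card_seteq) auto
    have "period h A (int l)"
    proof (rule periodI)
      fix a assume "a \<in> A"
      then have "int l dvd a + int l" using assms(6) by simp
      then have "(a + int l) mod int h \<in> ?I"
        unfolding multiples_below[OF lh assms(2), symmetric]
        using lh assms(2) by (simp add: dvd_mod)
      then obtain b where "b \<in> A" "(a + int l) mod int h = b mod int h"
        unfolding eq[symmetric] by (auto simp: residues_in_def)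
      then show "\<exists>b\<in>A. int h dvd a + int l - b" by (auto simp: mod_eq_dvd_iff)
    qed
    then have "period M A (int l)" by (rule period_lift[OF assms(1) per])
    then have "h dvd l" using assms(3) by simp
    then show False using lh assms(7) dvd_antisym by blast
  qed
qed

section \<open>Subgroups covered by few rotations\<close>

definition rot_covered :: "nat \<Rightarrow> (int \<times> bool) multiset \<Rightarrow> nat \<Rightarrow> bool" where
  "rot_covered n S g \<longleftrightarrow> g > 0 \<and> g dvd n \<and>
     (\<exists>U. U \<subseteq># filter_mset (\<lambda>e. \<not> snd e \<and> int g dvd fst e) S \<and> size U < n div g \<and> covers n g U)"

lemma rot_covered_self: "n > 0 \<Longrightarrow> rot_covered n S n"
  by (auto simp: rot_covered_def covers_refl intro!: exI[of _ "{#}"])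

text \<open>If some subgroup had too many rotations modulo the largest covered subgroup, then a minimal
  such subgroup would itself be covered.\<close>

lemma few_rotations_outside_covered:
  assumes "n > 0" "odd n" and g: "rot_covered n S g" "\<And>g'. rot_covered n S g' \<Longrightarrow> g \<le> g'"
    and g': "g' dvd g" "g' < g"
  shows "size (filter_mset (\<lambda>e. \<not> snd e \<and> int g' dvd fst e \<and> \<not> int g dvd fst e) S) + 2 \<le> g div g'"
proof (rule ccontr)
  define F where "F h = filter_mset (\<lambda>e. \<not> snd e \<and> int h dvd fst e \<and> \<not> int g dvd fst e) S" for h
  define heavy where "heavy h \<longleftrightarrow> h dvd g \<and> h < g \<and> g div h \<le> size (F h) + 1" for h
  assume "\<not> ?thesis"
  then have "heavy g'" using g' by (simp add: heavy_def F_def)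
  moreover have "\<forall>h. heavy h \<longrightarrow> h < g" by (auto simp: heavy_def)
  ultimately obtain l where l: "heavy l" "\<And>h. heavy h \<Longrightarrow> h \<le> l"
    using ex_has_greatest_nat[of heavy g' id g] by auto
  have g0: "g > 0" "g dvd n" "odd g" using g(1) assms(2) by (auto simp: rot_covered_def)
  have lg: "l dvd g" "l < g" using l(1) by (auto simp: heavy_def)
  have l0: "l > 0" using lg(1) g0(1) by (auto intro: Nat.gr0I)
  have "g div l - 1 \<le> size (F l)" using l(1) by (auto simp: heavy_def)
  then obtain Q where Q: "Q \<subseteq># F l" "size Q = g div l - 1" by (rule ex_submset_size)
  have QF: "\<not> snd e \<and> int l dvd fst e \<and> \<not> int g dvd fst e" if "e \<in># Q" for e
    using mset_subset_eqD[OF Q(1) that] by (simp add: F_def)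
  then have rf: "refls Q = 0" by (auto simp: refls_eq_0_iff)
  define A where "A = balanced_sums Q"
  have A: "A \<noteq> {}" using balanced_sums_nonempty[OF rf] by (simp add: A_def)
  have Al: "\<forall>a\<in>A. int l dvd a"
    using balanced_sums_dvd[of Q "int l" 0] QF by (auto simp: A_def)
  obtain h where h: "h > 0" "h dvd g" "\<And>x. period g A x \<longleftrightarrow> int h dvd x"
    using ex_least_period[OF g0(1), of A] by blast
  have prod: "g div l = (g div h) * (h div l)" if "l dvd h"
    using that h(1,2) l0 by (auto elim!: dvdE)
  show False
  proof (cases "h = l")
    case True
    obtain U where U: "U \<subseteq># filter_mset (\<lambda>e. \<not> snd e \<and> int g dvd fst e) S"
      "size U < n div g" "covers n g U" using g(1) by (auto simp: rot_covered_def)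
    have "covers g l Q"
      using covers_of_period[of g Q l] h(3) A Al True g0(1) by (simp add: A_def)
    then have cov: "covers n l (U + Q)" using covers_trans U(3) by blast
    let ?F = "filter_mset (\<lambda>e. \<not> snd e \<and> int l dvd fst e) S"
    have "filter_mset (\<lambda>e. \<not> snd e \<and> int g dvd fst e) S = filter_mset (\<lambda>e. int g dvd fst e) ?F"
      using lg(1) by (auto simp: filter_filter_mset intro!: filter_mset_cong
        intro: dvd_trans[of "int l" "int g"])
    moreover have "F l = filter_mset (\<lambda>e. \<not> int g dvd fst e) ?F"
      by (auto simp: F_def filter_filter_mset intro!: filter_mset_cong)
    ultimately have sub: "U + Q \<subseteq># ?F"
      using U(1) Q(1) by (intro submset_union_filter) simp_all
    \<comment> \<open>With \<open>u = n div g\<close> and \<open>v = g div l\<close> the size is at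
      most \<open>(u - 1) + (v - 1)\<close>, which is less than \<open>u * v\<close>; so the bound
      in \<open>rot_covered\<close> survives composition.\<close>
    have "n div l = (n div g) * (g div l)" using lg(1) g0(1,2) l0 by (auto elim!: dvdE)
    moreover have "n div g > 0" "g div l > 0"
      using g0 lg l0 assms(1) by (auto simp: div_greater_zero_iff dvd_imp_le)
    ultimately have "size (U + Q) < n div l"
      using U(2) Q(2) mult_le_mono[of 1 "n div g" 1 "g div l"]
      by (cases "n div g"; cases "g div l") auto
    then have "rot_covered n S l"
      using sub cov l0 lg(1) g0(2) by (auto simp: rot_covered_def intro: dvd_trans)
    then show False using g(2) lg(2) by fastforce
  next
    case False
    note sb = stabilizer_index_bound[OF g0(1) h(1,3) A lg(1) Al False]
    have "card (residues_in h A) \<ge> Suc (size (filter_mset (\<lambda>e. \<not> int h dvd fst e) Q))"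
      unfolding A_def
    proof (rule card_balanced_sums_ge[OF h(1) _ rf])
      show "odd h" using h(2) g0(3) by (metis dvd_trans)
      show "int h dvd x" if "period h (balanced_sums Q) x" for x
        using period_lift[OF g0(1), of A h x] h(3) that by (simp add: A_def)
    qed
    then have out: "size (filter_mset (\<lambda>e. \<not> int h dvd fst e) Q) + 2 \<le> h div l" using sb(2) by simp
    have split: "size Q = size (filter_mset (\<lambda>e. int h dvd fst e) Q) + size (filter_mset (\<lambda>e. \<not> int h dvd fst e) Q)"
      by (metis multiset_partition size_union)
    show False
    proof (cases "h = g")
      case True
      \<comment> \<open>All of \<open>Q\<close> lies outside the multiples of \<open>g\<close>, so
        \<open>out\<close> alone contradicts the size of \<open>Q\<close>.\<close>
      then have "size (filter_mset (\<lambda>e. int h dvd fst e) Q) = 0" using QF by auto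
      moreover have "h div l = g div l" using True by simp
      ultimately show False using out split Q(2) by linarith
    next
      case hg: False
      then have "h < g" using h(2) g0(1) by (simp add: dvd_imp_le le_neq_implies_less)
      moreover have "\<not> heavy h" using l(2) sb(1) h(1) False by (metis dvd_imp_le le_antisym)
      ultimately have "size (F h) + 2 \<le> g div h" using h(2) by (auto simp: heavy_def)
      moreover have "filter_mset (\<lambda>e. int h dvd fst e) Q \<subseteq># F h"
      proof -
        have "filter_mset (\<lambda>e. int h dvd fst e) (F l) = F h"
          using sb(1) by (auto simp: F_def filter_filter_mset intro!: filter_mset_cong
            intro: dvd_trans[of "int l" "int h"])
        then show ?thesis using multiset_filter_mono[OF Q(1)] by metis
      qed
      then have "size (filter_mset (\<lambda>e. int h dvd fst e) Q) \<le> size (F h)" by (rule size_mset_mono)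
      \<comment> \<open>With \<open>u = h div l\<close> and \<open>v = g div h\<close>, counting
        \<open>Q\<close> inside and outside the multiples of \<open>h\<close> yields
        \<open>u * v + 3 \<le> u + v\<close>, impossible for positive \<open>u\<close> and
        \<open>v\<close>.\<close>
      ultimately have "g div l - 1 + 4 \<le> h div l + g div h" using out split Q(2) by linarith
      moreover have "h div l \<ge> 1" "g div h \<ge> 1" using out \<open>size (F h) + 2 \<le> g div h\<close> by auto
      ultimately show False
        using prod[OF sb(1)] by (cases "h div l"; cases "g div h") auto
    qed
  qed
qed

text \<open>Let \<open>h\<close> generate the stabilizer and let \<open>j\<close> elements of
  \<open>Q\<close> lie outside its multiples. There are at least \<open>(n div h) * (j + 1)\<close>
  residues. For \<open>h < n\<close> this is at least \<open>n div h + j\<close>, while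
  \<open>few\<close> allows at most \<open>n div h - 2\<close> elements inside. A nontrivial
  stabilizer thus costs nothing.\<close>

lemma card_balanced_sums_ge_size:
  assumes "n > 0" "odd n"
    and few: "\<And>l. l dvd n \<Longrightarrow> l < n \<Longrightarrow>
      size (filter_mset (\<lambda>e. \<not> snd e \<and> int l dvd fst e \<and> \<not> int n dvd fst e) S) + 2 \<le> n div l"
    and Q: "Q \<subseteq># filter_mset (\<lambda>e. \<not> snd e \<and> \<not> int n dvd fst e) S"
  shows "Suc (size Q) \<le> card (residues_in n (balanced_sums Q))"
proof -
  have QF: "\<not> snd e \<and> \<not> int n dvd fst e" if "e \<in># Q" for e
    using mset_subset_eqD[OF Q that] by simp
  then have rf: "refls Q = 0" by (auto simp: refls_eq_0_iff)
  obtain h where h: "h > 0" "h dvd n" "\<And>x. period n (balanced_sums Q) x \<longleftrightarrow> int h dvd x"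
    using ex_least_period[OF assms(1), of "balanced_sums Q"] by blast
  have ge: "card (residues_in h (balanced_sums Q)) \<ge> Suc (size (filter_mset (\<lambda>e. \<not> int h dvd fst e) Q))"
  proof (rule card_balanced_sums_ge[OF h(1) _ rf])
    show "odd h" using h(2) assms(2) by (metis dvd_trans)
    show "int h dvd x" if "period h (balanced_sums Q) x" for x
      using period_lift[OF assms(1), of "balanced_sums Q" h x] h(3) that by simp
  qed
  show ?thesis
  proof (cases "h = n")
    case True
    then have "filter_mset (\<lambda>e. \<not> int h dvd fst e) Q = Q"
      using QF by (auto simp: filter_mset_eq_conv)
    then show ?thesis using ge True by simp
  next
    case False
    then have "h < n" using h(2) assms(1) by (simp add: dvd_imp_le le_neq_implies_less)
    have "filter_mset (\<lambda>e. int h dvd fst e) Q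
      \<subseteq># filter_mset (\<lambda>e. \<not> snd e \<and> int h dvd fst e \<and> \<not> int n dvd fst e) S"
      using multiset_filter_mono[OF Q, of "\<lambda>e. int h dvd fst e"]
      by (simp add: filter_filter_mset conj_ac)
    then have "size (filter_mset (\<lambda>e. int h dvd fst e) Q) + 2 \<le> n div h"
      using few[OF h(2) \<open>h < n\<close>] size_mset_mono by fastforce
    moreover have "size Q = size (filter_mset (\<lambda>e. int h dvd fst e) Q) + size (filter_mset (\<lambda>e. \<not> int h dvd fst e) Q)"
      by (metis multiset_partition size_union)
    moreover have "card (residues_in n (balanced_sums Q)) = (n div h) * card (residues_in h (balanced_sums Q))"
      using residues_in_card_periodic[OF assms(1) h(2)] h(3) by simp
    moreover have "(n div h) * Suc (size (filter_mset (\<lambda>e. \<not> int h dvd fst e) Q))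
      \<le> (n div h) * card (residues_in h (balanced_sums Q))" using ge by (rule mult_le_mono2)
    moreover have "n div h + j \<le> (n div h) * Suc j" if "n div h \<ge> 2" for j
      using that by (cases "n div h") auto
    from this[of "size (filter_mset (\<lambda>e. \<not> int h dvd fst e) Q)"]
    have "n div h + size (filter_mset (\<lambda>e. \<not> int h dvd fst e) Q)
      \<le> (n div h) * Suc (size (filter_mset (\<lambda>e. \<not> int h dvd fst e) Q))"
      using calculation(1) by linarith
    ultimately show ?thesis by linarith
  qed
qed

text \<open>Reflections enter in pairs with opposite signs; such a pair keeps the balance and acts
  like a rotation by the difference of the exponents. A largest \<open>U\<close> gaining one residue
  per pair leaves reflections that agree modulo the stabilizer: two incongruent ones would shift the
  sums by plus and minus a difference whose double is no period, as \<open>h\<close> is odd.\<close>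

lemma greedy_pairs:
  assumes "M > 0" "odd M" "refls Q = 0"
    and Q: "Suc (size Q) \<le> card (residues_in M (balanced_sums Q))"
    and W: "\<forall>e\<in>#W. snd e"
  obtains U h b' where "U \<subseteq># W" "even (size U)" "h > 0" "h dvd M"
    "\<And>x. period M (balanced_sums (Q + U)) x \<longleftrightarrow> int h dvd x"
    "\<forall>e\<in>#W - U. int h dvd fst e - b'"
    "Suc (size Q + size U div 2) \<le> card (residues_in M (balanced_sums (Q + U)))"
proof -
  define ok where "ok U \<longleftrightarrow> U \<subseteq># W \<and> even (size U) \<and>
    Suc (size Q + size U div 2) \<le> card (residues_in M (balanced_sums (Q + U)))" for U
  have "ok {#}" using Q by (simp add: ok_def)
  moreover have "\<forall>U. ok U \<longrightarrow> size U < Suc (size W)"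
    by (auto simp: ok_def less_Suc_eq_le intro: size_mset_mono)
  ultimately obtain U where U: "ok U" "\<And>U'. ok U' \<Longrightarrow> size U' \<le> size U"
    using ex_has_greatest_nat[of ok "{#}" size "Suc (size W)"] by blast
  define A where "A = balanced_sums (Q + U)"
  obtain h where h: "h > 0" "h dvd M" "\<And>x. period M A x \<longleftrightarrow> int h dvd x"
    using ex_least_period[OF assms(1), of A] by blast
  have cong: "int h dvd fst e - fst w" if w: "w \<in># W - U" and e: "e \<in># W - U" for w e
  proof (rule ccontr)
    assume nd: "\<not> int h dvd fst e - fst w"
    then have "e \<noteq> w" by auto
    then have "e \<in># (W - U) - {#w#}" using e by (simp add: in_diff_count)
    then have "{#w, e#} \<subseteq># W - U" using w by (metis insert_DiffM insert_subset_eq_iff mset_subset_eq_single)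
    then have sub: "U + {#w, e#} \<subseteq># W"
      using U(1) by (intro submset_add_diff) (auto simp: ok_def)
    have se: "snd e = snd w" using w e W by (meson in_diffD)
    have d: "signed_sum {#w, e#} (fst e - fst w) 0" "signed_sum {#w, e#} (fst w - fst e) 0"
      using signed_sum_pair[OF se] signed_sum_pair[OF se[symmetric]] by (simp_all add: add_mset_commute)
    have coset: "(\<lambda>a. a + (fst e - fst w)) ` A \<subseteq> balanced_sums (Q + (U + {#w, e#}))"
      "(\<lambda>a. a + (fst w - fst e)) ` A \<subseteq> balanced_sums (Q + (U + {#w, e#}))"
      using balanced_sums_add[of _ "Q + U" _ "{#w, e#}"] d
      unfolding A_def balanced_sums_def[of "{#w, e#}"] by (auto simp: add.assoc simp del: add_mset_add_single)
    have "\<not> period M A ((fst e - fst w) - (fst w - fst e))"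
    proof
      assume "period M A ((fst e - fst w) - (fst w - fst e))"
      then have "int h dvd 2 * (fst e - fst w)" using h(3) by (simp add: algebra_simps)
      moreover have "coprime (int h) 2" using h(2) assms(2) by (auto dest: dvd_trans)
      ultimately show False using nd coprime_dvd_mult_right_iff by blast
    qed
    then have "card (residues_in M A) < card (residues_in M (balanced_sums (Q + (U + {#w, e#}))))"
      by (rule card_residues_in_expand[OF assms(1) _ coset])
    then have "ok (U + {#w, e#})" using U(1) sub by (auto simp: ok_def A_def)
    then show False using U(2) by fastforce
  qed
  have "\<exists>b'. \<forall>e\<in>#W - U. int h dvd fst e - b'"
  proof (cases "W - U = {#}")
    case False
    then obtain w where "w \<in># W - U" by blast
    then show ?thesis using cong by blast
  qed simp
  then obtain b' where "\<forall>e\<in>#W - U. int h dvd fst e - b'" by blast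
  then show ?thesis using that[of U h b'] U(1) h by (auto simp: ok_def A_def)
qed

text \<open>The subgroup is taken minimal among those having a coset with many reflections: a coset that
  could not be covered would leave many reflections in a coset of a smaller subgroup.\<close>

lemma ex_covered_coset:
  fixes c :: int
  assumes "M > 0" "odd M" and W0: "\<forall>e\<in>#W0. snd e"
    and Q: "\<And>l. l dvd M \<Longrightarrow> refls (Q l) = 0" "\<And>l. l dvd M \<Longrightarrow> \<forall>e\<in>#Q l. int l dvd fst e"
      "\<And>l. l dvd M \<Longrightarrow> Suc (size (Q l)) \<le> card (residues_in M (balanced_sums (Q l)))"
    and size: "int (size W0) \<ge> 2 * int M + c - 2 * int (size (Q 1))"
  obtains l b U where "l > 0" "l dvd M" "U \<subseteq># W0" "even (size U)" "\<forall>e\<in>#U. int l dvd fst e - b"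
    "covers M l (Q l + U)" "size (Q l) + size U div 2 < M div l"
    "int (size (filter_mset (\<lambda>e. int l dvd fst e - b) (W0 - U))) \<ge> c + 2"
proof -
  define F where "F l b = filter_mset (\<lambda>e. int l dvd fst e - b) W0" for l b
  \<comment> \<open>The threshold leaves \<open>c + 2\<close> reflections of the coset after
    \<open>U\<close> is removed, since \<open>bound\<close> below allows \<open>U\<close> at most
    \<open>2 * (M div l) - 2 - 2 * size (Q l)\<close> elements.\<close>
  define big where "big l \<longleftrightarrow> l dvd M \<and>
    (\<exists>b. int (size (F l b)) \<ge> 2 * int (M div l) + c - 2 * int (size (Q l)))" for l
  have "F 1 0 = W0" by (auto simp: F_def filter_mset_eq_conv)
  then have "big 1" using size by (auto simp: big_def intro!: exI[of _ 0])
  moreover have "\<forall>l. big l \<longrightarrow> l < Suc M" using assms(1) by (auto simp: big_def dvd_imp_le less_Suc_eq_le)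
  ultimately obtain l where l: "big l" "\<And>h. big h \<Longrightarrow> h \<le> l"
    using ex_has_greatest_nat[of big 1 id "Suc M"] by auto
  then obtain b where lM: "l dvd M"
    and b: "int (size (F l b)) \<ge> 2 * int (M div l) + c - 2 * int (size (Q l))"
    by (auto simp: big_def)
  have l0: "l > 0" using lM assms(1) by (auto intro: Nat.gr0I)
  have W: "\<forall>e\<in>#F l b. snd e" using W0 by (auto simp: F_def)
  obtain U h b' where U: "U \<subseteq># F l b" "even (size U)" "h > 0" "h dvd M"
    "\<And>x. period M (balanced_sums (Q l + U)) x \<longleftrightarrow> int h dvd x"
    "\<forall>e\<in>#F l b - U. int h dvd fst e - b'"
    "Suc (size (Q l) + size U div 2) \<le> card (residues_in M (balanced_sums (Q l + U)))"
    using greedy_pairs[OF assms(1,2) Q(1)[OF lM] Q(3)[OF lM] W] by blast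
  define A where "A = balanced_sums (Q l + U)"
  have Ub: "\<forall>e\<in>#U. int l dvd fst e - b" "\<forall>e\<in>#U. snd e"
    using U(1) W0 by (auto simp: F_def dest!: mset_subset_eqD)
  have UW: "U \<subseteq># W0" using subset_mset.order_trans[OF U(1)] by (simp add: F_def)
  have elts: "\<forall>e\<in>#Q l + U. int l dvd fst e - (if snd e then b else 0)"
    using Q(1,2)[OF lM] Ub by (auto simp: refls_eq_0_iff)
  have Al: "\<forall>a\<in>A. int l dvd a"
    using balanced_sums_dvd[OF elts] by (simp add: A_def)
  have "card (residues_in M A) > 0" using U(7) unfolding A_def by linarith
  then have A: "A \<noteq> {}" by (auto simp: residues_in_def)
  have sizeU: "size (F l b - U) = size (F l b) - size U" "size U \<le> size (F l b)"
    using U(1) by (auto simp: size_Diff_submset size_mset_mono)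
  have "h = l"
  proof (rule ccontr)
    assume hl: "h \<noteq> l"
    note sb = stabilizer_index_bound[OF assms(1) U(3) U(5)[folded A_def] A lM Al hl]
    \<comment> \<open>The sums miss a class modulo \<open>h\<close>, so they have at most
      \<open>M div l - M div h\<close> residues. This lowers the bound on \<open>size U\<close> by
      \<open>2 * (M div h)\<close>, and the reflections left over meet the threshold for
      \<open>h\<close>.\<close>
    have "card (residues_in M A) = (M div h) * card (residues_in h A)"
      using residues_in_card_periodic[OF assms(1) U(4)] U(5) by (simp add: A_def)
    also have "\<dots> \<le> (M div h) * (h div l - 1)" using sb(2) by (intro mult_le_mono2) simp
    also have "\<dots> = M div l - M div h"
    proof -
      obtain i j where "h = l * i" "M = h * j" using sb(1) U(4) by (elim dvdE)
      then show ?thesis using l0 U(3) by (simp add: diff_mult_distrib2 mult.assoc) (simp add: mult.commute)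
    qed
    finally have "size (Q l) + size U div 2 + 1 + M div h \<le> M div l"
      using U(7) div_le_mono2[of l h M] sb(1) U(3) l0 dvd_imp_le[of l h] unfolding A_def by linarith
    moreover have "F l b - U \<subseteq># F h b'"
    proof -
      have eq: "filter_mset (\<lambda>e. int h dvd fst e - b') (F l b - U) = F l b - U"
        unfolding filter_mset_eq_conv using U(6) by simp
      have "F l b - U \<subseteq># W0"
        using subset_mset.order_trans[OF diff_subset_eq_self[of "F l b" U]] by (simp add: F_def)
      from multiset_filter_mono[OF this, of "\<lambda>e. int h dvd fst e - b'"]
      show ?thesis unfolding eq by (simp add: F_def)
    qed
    then have "size (F l b) - size U \<le> size (F h b')" using size_mset_mono sizeU by metis
    moreover have "size U = 2 * (size U div 2)" using U(2) by simp
    ultimately have "int (size (F h b')) \<ge> 2 * int (M div h) + c - 2 * int (size (Q h))"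
      using b sizeU(2) by linarith
    then have "big h" using U(4) by (auto simp: big_def)
    then have "h \<le> l" by (rule l(2))
    then show False using hl sb(1) U(3) dvd_imp_le by fastforce
  qed
  have cov: "covers M l (Q l + U)"
    using covers_of_period[OF _ assms(1)] U(5) A Al \<open>h = l\<close> by (simp add: A_def)
  have "card (residues_in M A) \<le> M div l"
    by (rule card_residues_in_multiples[OF lM assms(1) bspec[OF Al]])
  then have bound: "size (Q l) + size U div 2 < M div l" using U(7) by (simp add: A_def)
  have "filter_mset (\<lambda>e. int l dvd fst e - b) U = U"
    unfolding filter_mset_eq_conv using Ub(1) by simp
  then have "filter_mset (\<lambda>e. int l dvd fst e - b) (W0 - U) = F l b - U"
    by (simp add: F_def)
  then have "size (filter_mset (\<lambda>e. int l dvd fst e - b) (W0 - U)) = size (F l b) - size U"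
    using sizeU(1) by simp
  moreover have "size U = 2 * (size U div 2)" using U(2) by simp
  ultimately have "int (size (filter_mset (\<lambda>e. int l dvd fst e - b) (W0 - U))) \<ge> c + 2"
    using b bound sizeU by linarith
  then show ?thesis using that[OF l0 lM UW U(2) Ub(1) cov bound] by blast
qed

subsection \<open>Zero-sum blocks\<close>

definition rots :: "(int \<times> bool) multiset \<Rightarrow> nat" where
  "rots T = size (filter_mset (\<lambda>e. \<not> snd e) T)"

lemma rots_simps [simp]:
  "rots {#} = 0" "rots (add_mset e T) = (if snd e then rots T else Suc (rots T))"
  "rots (T + T') = rots T + rots T'"
  by (simp_all add: rots_def)

lemma size_eq_rots_refls: "size T = rots T + refls T"
  by (induction T) auto

lemma rots_mono: "T \<subseteq># T' \<Longrightarrow> rots T \<le> rots T'"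
  by (auto simp: rots_def intro!: size_mset_mono multiset_filter_mono)

lemma signed_sum_sum:
  assumes "finite I" "\<And>i. i \<in> I \<Longrightarrow> signed_sum (T i) (s i) (t i)"
  shows "signed_sum (\<Sum>i\<in>I. T i) (\<Sum>i\<in>I. s i) (\<Sum>i\<in>I. t i)"
  using assms by (induction I) (auto intro: signed_sum_add)

lemma rots_sum: "finite I \<Longrightarrow> rots (\<Sum>i\<in>I. T i) = (\<Sum>i\<in>I. rots (T i))"
  by (induction I rule: finite_induct) auto

lemma sum_mset_subset_mono:
  fixes T :: "nat \<Rightarrow> 'a multiset"
  assumes "finite J" "I \<subseteq> J"
  shows "(\<Sum>i\<in>I. T i) \<subseteq># (\<Sum>i\<in>J. T i)"
  using sum.subset_diff[OF assms(2,1), of T] by simp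

text \<open>Two of the \<open>2 ^ \<kappa>\<close> partial sums agree; their difference is the block.\<close>

lemma ex_zero_block_items:
  fixes T :: "nat \<Rightarrow> (int \<times> bool) multiset"
  assumes items: "\<And>i. i < \<kappa> \<Longrightarrow> signed_sum (T i) (s i) (t i)"
    and "l > 0" "w > 0" "w * l < 2 ^ \<kappa>"
  obtains K \<sigma> \<tau> where "K \<subseteq> {..<\<kappa>}" "K \<noteq> {}" "signed_sum (\<Sum>i\<in>K. T i) \<sigma> \<tau>"
    "int l dvd \<sigma> - b * \<tau>" "w = 2 \<Longrightarrow> even (rots (\<Sum>i\<in>K. T i))"
    "(\<And>i. i < \<kappa> \<Longrightarrow> t i = 0) \<Longrightarrow> \<tau> = 0"
proof -
  \<comment> \<open>Subtracting \<open>b\<close> per unit of excess makes reflections congruent to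
    \<open>b\<close> count as zero.\<close>
  define v where "v i = s i - b * t i" for i
  \<comment> \<open>The second component tracks the number of rotations modulo \<open>w\<close>:
    \<open>w = 2\<close> controls its parity at the cost of a factor two, \<open>w = 1\<close>
    records nothing.\<close>
  define f where "f I = ((\<Sum>i\<in>I. v i) mod int l, (\<Sum>i\<in>I. rots (T i)) mod w)" for I
  have "card (f ` Pow {..<\<kappa>}) \<le> card ({0..<int l} \<times> {0..<w})"
    using assms(2,3) by (intro card_mono) (auto simp: f_def)
  also have "\<dots> < card (Pow {..<\<kappa>})"
    using assms(4) by (simp add: card_cartesian_product card_Pow mult.commute)
  finally have "\<not> inj_on f (Pow {..<\<kappa>})" using pigeonhole by blast
  then obtain I J where IJ: "I \<subseteq> {..<\<kappa>}" "J \<subseteq> {..<\<kappa>}" "I \<noteq> J" "f I = f J"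
    by (auto simp: inj_on_def)
  have fin: "finite I" "finite J" using IJ finite_subset by blast+
  \<comment> \<open>Common items cancel, and those in \<open>J - I\<close> are used with all signs
    reversed.\<close>
  define K where "K = (I - J) \<union> (J - I)"
  define \<sigma> where "\<sigma> = (\<Sum>i\<in>I - J. s i) - (\<Sum>i\<in>J - I. s i)"
  define \<tau> where "\<tau> = (\<Sum>i\<in>I - J. t i) - (\<Sum>i\<in>J - I. t i)"
  have split: "(\<Sum>i\<in>I. g i) = (\<Sum>i\<in>I - J. g i) + (\<Sum>i\<in>I \<inter> J. g i)"
    "(\<Sum>i\<in>J. g i) = (\<Sum>i\<in>J - I. g i) + (\<Sum>i\<in>I \<inter> J. g i)"
    for g :: "nat \<Rightarrow> 'b::comm_monoid_add"
    using sum.Int_Diff[OF fin(1), of g J] sum.Int_Diff[OF fin(2), of g I]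
    by (simp_all add: ac_simps Int_commute)
  have sumK: "(\<Sum>i\<in>K. g i) = (\<Sum>i\<in>I - J. g i) + (\<Sum>i\<in>J - I. g i)"
    for g :: "nat \<Rightarrow> 'b::comm_monoid_add"
    unfolding K_def using fin by (intro sum.union_disjoint) auto
  have "signed_sum (\<Sum>i\<in>K. T i) \<sigma> \<tau>"
    unfolding sumK \<sigma>_def \<tau>_def
    by (intro signed_sum_diff signed_sum_sum items) (use fin IJ in auto)
  moreover have "int l dvd \<sigma> - b * \<tau>"
  proof -
    have "int l dvd (\<Sum>i\<in>I. v i) - (\<Sum>i\<in>J. v i)"
      using IJ(4) by (simp add: f_def mod_eq_dvd_iff)
    moreover have "(\<Sum>i\<in>I. v i) - (\<Sum>i\<in>J. v i) = (\<Sum>i\<in>I - J. v i) - (\<Sum>i\<in>J - I. v i)"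
      by (simp only: split[of v])
    moreover have "(\<Sum>i\<in>I - J. v i) - (\<Sum>i\<in>J - I. v i) = \<sigma> - b * \<tau>"
      by (simp add: \<sigma>_def \<tau>_def v_def sum_subtractf sum_distrib_left algebra_simps)
    ultimately show ?thesis by simp
  qed
  moreover have "even (rots (\<Sum>i\<in>K. T i))" if "w = 2"
  proof -
    let ?r = "\<lambda>i. rots (T i)"
    have "even ((\<Sum>i\<in>I. ?r i) + (\<Sum>i\<in>J. ?r i))"
      using IJ(4) that by (auto simp: f_def mod2_eq_if split: if_splits)
    then have "even ((\<Sum>i\<in>I - J. ?r i) + (\<Sum>i\<in>J - I. ?r i))"
      unfolding split[of ?r] by auto
    moreover have "rots (\<Sum>i\<in>K. T i) = (\<Sum>i\<in>K. ?r i)"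
      using fin by (intro rots_sum) (simp add: K_def)
    moreover have "(\<Sum>i\<in>K. ?r i) = (\<Sum>i\<in>I - J. ?r i) + (\<Sum>i\<in>J - I. ?r i)" by (rule sumK)
    ultimately show ?thesis by (simp only:)
  qed
  moreover have "\<tau> = 0" if "\<And>i. i < \<kappa> \<Longrightarrow> t i = 0"
  proof -
    have "t i = 0" if "i \<in> I \<union> J" for i using that IJ(1,2) \<open>\<And>i. i < \<kappa> \<Longrightarrow> t i = 0\<close> by auto
    then show ?thesis by (simp add: \<tau>_def)
  qed
  moreover have "K \<subseteq> {..<\<kappa>}" "K \<noteq> {}" using IJ by (auto simp: K_def)
  ultimately show ?thesis using that by blast
qed

lemma sum_single_nth:
  assumes "finite K"
  shows "(\<Sum>i\<in>K. {#xs ! i#}) = image_mset (nth xs) (mset_set K)"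
  using assms by (induction K) auto

lemma ex_zero_block:
  assumes "l > 0" "w > 0" "w * l < 2 ^ size Z"
  obtains X \<sigma> \<tau> where "X \<subseteq># Z" "X \<noteq> {#}" "signed_sum X \<sigma> \<tau>" "int l dvd \<sigma> - b * \<tau>"
    "w = 2 \<Longrightarrow> even (rots X)"
proof -
  obtain zs where zs: "mset zs = Z" using ex_mset by blast
  have len: "length zs = size Z" using zs by auto
  obtain K \<sigma> \<tau> where K: "K \<subseteq> {..<length zs}" "K \<noteq> {}" "signed_sum (\<Sum>i\<in>K. {#zs ! i#}) \<sigma> \<tau>"
    "int l dvd \<sigma> - b * \<tau>" "w = 2 \<Longrightarrow> even (rots (\<Sum>i\<in>K. {#zs ! i#}))"
    by (rule ex_zero_block_items[of "length zs" "\<lambda>i. {#zs ! i#}" "\<lambda>i. fst (zs ! i)"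
          "\<lambda>i. if snd (zs ! i) then 1 else 0" l w b])
      (use assms len signed_sum_single in auto)
  have fin: "finite K" using K(1) finite_subset by blast
  show ?thesis
  proof (rule that[of "\<Sum>i\<in>K. {#zs ! i#}"])
    show "(\<Sum>i\<in>K. {#zs ! i#}) \<subseteq># Z"
      unfolding sum_single_nth[OF fin] zs[symmetric] by (rule image_nth_subset[OF K(1)])
    show "(\<Sum>i\<in>K. {#zs ! i#}) \<noteq> {#}"
      unfolding sum_single_nth[OF fin] using K(2) fin by (simp add: mset_set_empty_iff)
  qed (use K in auto)
qed

lemma size_2_obtain:
  assumes "size M = 2"
  obtains a b where "M = {#a, b#}"
proof -
  obtain a N where N: "M = add_mset a N" "size N = 1"
    using assms by (cases M) auto
  then obtain b where "N = {#b#}" using size_1_singleton_mset by blast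
  then show ?thesis using that N(1) by blast
qed

text \<open>A single rotation, or two reflections with opposite signs, has excess zero, so an item
  costs at most two elements.\<close>

lemma ex_balanced_items:
  "2 * j \<le> size Z \<Longrightarrow> \<exists>T s. (\<forall>i<j. signed_sum (T i) (s i) 0 \<and> T i \<noteq> {#}) \<and> (\<Sum>i<j. T i) \<subseteq># Z"
proof (induction j arbitrary: Z)
  case (Suc j)
  have "\<exists>I \<sigma>. I \<subseteq># Z \<and> size I \<le> 2 \<and> I \<noteq> {#} \<and> signed_sum I \<sigma> 0"
  proof (cases "\<exists>e\<in>#Z. \<not> snd e")
    case True
    then obtain e where "e \<in># Z" "\<not> snd e" by blast
    then show ?thesis using signed_sum_single[of e] by (intro exI[of _ "{#e#}"]) auto
  next
    case False
    obtain I where I: "I \<subseteq># Z" "size I = 2" using Suc.prems by (auto intro: ex_submset_size[of 2 Z])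
    then obtain e e' where ee: "I = {#e, e'#}" using size_2_obtain by blast
    then have "e \<in># Z" "e' \<in># Z" using I(1) by (auto dest: mset_subset_eqD)
    then have "snd e = snd e'" using False by blast
    then show ?thesis using signed_sum_pair[of e e'] I ee by (intro exI[of _ I]) auto
  qed
  then obtain I \<sigma> where I: "I \<subseteq># Z" "size I \<le> 2" "I \<noteq> {#}" "signed_sum I \<sigma> 0" by blast
  have "2 * j \<le> size (Z - I)" using Suc.prems I(1,2) by (simp add: size_Diff_submset)
  then obtain T s where T: "\<forall>i<j. signed_sum (T i) (s i) 0 \<and> T i \<noteq> {#}" "(\<Sum>i<j. T i) \<subseteq># Z - I"
    using Suc.IH by blast
  have "(\<Sum>i<Suc j. (T(j := I)) i) = I + (\<Sum>i<j. T i)"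
    by (simp add: add.commute)
  then have "(\<Sum>i<Suc j. (T(j := I)) i) \<subseteq># Z" using submset_add_diff[OF I(1) T(2)] by (simp only:)
  then show ?case using T(1) I(3,4)
    by (intro exI[of _ "T(j := I)"] exI[of _ "s(j := \<sigma>)"]) (auto simp: less_Suc_eq)
qed simp

text \<open>Meant for the situation without a reserve of congruent reflections: twice as many
  elements buy an excess of exactly zero.\<close>

lemma ex_balanced_zero_block:
  assumes "l > 0" "l < 2 ^ j" "2 * j \<le> size Z"
  obtains X \<sigma> where "X \<subseteq># Z" "X \<noteq> {#}" "signed_sum X \<sigma> 0" "int l dvd \<sigma>"
proof -
  obtain T s where T: "\<forall>i<j. signed_sum (T i) (s i) 0 \<and> T i \<noteq> {#}" "(\<Sum>i<j. T i) \<subseteq># Z"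
    using ex_balanced_items[OF assms(3)] by blast
  obtain K \<sigma> \<tau> where K: "K \<subseteq> {..<j}" "K \<noteq> {}" "signed_sum (\<Sum>i\<in>K. T i) \<sigma> \<tau>" "int l dvd \<sigma> - 0 * \<tau>" "\<tau> = 0"
    by (rule ex_zero_block_items[of j T s "\<lambda>_. 0" l 1 0]) (use assms T in auto)
  have fin: "finite K" using K(1) finite_subset by blast
  obtain i where i: "i \<in> K" using K(2) by blast
  have "T i \<subseteq># (\<Sum>i\<in>K. T i)" using sum_mset_subset_mono[OF fin, of "{i}" T] i by simp
  then have "(\<Sum>i\<in>K. T i) \<noteq> {#}" using T(1) i K(1) by (auto simp del: sum_eq_0_iff)
  moreover have "(\<Sum>i\<in>K. T i) \<subseteq># Z"
    using sum_mset_subset_mono[OF _ K(1), of T] T(2) by (simp add: subset_mset.order_trans)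
  ultimately show ?thesis using that[of "\<Sum>i\<in>K. T i" \<sigma>] K(3-5) by simp
qed

text \<open>Two elements with the same key form a block with signed sum zero modulo \<open>l\<close>.\<close>

definition pair_key :: "nat \<Rightarrow> int \<times> bool \<Rightarrow> int \<times> bool" where
  "pair_key l e = (if snd e then fst e mod int l else min (fst e mod int l) ((- fst e) mod int l), snd e)"

text \<open>A reservoir for adjusting the length in steps of two without disturbing the balance or
  the sum modulo \<open>l\<close>.\<close>

definition droppable :: "nat \<Rightarrow> (int \<times> bool) multiset \<Rightarrow> bool" where
  "droppable l P \<longleftrightarrow> even (size P) \<and>
     (\<forall>j\<le>size P. even j \<longrightarrow> (\<exists>P' s. P' \<subseteq># P \<and> size P' = j \<and> signed_sum P' s 0 \<and> int l dvd s))"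

lemma droppableD:
  assumes "droppable l P" "j \<le> size P" "even j"
  obtains P' s where "P' \<subseteq># P" "size P' = j" "signed_sum P' s 0" "int l dvd s"
  using assms unfolding droppable_def by blast

lemma signed_sum_pair_key:
  assumes "pair_key l e = pair_key l e'"
  shows "\<exists>s. signed_sum {#e, e'#} s 0 \<and> int l dvd s"
proof -
  have snd: "snd e = snd e'" using assms by (simp add: pair_key_def)
  show ?thesis
  proof (cases "fst e mod int l = fst e' mod int l")
    case True
    then show ?thesis using signed_sum_pair[OF snd] by (auto simp: mod_eq_dvd_iff)
  next
    case False
    then have rot: "\<not> snd e" using assms by (auto simp: pair_key_def)
    have "fst e mod int l = (- fst e') mod int l \<or> (- fst e) mod int l = fst e' mod int l
      \<or> (- fst e) mod int l = (- fst e') mod int l"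
      using assms rot snd False by (auto simp: pair_key_def min_def split: if_splits)
    then have "int l dvd fst e + fst e' \<or> int l dvd - fst e - fst e' \<or> int l dvd - fst e + fst e'"
      by (auto simp: mod_eq_dvd_iff)
    moreover have "\<not> int l dvd - fst e + fst e'"
      using False by (metis mod_eq_dvd_iff uminus_add_conv_diff dvd_diff_commute)
    moreover have "- fst e - fst e' = - (fst e + fst e')" by simp
    ultimately have "int l dvd fst e + fst e'" by (metis dvd_minus_iff)
    then show ?thesis using signed_sum_self[of "{#e, e'#}"] rot snd by auto
  qed
qed

lemma droppable_add_pair:
  assumes "pair_key l e = pair_key l e'" "droppable l P"
  shows "droppable l ({#e, e'#} + P)"
  unfolding droppable_def
proof (intro conjI allI impI)
  show "even (size ({#e, e'#} + P))" using assms(2) by (simp add: droppable_def)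
  fix j assume j: "j \<le> size ({#e, e'#} + P)" "even j"
  obtain s where s: "signed_sum {#e, e'#} s 0" "int l dvd s" using signed_sum_pair_key[OF assms(1)] by blast
  show "\<exists>P' s. P' \<subseteq># {#e, e'#} + P \<and> size P' = j \<and> signed_sum P' s 0 \<and> int l dvd s"
  proof (cases "j = 0")
    case True
    then show ?thesis by (intro exI[of _ "{#}"] exI[of _ 0]) simp
  next
    case False
    then have "j \<ge> 2" using j(2) by presburger
    then obtain P' s' where P': "P' \<subseteq># P" "size P' = j - 2" "signed_sum P' s' 0" "int l dvd s'"
      using droppableD[OF assms(2), of "j - 2"] j(2) le_diff_conv[of j 2 "size P"] j(1) by auto
    then show ?thesis
      using signed_sum_add[OF s(1) P'(3)] s(2) \<open>j \<ge> 2\<close>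
      by (intro exI[of _ "{#e, e'#} + P'"] exI[of _ "s + s'"]) auto
  qed
qed

lemma size_eq_card_of_count_le_1:
  assumes "\<And>x. count M x \<le> 1"
  shows "size M = card (set_mset M)"
proof -
  have "count M x = 1" if "x \<in># M" for x using assms[of x] that by (simp add: le_Suc_eq flip: count_greater_zero_iff)
  then show ?thesis by (simp add: size_multiset_overloaded_eq)
qed

text \<open>Once pairs with equal keys are removed as long as possible, the keys of the remaining
  \<open>V\<close> are distinct, so counting keys bounds its size.\<close>

lemma ex_pairing:
  obtains P V where "E = P + V" "droppable l P" "size V = card (pair_key l ` set_mset V)"
proof -
  have "\<exists>P V. E = P + V \<and> droppable l P \<and> size V = card (pair_key l ` set_mset V)"
  proof (induction "size E" arbitrary: E rule: less_induct)
    case less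
    show ?case
    proof (cases "\<forall>x. count (image_mset (pair_key l) E) x \<le> 1")
      case True
      then have "size E = card (pair_key l ` set_mset E)"
        using size_eq_card_of_count_le_1[OF True[rule_format]] by simp
      moreover have "droppable l {#}" by (auto simp: droppable_def intro!: exI[of _ 0])
      ultimately show ?thesis by (intro exI[of _ "{#}"] exI[of _ E]) auto
    next
      case False
      then obtain x where "\<not> count (image_mset (pair_key l) E) x \<le> 1" by blast
      then have "count (image_mset (pair_key l) E) x \<ge> 2" by simp
      then have "{#x, x#} \<subseteq># image_mset (pair_key l) E" by (auto simp: subseteq_mset_def)
      then obtain Y where Y: "Y \<subseteq># E" "{#x, x#} = image_mset (pair_key l) Y"
        by (rule subset_image_mset_obtain)
      have "size Y = size (image_mset (pair_key l) Y)" by simp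
      also have "\<dots> = 2" unfolding Y(2)[symmetric] by simp
      finally have szY: "size Y = 2" .
      then obtain e e' where Ye: "Y = {#e, e'#}" by (rule size_2_obtain)
      have "pair_key l a = x" if "a \<in># Y" for a
      proof -
        have "pair_key l a \<in># {#x, x#}" using that unfolding Y(2) by simp
        then show ?thesis by simp
      qed
      then have ee: "Y = {#e, e'#}" "pair_key l e = x" "pair_key l e' = x" using Ye by auto
      have "size (E - Y) < size E"
        using size_mset_mono[OF Y(1)] szY by (simp add: size_Diff_submset[OF Y(1)])
      then obtain P V where PV: "E - Y = P + V" "droppable l P" "size V = card (pair_key l ` set_mset V)"
        using less by blast
      have "E = (Y + P) + V" using PV(1) Y(1) by (metis add.assoc subset_mset.add_diff_inverse)
      moreover have "droppable l (Y + P)"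
        unfolding ee(1) by (rule droppable_add_pair[OF _ PV(2)]) (simp add: ee)
      ultimately show ?thesis using PV(3) by blast
    qed
  qed
  then show ?thesis using that by blast
qed

text \<open>Blocks are appended until length \<open>B\<close> is reached; the last one starts below
  \<open>B\<close> and has at most \<open>Suc \<kappa>\<close> elements, so it overshoots by at most
  \<open>\<kappa>\<close>. The bound on \<open>size V\<close> guarantees that more than
  \<open>\<kappa>\<close> elements remain whenever another block is needed.\<close>

lemma ex_chain:
  assumes "Good X0" "X0 \<subseteq># V"
    and step: "\<And>Y. X0 \<subseteq># Y \<Longrightarrow> Y \<subseteq># V \<Longrightarrow> Good Y \<Longrightarrow> size (V - Y) > \<kappa> \<Longrightarrow>
      \<exists>X. X \<subseteq># V - Y \<and> X \<noteq> {#} \<and> size X \<le> Suc \<kappa> \<and> Good (Y + X)"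
    and B: "B + \<kappa> \<le> size V"
  obtains Y where "X0 \<subseteq># Y" "Y \<subseteq># V" "Good Y" "B \<le> size Y" "Y = X0 \<or> size Y \<le> B + \<kappa>"
proof -
  define ok where "ok Y \<longleftrightarrow> X0 \<subseteq># Y \<and> Y \<subseteq># V \<and> Good Y \<and> (Y = X0 \<or> size Y \<le> B + \<kappa>)" for Y
  have "ok X0" using assms(1,2) by (simp add: ok_def)
  moreover have "\<forall>Y. ok Y \<longrightarrow> size Y < Suc (size V)"
    by (auto simp: ok_def less_Suc_eq_le intro: size_mset_mono)
  ultimately obtain Y where Y: "ok Y" "\<And>Y'. ok Y' \<Longrightarrow> size Y' \<le> size Y"
    using ex_has_greatest_nat[of ok X0 size "Suc (size V)"] by blast
  have "B \<le> size Y"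
  proof (rule ccontr)
    assume lt: "\<not> B \<le> size Y"
    have "size (V - Y) > \<kappa>" using Y(1) B lt by (simp add: ok_def size_Diff_submset)
    then obtain X where X: "X \<subseteq># V - Y" "X \<noteq> {#}" "size X \<le> Suc \<kappa>" "Good (Y + X)"
      using step[of Y] Y(1) by (auto simp: ok_def)
    have "ok (Y + X)"
      using Y(1) X lt submset_add_diff[of Y V X]
      by (auto simp: ok_def intro: subset_mset.order_trans[OF _ mset_subset_eq_add_left])
    then have "size (Y + X) \<le> size Y" by (rule Y(2))
    then show False using X(2) by simp
  qed
  then show ?thesis using that Y(1) by (auto simp: ok_def)
qed

section \<open>Reaching a prescribed length\<close>

lemma ex_signed_sum_reflections:
  assumes "\<forall>e\<in>#R. snd e" "\<bar>t\<bar> \<le> int (size R)" "even (int (size R) - t)"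
  shows "\<exists>s. signed_sum R s t"
proof -
  define j where "j = nat ((int (size R) + t) div 2)"
  have "even (int (size R) + t)" using assms(3) by simp
  then have j: "2 * int j = int (size R) + t" using assms(2) by (simp add: j_def)
  then have "j \<le> size R" using assms(2) by linarith
  then obtain R1 where R1: "R1 \<subseteq># R" "size R1 = j" by (rule ex_submset_size)
  then have R: "R = R1 + (R - R1)" by simp
  have "\<forall>e\<in>#R1. snd e" "\<forall>e\<in>#R - R1. snd e" using assms(1) R1(1) by (auto dest: mset_subset_eqD in_diffD)
  then have "refls R1 = j" "refls (R - R1) = size R - j"
    using R1 by (auto simp: refls_eq_size size_Diff_submset)
  then have "int (refls R1) - int (refls (R - R1)) = t" using j \<open>j \<le> size R\<close> by linarith
  then show ?thesis unfolding signed_sum_def using R by blast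
qed

text \<open>Part of \<open>R\<close> contributes the excess \<open>- \<tau>\<close>. Everything
  outside \<open>U\<close> then adds up to a multiple of \<open>l\<close>, which \<open>U\<close>
  cancels modulo \<open>n\<close>; \<open>P\<close> merely tunes the length.\<close>

lemma assemble:
  assumes cov: "covers n l U"
    and Y: "signed_sum Y \<sigma> \<tau>" "int l dvd \<sigma> - b * \<tau>"
    and R: "\<forall>e\<in>#R. snd e \<and> int l dvd fst e - b" "\<bar>\<tau>\<bar> \<le> int (size R)"
    and P: "droppable l P"
    and sz: "int (size U + size Y) + \<bar>\<tau>\<bar> \<le> int N" "N \<le> size U + size Y + size P + size R"
      "even (int N - int (size U) - int (size Y) - \<tau>)"
  shows "\<exists>T. T \<subseteq># U + Y + P + R \<and> size T = N \<and> (\<exists>s. signed_sum T s 0 \<and> int n dvd s)"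
proof -
  define M where "M = N - size U - size Y"
  have M: "int M = int N - int (size U) - int (size Y)" using sz(1) by (simp add: M_def)
  \<comment> \<open>The least even number of elements of \<open>P\<close> that leaves at most
    \<open>size R\<close> places for \<open>R\<close>.\<close>
  define j where "j = (if M \<le> size R then 0 else if even (M - size R) then M - size R else M - size R + 1)"
  have evP: "even (size P)" using P by (simp add: droppable_def)
  \<comment> \<open>Rounding up uses only \<open>size R - 1\<close> elements of \<open>R\<close>;
    parity excludes that all of them are needed to compensate \<open>\<tau>\<close>.\<close>
  have neq: "\<bar>\<tau>\<bar> \<noteq> int (size R)" if "\<not> M \<le> size R" "odd (M - size R)"
  proof
    assume "\<bar>\<tau>\<bar> = int (size R)"
    then have "\<tau> = int (size R) \<or> \<tau> = - int (size R)" by linarith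
    then have "even (int (size R) - \<tau>)" by auto
    moreover have "even (int M - \<tau>)" using sz(3) M by simp
    ultimately have "even (int M - int (size R))" by auto
    then show False using that by (simp flip: of_nat_diff)
  qed
  have j: "even j" "j \<le> size P" "j \<le> M" "M - j \<le> size R" "\<bar>\<tau>\<bar> \<le> int (M - j)"
  proof -
    show "even j" by (auto simp: j_def)
    show "j \<le> size P"
    proof (cases "M \<le> size R")
      case False
      have "M - size R \<le> size P" using sz(2) by (simp add: M_def)
      moreover have "M - size R \<noteq> size P" if "odd (M - size R)" using that evP by metis
      ultimately show ?thesis using False by (auto simp: j_def)
    qed (simp add: j_def)
    show "j \<le> M" using neq R(2) by (cases "size R") (auto simp: j_def)
    show "M - j \<le> size R" by (auto simp: j_def)
    show "\<bar>\<tau>\<bar> \<le> int (M - j)" using neq R(2) sz(1) M by (auto simp: j_def)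
  qed
  obtain P' p where P': "P' \<subseteq># P" "size P' = j" "signed_sum P' p 0" "int l dvd p"
    using droppableD[OF P j(2,1)] by blast
  obtain R' where R': "R' \<subseteq># R" "size R' = M - j" using ex_submset_size[OF j(4)] by blast
  have R'_refl: "\<forall>e\<in>#R'. snd e \<and> int l dvd fst e - b" using R(1) R'(1) by (meson mset_subset_eqD)
  have "even (int (size R') - - \<tau>)" using sz(3) M j(1,3) R'(2) by (auto simp: of_nat_diff)
  then obtain r where r: "signed_sum R' r (- \<tau>)"
    using ex_signed_sum_reflections[of R' "- \<tau>"] R'_refl R'(2) j(5) by auto
  have "int l dvd r - b * (- \<tau>)" by (rule signed_sum_dvd[OF _ r]) (use R'_refl in auto)
  then have "int l dvd (\<sigma> - b * \<tau>) + p + (r - b * (- \<tau>))" using Y(2) P'(4) by (intro dvd_add)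
  then have "int l dvd \<sigma> + p + r" by (simp add: algebra_simps)
  then have "int l dvd - (\<sigma> + p + r)" by (simp only: dvd_minus_iff)
  then obtain u where u: "u \<in> balanced_sums U" "int n dvd u - (- (\<sigma> + p + r))"
    using cov unfolding covers_def by blast
  have "signed_sum (U + (Y + P' + R')) (u + (\<sigma> + p + r)) (0 + (\<tau> + 0 + - \<tau>))"
    using u(1) by (intro signed_sum_add Y(1) P'(3) r) (simp add: balanced_sums_def)
  moreover have "int n dvd u + (\<sigma> + p + r)" using u(2) by (simp add: algebra_simps)
  moreover have "size (U + (Y + P' + R')) = N" using P'(2) R'(2) j(3) sz(1) by (auto simp: M_def)
  moreover have "U + (Y + P' + R') \<subseteq># U + Y + P + R"
    using P'(1) R'(1) by (simp add: add.assoc subset_mset.add_mono)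
  ultimately show ?thesis by (intro exI[of _ "U + (Y + P' + R')"]) auto
qed

text \<open>Reflections enter with exponents relative to the base point \<open>b\<close>; the imbalance \<open>\<tau>\<close> is later
  compensated by reflections congruent to \<open>b\<close>.\<close>

definition zero_mod :: "nat \<Rightarrow> int \<Rightarrow> nat \<Rightarrow> (int \<times> bool) multiset \<Rightarrow> bool" where
  "zero_mod l b m Y \<longleftrightarrow> (\<exists>\<sigma> \<tau>. signed_sum Y \<sigma> \<tau> \<and> int l dvd \<sigma> - b * \<tau> \<and> \<bar>\<tau>\<bar> \<le> int m)"

text \<open>Flipping all signs of one summand keeps the imbalance bounded by the larger of the two.\<close>

lemma zero_mod_add:
  assumes "zero_mod l b m X" "zero_mod l b m Y"
  shows "zero_mod l b m (X + Y)"
proof -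
  obtain \<sigma> \<tau> \<sigma>' \<tau>' where *: "signed_sum X \<sigma> \<tau>" "int l dvd \<sigma> - b * \<tau>" "\<bar>\<tau>\<bar> \<le> int m"
    "signed_sum Y \<sigma>' \<tau>'" "int l dvd \<sigma>' - b * \<tau>'" "\<bar>\<tau>'\<bar> \<le> int m"
    using assms unfolding zero_mod_def by blast
  show ?thesis
  proof (cases "(\<tau> \<ge> 0) = (\<tau>' \<ge> 0)")
    case True
    have "int l dvd (\<sigma> - b * \<tau>) - (\<sigma>' - b * \<tau>')" using *(2,5) by (rule dvd_diff)
    then have "int l dvd (\<sigma> - \<sigma>') - b * (\<tau> - \<tau>')" by (simp add: algebra_simps)
    moreover have "\<bar>\<tau> - \<tau>'\<bar> \<le> int m" using True *(3,6) by auto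
    ultimately show ?thesis using signed_sum_diff[OF *(1,4)] unfolding zero_mod_def by blast
  next
    case False
    have "int l dvd (\<sigma> - b * \<tau>) + (\<sigma>' - b * \<tau>')" using *(2,5) by (rule dvd_add)
    then have "int l dvd (\<sigma> + \<sigma>') - b * (\<tau> + \<tau>')" by (simp add: algebra_simps)
    moreover have "\<bar>\<tau> + \<tau>'\<bar> \<le> int m" using False *(3,6) by auto
    ultimately show ?thesis using signed_sum_add[OF *(1,4)] unfolding zero_mod_def by blast
  qed
qed

lemma zero_mod_empty: "zero_mod l b m {#}"
  unfolding zero_mod_def by (intro exI[of _ 0]) simp

lemma size_le_of_keys:
  assumes "size V = card (pair_key l ` set_mset V)" "finite A" "finite B"
    and "\<And>e. e \<in># V \<Longrightarrow> snd e \<Longrightarrow> fst e mod int l \<in> A"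
    and "\<And>e. e \<in># V \<Longrightarrow> \<not> snd e \<Longrightarrow> min (fst e mod int l) ((- fst e) mod int l) \<in> B"
  shows "size V \<le> card A + card B"
proof -
  have "pair_key l e \<in> (A \<times> {True}) \<union> (B \<times> {False})" if "e \<in># V" for e
    using assms(4,5)[OF that] by (cases "snd e") (simp_all add: pair_key_def)
  then have "pair_key l ` set_mset V \<subseteq> (A \<times> {True}) \<union> (B \<times> {False})" by blast
  then have "size V \<le> card ((A \<times> {True}) \<union> (B \<times> {False}))"
    unfolding assms(1) using assms(2,3) by (intro card_mono) auto
  also have "\<dots> \<le> card (A \<times> {True}) + card (B \<times> {False})" by (rule card_Un_le)
  finally show ?thesis by (simp add: card_cartesian_product)
qed

text \<open>Rotations matter only up to sign, so for odd \<open>l\<close> they have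
  \<open>(l + 1) div 2\<close> keys, one of which belongs to the trivial rotations.\<close>

lemma min_residue_bounds:
  assumes "l > 0"
  shows "odd l \<Longrightarrow> min (v mod int l) ((- v) mod int l) \<in> {0..(int l - 1) div 2}"
    "\<not> int l dvd v \<Longrightarrow> 0 < min (v mod int l) ((- v) mod int l)"
proof -
  have pos: "v mod int l \<ge> 0" "(- v) mod int l \<ge> 0" using assms by auto
  show "0 < min (v mod int l) ((- v) mod int l)" if "\<not> int l dvd v"
  proof -
    have "v mod int l \<noteq> 0" using that by (simp add: dvd_eq_mod_eq_0)
    moreover have "\<not> int l dvd - v" using that by simp
    then have "(- v) mod int l \<noteq> 0" by (simp add: dvd_eq_mod_eq_0)
    ultimately show ?thesis using pos by simp
  qed
  show "min (v mod int l) ((- v) mod int l) \<in> {0..(int l - 1) div 2}" if odd: "odd l"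
  proof (cases "v mod int l = 0")
    case True
    then show ?thesis using assms pos(2) by simp
  next
    case False
    then have eq: "(- v) mod int l = int l - v mod int l"
      by (simp add: zmod_zminus1_eq_if)
    obtain q where q: "l = 2 * q + 1" using odd by (rule oddE)
    have "min (v mod int l) (int l - v mod int l) \<le> int q" using q by linarith
    moreover have "(int l - 1) div 2 = int q" using q by simp
    moreover have "0 \<le> min (v mod int l) (int l - v mod int l)" using pos eq by simp
    ultimately show ?thesis unfolding eq by simp
  qed
qed

text \<open>The appended blocks have an even number of rotations, so the initial \<open>X0\<close>
  alone decides the parity, and the bound \<open>m\<close> on the imbalance does not grow along the
  chain.\<close>

lemma even_zero_mod_chain:
  assumes X0: "zero_mod l b m X0" "X0 \<subseteq># V" "B + \<kappa> \<le> size V"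
    and blocks: "\<And>Z. Z \<subseteq># V \<Longrightarrow> size Z = Suc \<kappa> \<Longrightarrow>
      \<exists>X. X \<subseteq># Z \<and> X \<noteq> {#} \<and> even (rots X) \<and> zero_mod l b m X"
  obtains Y where "X0 \<subseteq># Y" "Y \<subseteq># V" "zero_mod l b m Y" "even (rots Y) = even (rots X0)"
    "B \<le> size Y" "Y = X0 \<or> size Y \<le> B + \<kappa>"
proof -
  define Good where "Good Y \<longleftrightarrow> zero_mod l b m Y \<and> even (rots Y) = even (rots X0)" for Y
  have step: "\<exists>X. X \<subseteq># V - Y \<and> X \<noteq> {#} \<and> size X \<le> Suc \<kappa> \<and> Good (Y + X)"
    if Y: "Y \<subseteq># V" "Good Y" "size (V - Y) > \<kappa>" for Y
  proof -
    obtain Z where Z: "Z \<subseteq># V - Y" "size Z = Suc \<kappa>"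
      using ex_submset_size[of "Suc \<kappa>" "V - Y"] Y(3) by auto
    then have "Z \<subseteq># V" by (meson diff_subset_eq_self subset_mset.order_trans)
    then obtain X where X: "X \<subseteq># Z" "X \<noteq> {#}" "even (rots X)" "zero_mod l b m X"
      using blocks Z(2) by blast
    have "size X \<le> Suc \<kappa>" using size_mset_mono[OF X(1)] Z(2) by simp
    moreover have "Good (Y + X)" using X(3,4) Y(2) zero_mod_add by (auto simp: Good_def)
    ultimately show ?thesis using X(1,2) Z(1) by (meson subset_mset.order_trans)
  qed
  have "Good X0" using X0(1) by (simp add: Good_def)
  then obtain Y where "X0 \<subseteq># Y" "Y \<subseteq># V" "Good Y" "B \<le> size Y" "Y = X0 \<or> size Y \<le> B + \<kappa>"
    using ex_chain[of Good X0 V \<kappa> B] X0(2,3) step by blast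
  then show ?thesis using that by (auto simp: Good_def)
qed

text \<open>As \<open>S\<close> exceeds \<open>2 * n\<close> by \<open>k\<close>, all but
  \<open>k\<close> elements of \<open>V\<close> must be available; even blocks absorb them, and
  \<open>R\<close> compensates an imbalance of at most \<open>k + 1\<close>. In
  \<open>bound\<close>, the first alternative lets \<open>V\<close> be dropped altogether, and the
  second keeps room for the compensation.\<close>

lemma endgame:
  assumes cov: "covers n l U" and evU: "even (size U)"
    and S: "S = U + V + P + R" "size S = 2 * n + k"
    and R: "\<forall>e\<in>#R. snd e \<and> int l dvd fst e - b" "size R \<ge> k + 1"
    and P: "droppable l P"
    and blocks: "\<And>Z. Z \<subseteq># V \<Longrightarrow> size Z = Suc k \<Longrightarrow>
      \<exists>X. X \<subseteq># Z \<and> X \<noteq> {#} \<and> even (rots X) \<and> zero_mod l b (k + 1) X"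
    and bound: "size V \<le> k \<and> size U \<le> 2 * n \<or> size U + size V + k + 1 \<le> 2 * n"
  shows "\<exists>T. T \<subseteq># S \<and> size T = 2 * n \<and> (\<exists>s. signed_sum T s 0 \<and> int n dvd s)"
proof -
  have "\<exists>Y \<sigma> \<tau>. Y \<subseteq># V \<and> even (rots Y) \<and> signed_sum Y \<sigma> \<tau> \<and> int l dvd \<sigma> - b * \<tau> \<and>
    \<bar>\<tau>\<bar> \<le> int (k + 1) \<and> size V \<le> size Y + k \<and> int (size U + size Y) + \<bar>\<tau>\<bar> \<le> int (2 * n)"
  proof (cases "size V \<le> k")
    case True
    then show ?thesis using bound by (intro exI[of _ "{#}"] exI[of _ 0]) auto
  next
    case False
    then have "(size V - k) + k \<le> size V" by simp
    then obtain Y where Y: "Y \<subseteq># V" "zero_mod l b (k + 1) Y" "even (rots Y)" "size V - k \<le> size Y"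
      using even_zero_mod_chain[of l b "k + 1" "{#}" V "size V - k" k, OF zero_mod_empty] blocks by auto
    then obtain \<sigma> \<tau> where *: "signed_sum Y \<sigma> \<tau>" "int l dvd \<sigma> - b * \<tau>" "\<bar>\<tau>\<bar> \<le> int (k + 1)"
      unfolding zero_mod_def by blast
    have "int (size U + size Y) + \<bar>\<tau>\<bar> \<le> int (2 * n)"
      using size_mset_mono[OF Y(1)] *(3) bound False by linarith
    then show ?thesis using Y * by (intro exI[of _ Y] exI[of _ \<sigma>] exI[of _ \<tau>]) auto
  qed
  then obtain Y \<sigma> \<tau> where Y: "Y \<subseteq># V" "even (rots Y)" "signed_sum Y \<sigma> \<tau>" "int l dvd \<sigma> - b * \<tau>"
    "\<bar>\<tau>\<bar> \<le> int (k + 1)" "size V \<le> size Y + k" "int (size U + size Y) + \<bar>\<tau>\<bar> \<le> int (2 * n)" by blast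
  have "even (int (2 * n) - int (size U) - int (size Y) - \<tau>)"
    using signed_sum_parity[OF Y(3)] evU Y(2) by (simp add: size_eq_rots_refls[of Y])
  moreover have "2 * n \<le> size U + size Y + size P + size R" using S Y(6) by simp
  moreover have "\<bar>\<tau>\<bar> \<le> int (size R)" using Y(5) R(2) by linarith
  ultimately obtain T where T: "T \<subseteq># U + Y + P + R" "size T = 2 * n" "\<exists>s. signed_sum T s 0 \<and> int n dvd s"
    using assemble[OF cov Y(3,4) R(1) _ P Y(7)] by blast
  moreover have "U + Y + P + R \<subseteq># S" unfolding S(1) using Y(1) by (simp add: subset_mset.add_mono)
  ultimately show ?thesis by (meson subset_mset.order_trans)
qed

lemma solvable_of_balanced:
  assumes "T \<subseteq># S" "rots S < size T" "signed_sum T s 0" "int n dvd s"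
  shows "solvable n T"
  using solvableI[OF _ assms(3,4)] rots_mono[OF assms(1)] assms(2) size_eq_rots_refls[of T] by simp

lemma even_block:
  assumes "l > 0" "2 * l < 2 ^ Suc \<kappa>" "size Z = Suc \<kappa>" "\<kappa> < m"
  shows "\<exists>X. X \<subseteq># Z \<and> X \<noteq> {#} \<and> even (rots X) \<and> zero_mod l b m X"
proof -
  obtain X \<sigma> \<tau> where X: "X \<subseteq># Z" "X \<noteq> {#}" "signed_sum X \<sigma> \<tau>" "int l dvd \<sigma> - b * \<tau>" "even (rots X)"
    by (rule ex_zero_block[of l 2 Z b]) (use assms in auto)
  have "\<bar>\<tau>\<bar> \<le> int m"
    using signed_sum_abs_le[OF X(3)] refls_le_size[of X] size_mset_mono[OF X(1)] assms(3,4) by linarith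
  then show ?thesis using X unfolding zero_mod_def by blast
qed

text \<open>A proper subgroup has order at least three, which leaves a factor two for the parity of the
  number of rotations in the pigeonhole argument.\<close>

lemma solvable_of_covered_coset:
  assumes n: "n \<ge> 3" "odd n" "n < 2 ^ (k + 1)" "k > 0" "2 ^ k \<le> n" and l: "l > 0" "l dvd n" "l < n"
    and S: "size S = 2 * n + k" "U \<subseteq># S" "covers n l U" "even (size U)" "size U + 2 \<le> 2 * (n div l)"
    and R: "size (filter_mset (\<lambda>e. snd e \<and> int l dvd fst e - b) (S - U)) \<ge> k + 1"
  shows "\<exists>T. T \<subseteq># S \<and> size T = 2 * n \<and> (\<exists>s. signed_sum T s 0 \<and> int n dvd s)"
proof -
  let ?p = "\<lambda>e. snd e \<and> int l dvd fst e - b"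
  define R where "R = filter_mset ?p (S - U)"
  obtain P V where PV: "filter_mset (\<lambda>e. \<not> ?p e) (S - U) = P + V" "droppable l P"
    "size V = card (pair_key l ` set_mset V)" by (rule ex_pairing)
  have "S - U = R + (P + V)" unfolding PV(1)[symmetric] R_def by (rule multiset_partition)
  then have SU: "S = U + V + P + R" using S(2) by (metis add.assoc add.commute subset_mset.add_diff_inverse)
  obtain N where N: "n = l * N" using l(2) by blast
  have oddl: "odd l" "odd N" using n(2) N by auto
  have "N \<noteq> 1" "N \<noteq> 0" using N l(3) n(1) by auto
  then have N3: "N \<ge> 3" using oddl(2) by presburger
  have V_notR: "\<not> ?p e" if "e \<in># V" for e
  proof -
    have "e \<in># filter_mset (\<lambda>e. \<not> ?p e) (S - U)" unfolding PV(1) using that by simp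
    then show ?thesis unfolding set_mset_filter by blast
  qed
  \<comment> \<open>The class of \<open>b\<close> is excluded because its reflections outside
    \<open>U\<close> all belong to \<open>R\<close>.\<close>
  have "size V \<le> card ({0..<int l} - {b mod int l}) + card {0..(int l - 1) div 2}"
  proof (rule size_le_of_keys[OF PV(3)])
    fix e assume e: "e \<in># V" "snd e"
    then have "fst e mod int l \<noteq> b mod int l" using V_notR by (auto simp: mod_eq_dvd_iff)
    then show "fst e mod int l \<in> {0..<int l} - {b mod int l}" using l(1) by simp
  qed (use min_residue_bounds(1)[OF l(1)] oddl in auto)
  also have "\<dots> = (l - 1) + card {0..(int l - 1) div 2}" using l(1) by (simp add: card_Diff_singleton)
  also have "card {0..(int l - 1) div 2} \<le> l" using l(1) by simp
  finally have V: "size V \<le> (l - 1) + l" by simp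
  have "2 * l < 2 ^ Suc k"
  proof -
    have "l * 2 \<le> l * N" using N3 by (intro mult_le_mono2) simp
    moreover have "l * N < 2 ^ Suc k" using N n(3) by simp
    ultimately show ?thesis by linarith
  qed
  have "size V \<le> k \<and> size U \<le> 2 * n \<or> size U + size V + k + 1 \<le> 2 * n"
  proof (cases "l = 1")
    case True
    then show ?thesis using V n(4) S(5) by simp
  next
    case False
    then have l3: "l \<ge> 3" using oddl(1) l(1) by presburger
    have "k < n" using n(5) less_exp[of k] by linarith
    \<comment> \<open>After the shift by three the only nonlinear term of \<open>n\<close> is
      \<open>a * c\<close>, which is nonnegative, so the comparison becomes linear.\<close>
    obtain a c where ac: "l = a + 3" "N = c + 3" using l3 N3 by (metis add.commute le_Suc_ex)
    have "size U \<le> 2 * c + 4" using S(5) N l(1) ac(2) by simp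
    moreover have "size V \<le> 2 * a + 5" using V ac(1) by simp
    moreover have "n = a * c + 3 * a + 3 * c + 9" using N ac by (simp add: algebra_simps)
    ultimately have "size U + size V + k + 1 \<le> 2 * n" using \<open>k < n\<close> by linarith
    then show ?thesis ..
  qed
  then show ?thesis
  proof (rule endgame[OF S(3,4) SU S(1) _ _ PV(2), rotated 3])
    show "\<forall>e\<in>#R. snd e \<and> int l dvd fst e - b" unfolding R_def set_mset_filter by blast
    show "size R \<ge> k + 1" using R unfolding R_def .
    show "\<exists>X. X \<subseteq># Z \<and> X \<noteq> {#} \<and> even (rots X) \<and> zero_mod l b (k + 1) X"
      if "size Z = Suc k" for Z
      by (rule even_block[OF l(1) \<open>2 * l < 2 ^ Suc k\<close> that]) simp
  qed
qed

subsection \<open>Existence of a one-product subsequence\<close>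

text \<open>Half of the reflections of \<open>Z\<close> take each sign, so their base point
  \<open>b\<close> cancels and \<open>Z\<close> contributes a multiple of \<open>l\<close>, which
  \<open>U\<close> absorbs.\<close>

lemma cover_fill:
  assumes "covers n l U" "even (refls Z)"
    and "\<forall>e\<in>#Z. int l dvd fst e - (if snd e then b else 0)"
  shows "\<exists>s. signed_sum (U + Z) s 0 \<and> int n dvd s"
proof -
  define A where "A = filter_mset (\<lambda>e. \<not> snd e) Z"
  define R where "R = filter_mset snd Z"
  have Z: "Z = R + A" unfolding A_def R_def by (rule multiset_partition)
  have "size R = refls Z" by (simp add: R_def refls_def)
  then obtain r where r: "signed_sum R r 0"
    using ex_signed_sum_reflections[of R 0] assms(2) by (auto simp: R_def)
  have "refls A = 0" by (simp add: refls_eq_0_iff A_def)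
  then have "signed_sum A (wt A) 0" using signed_sum_self[of A] by simp
  then have s: "signed_sum Z (r + wt A) 0" using signed_sum_add[OF r] Z by fastforce
  then have "int l dvd - (r + wt A)" using signed_sum_dvd[OF assms(3) s] by (simp only: dvd_minus_iff) simp
  then obtain u where u: "u \<in> balanced_sums U" "int n dvd u - - (r + wt A)"
    using assms(1) unfolding covers_def by blast
  then have "signed_sum (U + Z) (u + (r + wt A)) (0 + 0)"
    using s by (intro signed_sum_add) (auto simp: balanced_sums_def)
  moreover have "int n dvd u + (r + wt A)" using u(2) by (simp add: algebra_simps)
  ultimately show ?thesis by auto
qed

lemma filter_reflections_diff:
  assumes "\<forall>e\<in>#Q. \<not> snd e" "\<forall>e\<in>#U. snd e"
  shows "filter_mset (\<lambda>e. snd e \<and> p e) (S - (Q + U)) = filter_mset p (filter_mset snd S - U)"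
proof -
  have Q: "filter_mset snd Q = {#}" using assms(1) by auto
  have U: "filter_mset snd U = U" unfolding filter_mset_eq_conv using assms(2) by simp
  have "filter_mset snd (S - (Q + U)) = filter_mset snd S - (filter_mset snd Q + filter_mset snd U)"
    by simp
  then have "filter_mset snd (S - (Q + U)) = filter_mset snd S - U" unfolding Q U by simp
  moreover have "filter_mset (\<lambda>e. snd e \<and> p e) (S - (Q + U)) =
    filter_mset p (filter_mset snd (S - (Q + U)))"
    by (simp only: filter_filter_mset conj_commute)
  ultimately show ?thesis by (simp only:)
qed

section \<open>Case analysis for sequences of length exactly 2 n + k\<close>

locale long_sequence =
  fixes n k :: nat and S :: "(int \<times> bool) multiset"
  assumes n3: "n \<ge> 3" and odd_n: "odd n" and k_le: "2 ^ k \<le> n" and k_less: "n < 2 ^ (k + 1)"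
    and size_S: "size S = 2 * n + k"
begin

definition solved :: bool where
  "solved \<longleftrightarrow> (\<exists>T. T \<subseteq># S \<and> (size T = n \<or> size T = 2 * n) \<and> solvable n T)"

lemma solvedI: "T \<subseteq># S \<Longrightarrow> size T = n \<or> size T = 2 * n \<Longrightarrow> solvable n T \<Longrightarrow> solved"
  by (auto simp: solved_def)

lemma n_pos: "n > 0" using n3 by simp

lemma k_pos: "k > 0"
  using n3 k_less by (cases k) auto

lemma n_ge: "2 * k + 1 \<le> n"
proof -
  have "2 * j \<le> 2 ^ j" if "j \<ge> 1" for j :: nat
    using that by (induction j rule: dec_induct) auto
  from this[of k] have "2 * k \<le> n" using k_pos k_le by linarith
  then show ?thesis using odd_n by presburger
qed

lemma rots_refls: "rots S + refls S = 2 * n + k"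
  using size_S size_eq_rots_refls[of S] by simp

abbreviation rotations :: "nat \<Rightarrow> (int \<times> bool) multiset" where
  "rotations g \<equiv> filter_mset (\<lambda>e. \<not> snd e \<and> int g dvd fst e) S"

lemma submset_parts:
  "A \<subseteq># filter_mset (\<lambda>e. \<not> snd e) S \<Longrightarrow> B \<subseteq># filter_mset snd S \<Longrightarrow> A + B \<subseteq># S"
  using submset_union_filter[of B snd S A] by (simp add: add.commute)

lemma solved_of_many_rotations:
  assumes "g > 0" "g dvd n" "size (rotations g) \<ge> n + n div g - 1"
  shows solved
proof -
  obtain N where N: "n = g * N" using assms(2) by blast
  then have "N > 0" using n_pos by (cases N) simp_all
  have "n div g = N" using N assms(1) by simp
  have "refls (rotations g) = 0" "\<forall>e\<in>#rotations g. int g dvd fst e" by (simp_all add: refls_eq_0_iff)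
  moreover have "g * N + N - 1 \<le> size (rotations g)"
    using assms(3) unfolding \<open>n div g = N\<close> unfolding N .
  ultimately obtain T where T: "T \<subseteq># rotations g" "size T = g * N" "solvable (g * N) T"
    using solvable_of_many_rotations[OF _ assms(1) \<open>N > 0\<close>] by meson
  have "T \<subseteq># S" by (rule subset_mset.order_trans[OF T(1)]) simp
  then show ?thesis using T(2,3) unfolding N[symmetric] by (intro solvedI[of T]) simp_all
qed

text \<open>\<open>U\<close> cancels every exponent sum, so only the length and the parity of the
  number of reflections are at stake, unless almost all elements are rotations.\<close>

lemma solved_of_cover_all:
  assumes "rot_covered n S 1"
  shows solved
proof (cases "rots S \<ge> 2 * n - 1")
  case True
  then show ?thesis using solved_of_many_rotations[of 1] by (simp add: rots_def)
next
  case False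
  obtain U where U: "U \<subseteq># rotations 1" "size U < n" "covers n 1 U"
    using assms by (auto simp: rot_covered_def)
  define A where "A = filter_mset (\<lambda>e. \<not> snd e) S"
  define R where "R = filter_mset snd S"
  have UA: "U \<subseteq># A" using U(1) by (simp add: A_def)
  have sA: "size A = rots S" "size R = refls S" by (simp_all add: A_def R_def rots_def refls_def)
  have sU: "size U \<le> rots S" using size_mset_mono[OF UA] sA by simp
  \<comment> \<open>All rotations are used, except that one is sacrificed when their number is odd
    and at least \<open>n\<close>; the extra reflection this requires exists because
    \<open>k > 0\<close>.\<close>
  have "\<exists>r m. size U \<le> r \<and> r \<le> rots S \<and> 2 \<le> m \<and> m \<le> refls S \<and> even m \<and> (r + m = n \<or> r + m = 2 * n)"
  proof (cases "even (rots S)")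
    case True
    then show ?thesis using False rots_refls sU by (intro exI[of _ "rots S"] exI[of _ "2 * n - rots S"]) auto
  next
    case odd: False
    show ?thesis
    proof (cases "rots S < n")
      case True
      then have "rots S + 2 \<le> n" using odd odd_n by presburger
      then show ?thesis using True odd odd_n rots_refls sU
        by (intro exI[of _ "rots S"] exI[of _ "n - rots S"]) auto
    next
      case ge: False
      then show ?thesis using False odd rots_refls U(2) k_pos
        by (intro exI[of _ "rots S - 1"] exI[of _ "2 * n + 1 - rots S"]) auto
    qed
  qed
  then obtain r m where rm: "size U \<le> r" "r \<le> rots S" "2 \<le> m" "m \<le> refls S" "even m"
    "r + m = n \<or> r + m = 2 * n" by blast
  have "r - size U \<le> size (A - U)" using rm(2) UA sA by (simp add: size_Diff_submset)
  then obtain Q where Q: "Q \<subseteq># A - U" "size Q = r - size U" by (rule ex_submset_size)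
  obtain W where W: "W \<subseteq># R" "size W = m" using ex_submset_size rm(4) sA by metis
  have AQ: "refls U = 0" "refls Q = 0" "\<forall>e\<in>#W. snd e"
    using UA Q(1) W(1) by (auto simp: refls_eq_0_iff A_def R_def dest!: mset_subset_eqD in_diffD)
  have rW: "refls W = m" using refls_eq_size[OF AQ(3)] W(2) by simp
  obtain s where s: "signed_sum (U + (Q + W)) s 0" "int n dvd s"
    using cover_fill[OF U(3), of "Q + W" 0] AQ rW rm(5) by auto
  have "(U + Q) + W \<subseteq># S"
    using submset_add_diff[OF UA Q(1)] W(1) by (intro submset_parts) (auto simp: A_def R_def)
  moreover have "size (U + (Q + W)) = n \<or> size (U + (Q + W)) = 2 * n" using rm Q(2) W(2) by auto
  moreover have "solvable n (U + (Q + W))" using s rW rm(3) by (intro solvableI) auto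
  ultimately show ?thesis by (intro solvedI) (auto simp: add.assoc)
qed

text \<open>Unless there are enough rotations in the subgroup for the Erdos-Ginzburg-Ziv theorem,
  these rotations \<open>F\<close> decide the target. An odd covering part of at most
  \<open>N\<close> of them allows length \<open>n\<close>; otherwise \<open>F\<close> is even and
  shorter than \<open>N\<close>, so all of it can join the covering set for length
  \<open>2 * n\<close>. Reflections extend the cover from multiples of \<open>g\<close> to multiples
  of \<open>l\<close>.\<close>

lemma solved_of_proper_cover:
  assumes g: "rot_covered n S g" "\<And>g'. rot_covered n S g' \<Longrightarrow> g \<le> g'" "1 < g" "g < n"
  shows solved
proof -
  obtain UH where UH: "UH \<subseteq># rotations g" "size UH < n div g" "covers n g UH" and gn: "g dvd n"
    using g(1) by (auto simp: rot_covered_def)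
  obtain N where N: "n = g * N" using gn by blast
  then have oddg: "odd g" "odd N" using odd_n by auto
  have "N \<noteq> 0" "N \<noteq> 1" using N g(4) by auto
  then have N3: "N \<ge> 3" using oddg(2) by presburger
  have g3: "g \<ge> 3" using g(3) oddg(1) by presburger
  have divN: "n div g = N" using N g(3) by simp
  obtain a c where ac: "g = a + 3" "N = c + 3" using g3 N3 by (metis add.commute le_Suc_ex)
  have nac: "n = a * c + 3 * a + 3 * c + 9" using N ac by (simp add: algebra_simps)
  define F where "F = rotations g"
  define W0 where "W0 = filter_mset snd S"
  have W0: "\<forall>e\<in>#W0. snd e" "size W0 = refls S" by (simp_all add: W0_def refls_def)
  have F: "\<not> snd e \<and> int g dvd fst e" if "e \<in># F" for e using that by (simp add: F_def)
  have FA: "F \<subseteq># filter_mset (\<lambda>e. \<not> snd e) S"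
  proof -
    have "F = filter_mset (\<lambda>e. int g dvd fst e) (filter_mset (\<lambda>e. \<not> snd e) S)"
      by (simp add: F_def filter_filter_mset conj_ac)
    then show ?thesis by simp
  qed
  have out: "rots S + 2 \<le> size F + g"
  proof -
    have "size (filter_mset (\<lambda>e. \<not> snd e \<and> int 1 dvd fst e \<and> \<not> int g dvd fst e) S) + 2 \<le> g div 1"
      by (rule few_rotations_outside_covered[OF n_pos odd_n g(1,2)]) (use g(3) in auto)
    moreover have "size (filter_mset (\<lambda>e. \<not> snd e \<and> \<not> int g dvd fst e) S) + size F = rots S"
    proof -
      have "rots S = size (filter_mset (\<lambda>e. int g dvd fst e) (filter_mset (\<lambda>e. \<not> snd e) S))
        + size (filter_mset (\<lambda>e. \<not> int g dvd fst e) (filter_mset (\<lambda>e. \<not> snd e) S))"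
        unfolding rots_def by (metis multiset_partition size_union)
      then show ?thesis by (simp add: F_def filter_filter_mset conj_ac)
    qed
    ultimately show ?thesis by simp
  qed
  show ?thesis
  proof (cases "size F \<ge> n + N - 1")
    case True
    then show ?thesis using solved_of_many_rotations[of g] g(3) gn divN by (simp add: F_def)
  next
    case few: False
    have g_pos: "g > 0" using g(3) by simp
    have card1: "card (residues_in g (balanced_sums {#})) = 1"
    proof -
      have "balanced_sums {#} = {0}" by (auto simp: balanced_sums_def)
      then show ?thesis by (simp add: residues_in_def)
    qed
    obtain l b Up where l: "l > 0" "l dvd g" "Up \<subseteq># W0" "even (size Up)" "\<forall>e\<in>#Up. int l dvd fst e - b"
      "covers g l ({#} + Up)" "size ({#} :: (int \<times> bool) multiset) + size Up div 2 < g div l"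
      "int (size (filter_mset (\<lambda>e. int l dvd fst e - b) (W0 - Up))) \<ge> (int (refls S) - 2 * int g) + 2"
    \<comment> \<open>This \<open>c\<close> makes the required number of reflections equal to the
      number available.\<close>
    proof (rule ex_covered_coset[of g W0 "\<lambda>_. {#}" "int (refls S) - 2 * int g"])
      show "Suc (size ({#} :: (int \<times> bool) multiset)) \<le> card (residues_in g (balanced_sums {#}))"
        using card1 by simp
    qed (use g_pos oddg(1) W0 in auto)
    define R where "R = filter_mset (\<lambda>e. int l dvd fst e - b) (W0 - Up)"
    have sR: "int (size R) \<ge> int (refls S) - 2 * int g + 2" using l(8) by (simp add: R_def)
    obtain x where gx: "g = l * x" using l(2) by blast
    have lN: "n div l = N * (g div l)" "g div l \<ge> 1" "g div l \<le> g"
    proof -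
      have "g div l = x" "n div l = x * N" using l(1) gx N by (simp_all add: mult.assoc)
      moreover have "x > 0" using gx g_pos by (cases x) simp_all
      ultimately show "n div l = N * (g div l)" "g div l \<ge> 1" "g div l \<le> g"
        using gx l(1) by (simp_all add: mult.commute)
    qed
    have sUp: "size Up + 2 \<le> 2 * (g div l)" using l(4,7) by auto
    have ln: "l dvd n" "l < n" using l(2) gn g(4) g_pos by (auto intro: dvd_trans dest: dvd_imp_le)
    have Up_refl: "\<forall>e\<in>#Up. snd e" using W0(1) l(3) by (meson mset_subset_eqD)
    show ?thesis
    proof (cases "odd (size F) \<or> size F \<ge> N")
      case True
      \<comment> \<open>A further element of \<open>F\<close> repairs the parity of
        \<open>UH\<close>, and \<open>size UH < N\<close> leaves room for it.\<close>
      have "\<exists>U'. U' \<subseteq># F \<and> odd (size U') \<and> size U' \<le> N \<and> covers n g U'"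
      proof (cases "odd (size UH)")
        case True
        then show ?thesis using UH divN by (intro exI[of _ UH]) (auto simp: F_def)
      next
        case ev: False
        then have "size UH \<noteq> size F" "size UH \<le> size F"
          using True UH(2) divN size_mset_mono[OF UH(1)] by (auto simp: F_def)
        then have "size (F - UH) \<noteq> 0" using UH(1) by (simp add: F_def size_Diff_submset)
        then obtain e where e: "e \<in># F - UH" by fastforce
        then have eF: "\<not> snd e \<and> int g dvd fst e" using F by (meson in_diffD)
        then have "fst e \<in> balanced_sums {#e#}" using signed_sum_single[of e] by (simp add: balanced_sums_def)
        then have "covers n g (UH + {#e#})" using covers_add[OF UH(3)] eF by blast
        moreover have "UH + {#e#} \<subseteq># F" using UH(1) e by (intro submset_add_diff) (auto simp: F_def)
        ultimately show ?thesis using ev UH(2) divN by (intro exI[of _ "UH + {#e#}"]) auto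
      qed
      then obtain U' where U': "U' \<subseteq># F" "odd (size U')" "size U' \<le> N" "covers n g U'" by blast
      have cov: "covers n l (U' + Up)" using covers_trans[OF U'(4)] l(6) by simp
      have sU: "size U' + size Up + 2 \<le> N + 2 * g" using U'(3) sUp lN(3) by linarith
      define D where "D = n - size U' - size Up"
      have D: "size U' + size Up + D = n" using sU nac ac by (simp add: D_def)
      have evD: "even D" using D odd_n U'(2) l(4) by (metis even_add)
      have "int (size R) \<ge> 2" using sR few out rots_refls nac ac by linarith
      then have R2: "size R \<ge> 2" by linarith
      have "int D + 2 \<le> int (size R) + (int (size F) - int (size U'))"
        using sR out rots_refls nac ac D by linarith
      then have avail: "D + 2 \<le> size R + (size F - size U')" using size_mset_mono[OF U'(1)] by linarith
      \<comment> \<open>As many reflections as possible in even number, the rest from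
        \<open>F\<close>. An odd \<open>size R\<close> wastes one reflection, which the slack in
        \<open>avail\<close> absorbs.\<close>
      define y where "y = min D (2 * (size R div 2))"
      have y: "even y" "y \<le> D" "y \<le> size R" "D - y \<le> size (F - U')"
        using evD avail by (auto simp: y_def min_def size_Diff_submset[OF U'(1)])
      obtain Y where Y: "Y \<subseteq># R" "size Y = y" using ex_submset_size[OF y(3)] by blast
      obtain X where X: "X \<subseteq># F - U'" "size X = D - y" using ex_submset_size[OF y(4)] by blast
      have Y_refl: "\<forall>e\<in>#Y. snd e \<and> int l dvd fst e - b"
      proof
        fix e assume "e \<in># Y"
        then have "e \<in># R" using Y(1) by (meson mset_subset_eqD)
        then have "e \<in># W0 - Up" "int l dvd fst e - b" unfolding R_def set_mset_filter by blast+
        then show "snd e \<and> int l dvd fst e - b" using W0(1) by (meson in_diffD)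
      qed
      have X_rot: "\<forall>e\<in>#X. \<not> snd e \<and> int l dvd fst e"
      proof
        fix e assume "e \<in># X"
        then have "e \<in># F" using X(1) by (meson in_diffD mset_subset_eqD)
        then have e: "\<not> snd e" "int g dvd fst e" using F by auto
        have "int l dvd int g" using l(2) by simp
        then show "\<not> snd e \<and> int l dvd fst e" using e dvd_trans by blast
      qed
      have rXY: "refls (X + Y) = y" "refls Up = size Up"
        using X_rot Y_refl Y(2) Up_refl refls_eq_size[of Y] refls_eq_size[of Up]
        by (auto simp: refls_eq_0_iff[of X])
      have "\<forall>e\<in>#X + Y. int l dvd fst e - (if snd e then b else 0)" using X_rot Y_refl by auto
      moreover have "even (refls (X + Y))" unfolding rXY(1) by (rule y(1))
      ultimately obtain s where s: "signed_sum ((U' + Up) + (X + Y)) s 0" "int n dvd s"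
        using cover_fill[OF cov] by blast
      \<comment> \<open>Signs are free only if a reflection is present: it comes from
        \<open>Up\<close> or, if that is empty, from \<open>Y\<close>.\<close>
      have "refls ((U' + Up) + (X + Y)) > 0"
      proof (cases "size Up = 0")
        case True
        have "N < n" using nac ac by simp
        then have "D > 0" using D True U'(3) by linarith
        then have "y > 0" using R2 by (simp add: y_def)
        then show ?thesis using rXY by simp
      next
        case False
        then have "refls Up > 0" using rXY(2) by linarith
        then show ?thesis by simp
      qed
      then have sol: "solvable n ((U' + Up) + (X + Y))" using s solvableI by blast
      have "U' + X \<subseteq># filter_mset (\<lambda>e. \<not> snd e) S"
        using submset_add_diff[OF U'(1) X(1)] FA by (rule subset_mset.order_trans)
      moreover have "Up + Y \<subseteq># W0"
        using subset_mset.order_trans[OF Y(1)[unfolded R_def] multiset_filter_subset]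
        by (rule submset_add_diff[OF l(3)])
      ultimately have "(U' + X) + (Up + Y) \<subseteq># S" by (intro submset_parts) (auto simp: W0_def)
      moreover have "(U' + X) + (Up + Y) = (U' + Up) + (X + Y)" by simp
      ultimately show ?thesis using sol D X(2) Y(2) y(2) by (intro solvedI[of "(U' + Up) + (X + Y)"]) auto
    next
      case False
      have cF: "covers n g F"
      proof -
        have rot: "\<forall>e\<in>#F - UH. \<not> snd e \<and> int g dvd fst e" using F by (meson in_diffD)
        then have "refls (F - UH) = 0" by (simp add: refls_eq_0_iff)
        then have "wt (F - UH) \<in> balanced_sums (F - UH)"
          using signed_sum_self[of "F - UH"] by (simp add: balanced_sums_def)
        moreover from this have "int g dvd wt (F - UH)"
          using balanced_sums_dvd[of "F - UH" "int g" 0] rot by auto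
        ultimately have "covers n g (UH + (F - UH))" by (rule covers_add[OF UH(3)])
        then show ?thesis using UH(1) by (simp add: F_def)
      qed
      have cov: "covers n l (F + Up)" using covers_trans[OF cF] l(6) by simp
      have FS: "F + Up \<subseteq># S" using FA l(3) by (intro submset_parts) (simp_all add: W0_def)
      have Req: "filter_mset (\<lambda>e. snd e \<and> int l dvd fst e - b) (S - (F + Up)) = R"
        unfolding R_def W0_def by (rule filter_reflections_diff) (use F Up_refl in auto)
      have "int (size R) \<ge> int k + 1" using sR False out rots_refls nac ac by linarith
      then have "size R \<ge> k + 1" by linarith
      moreover have "size (F + Up) + 2 \<le> 2 * (n div l)"
      proof -
        obtain x where x: "g div l = x + 1" using lN(2) by (metis add.commute le_Suc_ex)
        have "n div l = c * x + 3 * x + c + 3" using lN(1) x ac(2) by (simp add: algebra_simps)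
        then show ?thesis using False sUp x ac(2) by simp
      qed
      ultimately obtain T where T: "T \<subseteq># S" "size T = 2 * n" "\<exists>s. signed_sum T s 0 \<and> int n dvd s"
        using solvable_of_covered_coset[OF n3 odd_n k_less k_pos k_le l(1) ln size_S FS cov, of b] Req False l(4)
        by auto
      moreover have "rots S < 2 * n" using out False nac ac by simp
      ultimately show ?thesis using solvable_of_balanced[OF T(1)] by (intro solvedI[of T]) auto
    qed
  qed
qed

end

text \<open>Parity needs one element more than in \<open>even_block\<close> when only
  \<open>l < 2 ^ Suc k\<close> is known, yet the imbalance must stay within \<open>k + 1\<close>.
  Given \<open>k + 1\<close> reflections, a block among them has no rotations at all; with fewer
  reflections the excess is small anyway.\<close>

lemma even_block_Suc:
  assumes "l > 0" "l < 2 ^ Suc k" "size Z = Suc (Suc k)"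
  shows "\<exists>X. X \<subseteq># Z \<and> X \<noteq> {#} \<and> even (rots X) \<and> zero_mod l b (k + 1) X"
proof (cases "refls Z \<ge> k + 1")
  case True
  then obtain Z' where Z': "Z' \<subseteq># filter_mset snd Z" "size Z' = k + 1"
    using ex_submset_size[of "k + 1" "filter_mset snd Z"] by (auto simp: refls_def)
  obtain X \<sigma> \<tau> where X: "X \<subseteq># Z'" "X \<noteq> {#}" "signed_sum X \<sigma> \<tau>" "int l dvd \<sigma> - b * \<tau>"
    by (rule ex_zero_block[of l 1 Z' b]) (use assms Z' in auto)
  have XZ: "X \<subseteq># filter_mset snd Z" using X(1) Z'(1) by (rule subset_mset.order_trans)
  have "\<forall>e\<in>#X. snd e" using mset_subset_eqD[OF XZ] by fastforce
  then have "rots X = 0" using refls_eq_size[of X] size_eq_rots_refls[of X] by simp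
  moreover have "\<bar>\<tau>\<bar> \<le> int (k + 1)"
    using signed_sum_abs_le[OF X(3)] refls_le_size[of X] size_mset_mono[OF X(1)] Z'(2) by linarith
  moreover have "X \<subseteq># Z" by (rule subset_mset.order_trans[OF XZ]) simp
  ultimately show ?thesis using X unfolding zero_mod_def by (intro exI[of _ X]) auto
next
  case False
  obtain X \<sigma> \<tau> where X: "X \<subseteq># Z" "X \<noteq> {#}" "signed_sum X \<sigma> \<tau>" "int l dvd \<sigma> - b * \<tau>" "even (rots X)"
    by (rule ex_zero_block[of l 2 Z b]) (use assms in auto)
  have "\<bar>\<tau>\<bar> \<le> int (k + 1)"
    using signed_sum_abs_le[OF X(3)] refls_mono[OF X(1)] False by linarith
  then show ?thesis using X unfolding zero_mod_def by blast
qed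

context long_sequence
begin

text \<open>The reserve consists of reflections equal modulo \<open>n\<close>, so nothing has to be
  covered. If any \<open>k + 1\<close> elements of \<open>V\<close> contain an even block, length
  \<open>2 * n\<close> is reached. Otherwise some block has an odd number of rotations, and
  prolonging it by even blocks leads to length \<open>n\<close>.\<close>

lemma solved_of_frequent_reflection:
  assumes no0: "rotations n = {#}" and few: "rots S < n"
    and R: "size (filter_mset (\<lambda>e. snd e \<and> int n dvd fst e - b) S) \<ge> k + 1"
  shows solved
proof -
  let ?p = "\<lambda>e. snd e \<and> int n dvd fst e - b"
  define R where "R = filter_mset ?p S"
  obtain P V where PV: "filter_mset (\<lambda>e. \<not> ?p e) S = P + V" "droppable n P"
    "size V = card (pair_key n ` set_mset V)" by (rule ex_pairing)
  have SR: "S = R + (P + V)" unfolding PV(1)[symmetric] R_def by (rule multiset_partition)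
  have SU: "S = {#} + V + P + R" unfolding SR by simp
  have R_p: "\<forall>e\<in>#R. ?p e" and R_size: "size R \<ge> k + 1" using R by (simp_all add: R_def)
  obtain q where q: "n = 2 * q + 1" using odd_n by (rule oddE)
  have kq: "k \<le> q" using n_ge q by simp
  have "size V \<le> card ({0..<int n} - {b mod int n}) + card {1..int q}"
  proof (rule size_le_of_keys[OF PV(3)])
    fix e assume e: "e \<in># V"
    have eV: "e \<in># filter_mset (\<lambda>e. \<not> ?p e) S" unfolding PV(1) using e by simp
    show "fst e mod int n \<in> {0..<int n} - {b mod int n}" if "snd e"
      using eV that n_pos by (auto simp: mod_eq_dvd_iff)
    show "min (fst e mod int n) (- fst e mod int n) \<in> {1..int q}" if "\<not> snd e"
    proof -
      have "e \<notin># rotations n" using no0 by simp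
      then have "\<not> int n dvd fst e" using eV that by auto
      moreover have "(int n - 1) div 2 = int q" using q by simp
      ultimately show ?thesis
        using min_residue_bounds(1)[OF n_pos odd_n, of "fst e"] min_residue_bounds(2)[OF n_pos, of "fst e"]
        by simp
    qed
  qed simp_all
  also have "\<dots> = (n - 1) + q" using n_pos by (simp add: card_Diff_singleton)
  finally have V: "size V \<le> 3 * q" using q by simp
  have total: "size V + size P + size R = 2 * n + k" using size_S SU by (metis add_0 size_union)
  show ?thesis
  proof (cases "\<forall>Z. Z \<subseteq># V \<longrightarrow> size Z = Suc k \<longrightarrow>
      (\<exists>X. X \<subseteq># Z \<and> X \<noteq> {#} \<and> even (rots X) \<and> zero_mod n b (k + 1) X)")
    case True
    have "size ({#} :: (int \<times> bool) multiset) + size V + k + 1 \<le> 2 * n" using V q kq by simp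
    then obtain T where T: "T \<subseteq># S" "size T = 2 * n" "\<exists>s. signed_sum T s 0 \<and> int n dvd s"
      using endgame[OF covers_refl _ SU size_S R_p R_size PV(2)] True by auto
    then show ?thesis using solvable_of_balanced[OF T(1)] few by (intro solvedI[of T]) auto
  next
    case False
    then obtain Z where Z: "Z \<subseteq># V" "size Z = Suc k"
      "\<And>X. X \<subseteq># Z \<Longrightarrow> X \<noteq> {#} \<Longrightarrow> even (rots X) \<Longrightarrow> \<not> zero_mod n b (k + 1) X" by blast
    obtain X \<sigma> \<tau> where X: "X \<subseteq># Z" "X \<noteq> {#}" "signed_sum X \<sigma> \<tau>" "int n dvd \<sigma> - b * \<tau>"
      by (rule ex_zero_block[of n 1 Z b]) (use n_pos k_less Z(2) in auto)
    have sX: "size X \<le> k + 1" using size_mset_mono[OF X(1)] Z(2) by simp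
    have zX: "zero_mod n b (k + 1) X"
      using signed_sum_abs_le[OF X(3)] refls_le_size[of X] sX X(3,4) unfolding zero_mod_def
      by (intro exI[of _ \<sigma>] exI[of _ \<tau>]) auto
    then have oddX: "odd (rots X)" using Z(3) X(1,2) by blast
    have XV: "X \<subseteq># V" using X(1) Z(1) by (rule subset_mset.order_trans)
    \<comment> \<open>What \<open>Y\<close> must supply when \<open>P\<close> and \<open>R\<close>
      are used up.\<close>
    define B where "B = n - (size P + size R)"
    have "B + (k + 1) \<le> size V"
      using total size_mset_mono[OF Z(1)] Z(2) n_pos by (simp add: B_def)
    then obtain Y where Y: "X \<subseteq># Y" "Y \<subseteq># V" "zero_mod n b (k + 1) Y" "even (rots Y) = even (rots X)"
      "B \<le> size Y" "Y = X \<or> size Y \<le> B + (k + 1)"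
      using even_zero_mod_chain[OF zX XV, of B "k + 1"] even_block_Suc[OF n_pos, of k] k_less by auto
    obtain \<rho> \<theta> where Y': "signed_sum Y \<rho> \<theta>" "int n dvd \<rho> - b * \<theta>" "\<bar>\<theta>\<bar> \<le> int (k + 1)"
      using Y(3) unfolding zero_mod_def by blast
    have oddY: "odd (rots Y)" using Y(4) oddX by simp
    then have "rots Y \<ge> 1" by (cases "rots Y") auto
    then have \<theta>: "\<bar>\<theta>\<bar> + 1 \<le> int (size Y)"
      using signed_sum_abs_le[OF Y'(1)] size_eq_rots_refls[of Y] by linarith
    \<comment> \<open>A short \<open>Y\<close> contains a rotation, so the sum is at most
      \<open>2 * k + 1\<close>. A long one has at most \<open>B + k + 1\<close> elements with
      \<open>B \<le> q - k - 1\<close>, so the sum is at most \<open>q + k + 1\<close>, and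
      \<open>k \<le> q\<close>.\<close>
    have "int (size Y) + \<bar>\<theta>\<bar> \<le> int n"
    proof (cases "size Y \<le> k + 1")
      case True
      then show ?thesis using \<theta> n_ge by linarith
    next
      case big: False
      then have "size Y \<le> B + (k + 1)" "B > 0" using Y(6) sX by auto
      then show ?thesis using Y'(3) V total q by (simp add: B_def)
    qed
    moreover have "even (int n - int (size ({#} :: (int \<times> bool) multiset)) - int (size Y) - \<theta>)"
      using signed_sum_parity[OF Y'(1)] oddY odd_n by (simp add: size_eq_rots_refls[of Y])
    moreover have "n \<le> size ({#} :: (int \<times> bool) multiset) + size Y + size P + size R"
      using Y(5) by (simp add: B_def)
    moreover have "\<bar>\<theta>\<bar> \<le> int (size R)" using Y'(3) R_size by linarith
    ultimately obtain T where T: "T \<subseteq># {#} + Y + P + R" "size T = n" "\<exists>s. signed_sum T s 0 \<and> int n dvd s"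
      using assemble[OF covers_refl Y'(1,2) R_p _ PV(2), of n] by auto
    have "{#} + Y + P + R \<subseteq># S" unfolding SU using Y(2) by (simp add: subset_mset.add_mono)
    then have "T \<subseteq># S" using T(1) by (meson subset_mset.order_trans)
    then show ?thesis using solvable_of_balanced[of T S] few T(2,3) by (intro solvedI[of T]) auto
  qed
qed

text \<open>If the subgroup found is nontrivial modulo \<open>n\<close>, the pigeonhole argument has
  room for parity; otherwise the reserve consists of equal reflections.\<close>

lemma solved_of_no_trivial_rotation:
  assumes few: "\<And>l. l dvd n \<Longrightarrow> l < n \<Longrightarrow>
      size (filter_mset (\<lambda>e. \<not> snd e \<and> int l dvd fst e \<and> \<not> int n dvd fst e) S) + 2 \<le> n div l"
    and no0: "rotations n = {#}"
  shows solved
proof -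
  have nz: "\<not> int n dvd fst e" if "e \<in># S" "\<not> snd e" for e
  proof
    assume "int n dvd fst e"
    then have "e \<in># rotations n" using that by simp
    then show False using no0 by simp
  qed
  have rot_eq: "filter_mset (\<lambda>e. \<not> snd e \<and> \<not> int n dvd fst e) S = filter_mset (\<lambda>e. \<not> snd e) S"
    using nz by (auto intro!: filter_mset_cong)
  have "size (filter_mset (\<lambda>e. \<not> snd e \<and> int 1 dvd fst e \<and> \<not> int n dvd fst e) S) + 2 \<le> n div 1"
    using n3 by (intro few) auto
  then have rn: "rots S + 2 \<le> n" by (simp add: rots_def rot_eq)
  \<comment> \<open>The covering set must be even for the target length \<open>2 * n\<close>, hence
    an even number of rotations.\<close>
  have "\<exists>Q. Q \<subseteq># rotations l \<and> size Q = 2 * (size (rotations l) div 2)" for l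
    using ex_submset_size[of "2 * (size (rotations l) div 2)" "rotations l"] by fastforce
  then obtain Q where Q: "\<And>l. Q l \<subseteq># rotations l" "\<And>l. size (Q l) = 2 * (size (rotations l) div 2)"
    by metis
  have Q_rot: "\<forall>e\<in>#Q l. \<not> snd e \<and> int l dvd fst e" for l
  proof
    fix e assume "e \<in># Q l"
    then show "\<not> snd e \<and> int l dvd fst e" using mset_subset_eqD[OF Q(1)] by fastforce
  qed
  have rot_sub: "rotations l \<subseteq># filter_mset (\<lambda>e. \<not> snd e) S" for l
  proof -
    have "rotations l = filter_mset (\<lambda>e. int l dvd fst e) (filter_mset (\<lambda>e. \<not> snd e) S)"
      by (simp add: filter_filter_mset conj_ac)
    then show ?thesis by simp
  qed
  have Q_sub: "Q l \<subseteq># filter_mset (\<lambda>e. \<not> snd e) S" for l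
    using Q(1) rot_sub by (rule subset_mset.order_trans)
  define W0 where "W0 = filter_mset snd S"
  \<comment> \<open>This turns the size condition at \<open>l = 1\<close> into an equality, and
    losing at most one rotation to parity still leaves \<open>c + 2 \<ge> k + 1\<close>.\<close>
  define c where "c = int k - int (rots S) + 2 * int (size (Q 1))"
  have W0: "\<forall>e\<in>#W0. snd e" "size W0 = refls S" by (simp_all add: W0_def refls_def)
  have "size (Q 1) = 2 * (rots S div 2)" using Q(2)[of 1] by (simp add: rots_def)
  then have c: "c + 2 \<ge> int k + 1" by (cases "even (rots S)") (auto simp: c_def elim!: oddE)
  obtain l b Up where l: "l > 0" "l dvd n" "Up \<subseteq># W0" "even (size Up)" "\<forall>e\<in>#Up. int l dvd fst e - b"
    "covers n l (Q l + Up)" "size (Q l) + size Up div 2 < n div l"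
    "int (size (filter_mset (\<lambda>e. int l dvd fst e - b) (W0 - Up))) \<ge> c + 2"
  proof (rule ex_covered_coset[OF n_pos odd_n W0(1), of Q c])
    show "refls (Q l) = 0" for l using Q_rot by (auto simp: refls_eq_0_iff)
    show "\<forall>e\<in>#Q l. int l dvd fst e" for l using Q_rot by blast
    show "Suc (size (Q l)) \<le> card (residues_in n (balanced_sums (Q l)))" for l
      by (rule card_balanced_sums_ge_size[OF n_pos odd_n few]) (simp_all add: rot_eq Q_sub)
    show "int (size W0) \<ge> 2 * int n + c - 2 * int (size (Q 1))"
      using rots_refls W0(2) by (simp add: c_def)
  qed
  have Up_refl: "\<forall>e\<in>#Up. snd e" using W0(1) l(3) by (meson mset_subset_eqD)
  have "filter_mset (\<lambda>e. snd e \<and> int l dvd fst e - b) (S - (Q l + Up)) =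
    filter_mset (\<lambda>e. int l dvd fst e - b) (W0 - Up)"
    unfolding W0_def by (rule filter_reflections_diff) (use Q_rot Up_refl in auto)
  then have R: "size (filter_mset (\<lambda>e. snd e \<and> int l dvd fst e - b) (S - (Q l + Up))) \<ge> k + 1"
    using l(8) c by (simp only:)
  show ?thesis
  proof (cases "l < n")
    case True
    have sub: "Q l + Up \<subseteq># S" using Q_sub l(3) by (intro submset_parts) (simp_all add: W0_def)
    have ev: "even (size (Q l + Up))" using Q(2) l(4) by simp
    have sz: "size (Q l + Up) + 2 \<le> 2 * (n div l)" using l(7,4) by auto
    obtain T where T: "T \<subseteq># S" "size T = 2 * n" "\<exists>s. signed_sum T s 0 \<and> int n dvd s"
      using solvable_of_covered_coset[OF n3 odd_n k_less k_pos k_le l(1,2) True size_S sub l(6) ev sz R] by blast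
    then show ?thesis using solvable_of_balanced[OF T(1)] rn by (intro solvedI[of T]) auto
  next
    case False
    then have "l = n" using l(2) n_pos by (simp add: dvd_imp_le le_antisym)
    \<comment> \<open>For \<open>l = n\<close> the strict bound is \<open>1\<close>, so nothing is
      spent on the cover.\<close>
    then have "size (Q l) = 0" "size Up div 2 = 0" using l(7) n_pos by auto
    moreover have "size Up = 2 * (size Up div 2)" using l(4) by simp
    ultimately have "Q l + Up = {#}" by simp
    then show ?thesis using solved_of_frequent_reflection[OF no0, of b] R rn \<open>l = n\<close> by simp
  qed
qed

text \<open>Trivial rotations are fillers of either parity, so length \<open>n\<close> is always the
  target. It remains to find a balanced part with a reflection that is short enough for
  \<open>n\<close> and long enough for the fillers to suffice.\<close>

lemma solved_of_trivial_rotation: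
  assumes few: "\<And>l. l dvd n \<Longrightarrow> l < n \<Longrightarrow>
      size (filter_mset (\<lambda>e. \<not> snd e \<and> int l dvd fst e \<and> \<not> int n dvd fst e) S) + 2 \<le> n div l"
    and some0: "rotations n \<noteq> {#}"
  shows solved
proof (cases "size (rotations n) \<ge> n")
  case True
  then show ?thesis using solved_of_many_rotations[of n] n_pos by simp
next
  case z_less: False
  define Z0 where "Z0 = rotations n"
  define A where "A = filter_mset (\<lambda>e. \<not> snd e \<and> \<not> int n dvd fst e) S"
  define W0 where "W0 = filter_mset snd S"
  have zn: "size Z0 < n" and z1: "size Z0 \<ge> 1" using z_less some0 by (auto simp: Z0_def Suc_le_eq nonempty_has_size[symmetric])
  have split: "filter_mset (\<lambda>e. \<not> snd e) S = Z0 + A"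
  proof -
    have "filter_mset (\<lambda>e. \<not> snd e) S = filter_mset (\<lambda>e. int n dvd fst e) (filter_mset (\<lambda>e. \<not> snd e) S)
      + filter_mset (\<lambda>e. \<not> int n dvd fst e) (filter_mset (\<lambda>e. \<not> snd e) S)"
      by (rule multiset_partition)
    then show ?thesis by (simp add: Z0_def A_def filter_filter_mset conj_ac)
  qed
  have S: "S = W0 + (Z0 + A)" unfolding split[symmetric] W0_def by (rule multiset_partition)
  have total: "size W0 + size Z0 + size A = 2 * n + k" using size_S S by (metis add.assoc size_union)
  have "size (filter_mset (\<lambda>e. \<not> snd e \<and> int 1 dvd fst e \<and> \<not> int n dvd fst e) S) + 2 \<le> n div 1"
    using n3 by (intro few) auto
  then have An: "size A + 2 \<le> n" by (simp add: A_def)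
  have Z0: "\<forall>e\<in>#Z0. \<not> snd e \<and> int n dvd fst e" by (simp add: Z0_def)
  have A: "\<forall>e\<in>#A. \<not> snd e \<and> \<not> int n dvd fst e" by (simp add: A_def)
  have W0: "\<forall>e\<in>#W0. snd e" by (simp add: W0_def)
  have Z0_sum: "signed_sum Z (wt Z) 0 \<and> int n dvd wt Z" if "Z \<subseteq># Z0" for Z
  proof -
    have Z: "\<forall>e\<in>#Z. \<not> snd e \<and> int n dvd fst e" using Z0 that by (meson mset_subset_eqD)
    then have "refls Z = 0" by (simp add: refls_eq_0_iff)
    then have "signed_sum Z (wt Z) 0" using signed_sum_self[of Z] by simp
    moreover from this have "int n dvd wt Z - 0 * 0"
      by (rule signed_sum_dvd[rotated]) (use Z in auto)
    ultimately show ?thesis by simp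
  qed
  obtain P1 V1 where P1: "W0 = P1 + V1" "droppable n P1" "size V1 = card (pair_key n ` set_mset V1)"
    by (rule ex_pairing)
  obtain P2 V2 where P2: "A = P2 + V2" "droppable n P2" "size V2 = card (pair_key n ` set_mset V2)"
    by (rule ex_pairing)
  obtain q where q: "n = 2 * q + 1" using odd_n by (rule oddE)
  have kq: "k \<le> q" "q \<ge> 1" using n_ge q n3 by auto
  have V1: "size V1 \<le> n"
  proof -
    have "size V1 \<le> card {0..<int n} + card ({} :: int set)"
      by (rule size_le_of_keys[OF P1(3)]) (use n_pos W0 P1(1) in auto)
    then show ?thesis by simp
  qed
  have V2: "size V2 \<le> q"
  proof -
    have "size V2 \<le> card ({} :: int set) + card {1..int q}"
    proof (rule size_le_of_keys[OF P2(3)])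
      fix e assume e: "e \<in># V2"
      then have "\<not> snd e" "\<not> int n dvd fst e" using A P2(1) by auto
      moreover have "(int n - 1) div 2 = int q" using q by simp
      ultimately show "min (fst e mod int n) (- fst e mod int n) \<in> {1..int q}"
        using min_residue_bounds(1)[OF n_pos odd_n, of "fst e"] min_residue_bounds(2)[OF n_pos, of "fst e"]
        by simp
      show "fst e mod int n \<in> {}" if "snd e" using that \<open>\<not> snd e\<close> by simp
    qed simp_all
    then show ?thesis by simp
  qed
  show ?thesis
  proof (cases "P1 = {#}")
    \<comment> \<open>The reflections are distinct modulo \<open>n\<close>, so there are as many
      differences \<open>fst w - fst e\<close> as reflections. Their number and the
      \<open>size A + 1\<close> or more sums of \<open>A\<close> together exceed \<open>n\<close> by
      at least two, and a nonzero common value gives two reflections that cancel all of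
      \<open>A\<close>.\<close>
    case True
    have cardW: "size W0 = card (pair_key n ` set_mset W0)" using P1 True by simp
    have W0n: "size W0 \<le> n" using V1 P1(1) True by simp
    have "size W0 > 0" using total zn An by simp
    then have "W0 \<noteq> {#}" by auto
    then obtain w where w: "w \<in># W0" by blast
    define D where "D = (\<lambda>e. (fst w - fst e) mod int n) ` set_mset W0"
    define E where "E = residues_in n (balanced_sums A)"
    have cardD: "card D = size W0"
    proof -
      let ?K = "pair_key n ` set_mset W0" and ?f = "\<lambda>p. (fst w - fst p) mod int n"
      have key: "pair_key n e = (fst e mod int n, True)" if "e \<in># W0" for e
        using that W0 by (simp add: pair_key_def)
      have "D = ?f ` ?K"
        unfolding D_def image_image using key by (intro image_cong) (auto simp: mod_simps)
      moreover have "inj_on ?f ?K"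
      proof (rule inj_onI)
        fix p p' assume p: "p \<in> ?K" "p' \<in> ?K" "?f p = ?f p'"
        then obtain u v where "p = (u mod int n, True)" "p' = (v mod int n, True)" using key by force
        moreover from this have "(fst w - u) mod int n = (fst w - v) mod int n"
          using p(3) by (simp add: mod_simps)
        then have "int n dvd (fst w - u) - (fst w - v)" by (simp add: mod_eq_dvd_iff)
        then have "v mod int n = u mod int n" by (simp add: mod_eq_dvd_iff)
        ultimately show "p = p'" by simp
      qed
      ultimately show ?thesis using cardW by (simp add: card_image)
    qed
    have cardE: "Suc (size A) \<le> card E"
      unfolding E_def by (rule card_balanced_sums_ge_size[OF n_pos odd_n few]) (simp_all add: A_def)
    \<comment> \<open>One common value is not enough, because zero is attained by
      \<open>e = w\<close>.\<close>
    have "card (D \<inter> E) \<ge> 2"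
    proof -
      have fin: "finite D" "finite E" unfolding D_def E_def using finite_residues_in[OF n_pos] by auto
      have "D \<union> E \<subseteq> {0..<int n}" using n_pos residues_in_subset[OF n_pos] by (auto simp: D_def E_def)
      then have "card (D \<union> E) \<le> n" using card_mono[of "{0..<int n}" "D \<union> E"] by simp
      moreover have "card D + card E = card (D \<union> E) + card (D \<inter> E)" by (rule card_Un_Int[OF fin])
      ultimately show ?thesis using cardD cardE total zn k_pos by linarith
    qed
    then have "\<not> D \<inter> E \<subseteq> {0}" using card_mono[of "{0}" "D \<inter> E"] by auto
    then obtain d where d: "d \<in> D" "d \<in> E" "d \<noteq> 0" by auto
    obtain e where e: "e \<in># W0" "d = (fst w - fst e) mod int n" using d(1) by (auto simp: D_def)
    have "e \<noteq> w" using e(2) d(3) by auto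
    then have "e \<in># W0 - {#w#}" using e(1) by (simp add: in_diff_count)
    then have we: "{#w, e#} \<subseteq># W0" using w by (metis insert_DiffM insert_subset_eq_iff mset_subset_eq_single)
    obtain a where a: "a \<in> balanced_sums A" "d = a mod int n" using d(2) by (auto simp: E_def residues_in_def)
    have "(fst w - fst e) mod int n = a mod int n" using e(2) a(2) by simp
    then have "int n dvd (fst w - fst e) - a" unfolding mod_eq_dvd_iff .
    have "snd w = snd e" using w e(1) W0 by blast
    then have we_sum: "signed_sum {#w, e#} (fst w - fst e) 0" by (rule signed_sum_pair)
    have "n - 2 - size A \<le> size Z0" using total W0n by simp
    then obtain Z where Z: "Z \<subseteq># Z0" "size Z = n - 2 - size A" by (rule ex_submset_size)
    define T where "T = {#w, e#} + A + Z"
    have "signed_sum T ((fst w - fst e) - a + wt Z) (0 - 0 + 0)"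
      unfolding T_def using we_sum a(1) Z0_sum[OF Z(1)]
      by (intro signed_sum_add signed_sum_diff) (auto simp: balanced_sums_def)
    moreover have "int n dvd (fst w - fst e) - a + wt Z"
      using \<open>int n dvd (fst w - fst e) - a\<close> Z0_sum[OF Z(1)] by (intro dvd_add) auto
    moreover have "refls T > 0" using w W0 by (auto simp: T_def)
    ultimately have "solvable n T" using solvableI by simp
    moreover have "size T = n" using Z(2) An by (simp add: T_def)
    moreover have "T \<subseteq># S"
    proof -
      have "{#w, e#} + (Z + A) \<subseteq># W0 + (Z0 + A)" using we Z(1) by (intro subset_mset.add_mono) auto
      moreover have "T = {#w, e#} + (Z + A)" by (simp add: T_def)
      ultimately show ?thesis unfolding S by (simp only:)
    qed
    ultimately show ?thesis by (intro solvedI[of T]) auto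
  next
    case False
    have P1_2: "size P1 \<ge> 2" "even (size P1)" "even (size P2)"
    proof -
      show ev: "even (size P1)" "even (size P2)" using P1(2) P2(2) by (auto simp: droppable_def)
      have "size P1 \<noteq> 0" using False by simp
      then show "size P1 \<ge> 2" using ev(1) by presburger
    qed
    define V where "V = V1 + V2"
    define W where "W = size P1 + size P2 + size Z0"
    have VW: "size V + W = 2 * n + k" using total P1(1) P2(1) by (simp add: V_def W_def)
    have V: "size V \<le> n + q" using V1 V2 by (simp add: V_def)
    \<comment> \<open>No reserve can compensate an imbalance here, so blocks of excess zero are
      used. Each may cost \<open>2 * (k + 1)\<close> elements, which
      \<open>size V \<le> n + q\<close> and \<open>k \<le> q\<close> afford.\<close>
    have "\<exists>Y s. Y \<subseteq># V \<and> signed_sum Y s 0 \<and> int n dvd s \<and> n \<le> size Y + W \<and> size Y \<le> n"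
    proof (cases "n \<le> W")
      case True
      then show ?thesis by (intro exI[of _ "{#}"] exI[of _ 0]) simp
    next
      case less: False
      define Good where "Good Y \<longleftrightarrow> (\<exists>s. signed_sum Y s 0 \<and> int n dvd s)" for Y
      have step: "\<exists>X. X \<subseteq># V - Y \<and> X \<noteq> {#} \<and> size X \<le> Suc (2 * k + 1) \<and> Good (Y + X)"
        if Y: "Good Y" "size (V - Y) > 2 * k + 1" for Y
      proof -
        obtain Z where Z: "Z \<subseteq># V - Y" "size Z = 2 * (k + 1)"
          using ex_submset_size[of "2 * (k + 1)" "V - Y"] Y(2) by auto
        obtain X \<sigma> where X: "X \<subseteq># Z" "X \<noteq> {#}" "signed_sum X \<sigma> 0" "int n dvd \<sigma>"
          by (rule ex_balanced_zero_block[OF n_pos k_less, of Z]) (use Z(2) in auto)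
        obtain s where s: "signed_sum Y s 0" "int n dvd s" using Y(1) by (auto simp: Good_def)
        have "Good (Y + X)" unfolding Good_def
          using signed_sum_add[OF s(1) X(3)] s(2) X(4) by (intro exI[of _ "s + \<sigma>"]) simp
        moreover have "X \<subseteq># V - Y" using X(1) Z(1) by (rule subset_mset.order_trans)
        moreover have "size X \<le> Suc (2 * k + 1)" using size_mset_mono[OF X(1)] Z(2) by simp
        ultimately show ?thesis using X(2) by blast
      qed
      have "Good {#}" by (auto simp: Good_def)
      moreover have "(n - W) + (2 * k + 1) \<le> size V" using VW less kq q by simp
      ultimately obtain Y where Y: "Y \<subseteq># V" "Good Y" "n - W \<le> size Y" "Y = {#} \<or> size Y \<le> (n - W) + (2 * k + 1)"
        using ex_chain[of Good "{#}" V "2 * k + 1" "n - W"] step by auto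
      have "size Y \<le> n" using Y(4) less V VW q by auto
      moreover have "n \<le> size Y + W" using Y(3) by simp
      ultimately show ?thesis using Y(1,2) unfolding Good_def by blast
    qed
    then obtain Y s where Y: "Y \<subseteq># V" "signed_sum Y s 0" "int n dvd s" "n \<le> size Y + W" "size Y \<le> n" by blast
    define D where "D = n - size Y"
    \<comment> \<open>Pairs supply even lengths only; \<open>size Z0 \<ge> 1\<close> settles the
      last parity.\<close>
    define i where "i = min (2 * (D div 2)) (size P1)"
    define j where "j = min (2 * ((D - i) div 2)) (size P2)"
    have i: "even i" "i \<le> size P1" "i \<le> D" using P1_2(2) by (auto simp: i_def min_def)
    have j: "even j" "j \<le> size P2" "i + j \<le> D" using P1_2(3) i(3) by (auto simp: j_def min_def)
    have "D - i - j \<le> size Z0"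
    proof -
      have "D \<le> W" using Y(4) by (simp add: D_def)
      then show ?thesis using z1 unfolding i_def j_def W_def by (auto simp: min_def)
    qed
    then obtain Z where Z: "Z \<subseteq># Z0" "size Z = D - i - j" by (rule ex_submset_size)
    obtain P1' p1 where P1': "P1' \<subseteq># P1" "size P1' = i" "signed_sum P1' p1 0" "int n dvd p1"
      using droppableD[OF P1(2) i(2,1)] by blast
    obtain P2' p2 where P2': "P2' \<subseteq># P2" "size P2' = j" "signed_sum P2' p2 0" "int n dvd p2"
      using droppableD[OF P2(2) j(2,1)] by blast
    define T where "T = Y + P1' + P2' + Z"
    have "signed_sum T (s + p1 + p2 + wt Z) (0 + 0 + 0 + 0)"
      unfolding T_def using Y(2) P1'(3) P2'(3) Z0_sum[OF Z(1)] by (intro signed_sum_add) auto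
    moreover have "int n dvd s + p1 + p2 + wt Z"
      using Y(3) P1'(4) P2'(4) Z0_sum[OF Z(1)] by (intro dvd_add) auto
    \<comment> \<open>If \<open>Y\<close> has no reflection, its elements come from
      \<open>V2\<close> and number at most \<open>q\<close>, so at least two reflections are drawn
      from \<open>P1\<close>.\<close>
    moreover have "refls T > 0"
    proof (cases "refls Y = 0")
      case True
      have "\<forall>e\<in>#V1. snd e" using W0 P1(1) by simp
      then have "rots V1 = 0" using refls_eq_size[of V1] size_eq_rots_refls[of V1] by simp
      then have "size Y \<le> q"
        using True rots_mono[OF Y(1)] size_eq_rots_refls[of Y] size_eq_rots_refls[of V2] V2
        by (simp add: V_def)
      then have "D \<ge> 2" using q kq by (simp add: D_def)
      then have "i \<ge> 2" using P1_2(1) by (simp add: i_def)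
      moreover have "\<forall>e\<in>#P1'. snd e" using W0 P1(1) P1'(1) by (auto dest: mset_subset_eqD)
      ultimately have "refls P1' \<ge> 2" using refls_eq_size[of P1'] P1'(2) by simp
      then show ?thesis by (simp add: T_def)
    qed (simp add: T_def)
    ultimately have "solvable n T" using solvableI by simp
    moreover have "size T = n" using P1'(2) P2'(2) Z(2) j(3) Y(5) by (simp add: T_def D_def)
    moreover have "T \<subseteq># S"
    proof -
      have "T \<subseteq># V + P1 + P2 + Z0" unfolding T_def using Y(1) P1'(1) P2'(1) Z(1)
        by (intro subset_mset.add_mono)
      moreover have "V + P1 + P2 + Z0 = S" unfolding S P1(1) P2(1) V_def by simp
      ultimately show ?thesis by simp
    qed
    ultimately show ?thesis by (intro solvedI[of T]) auto
  qed
qed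

theorem solved: solved
proof -
  \<comment> \<open>The least \<open>g\<close> corresponds to the largest covered subgroup.\<close>
  define g where "g = (LEAST g. rot_covered n S g)"
  have ex: "rot_covered n S n" using rot_covered_self[OF n_pos] .
  have g: "rot_covered n S g" unfolding g_def using ex by (rule LeastI)
  have least: "g \<le> g'" if "rot_covered n S g'" for g' unfolding g_def using that by (rule Least_le)
  have "g > 0" "g \<le> n" using g n_pos by (auto simp: rot_covered_def dvd_imp_le)
  then consider "g = 1" | "1 < g" "g < n" | "g = n" by linarith
  then show ?thesis
  proof cases
    case 1
    then show ?thesis using solved_of_cover_all g by simp
  next
    case 2
    then show ?thesis using solved_of_proper_cover[OF g least] by blast
  next
    case 3
    note few = few_rotations_outside_covered[OF n_pos odd_n g least, unfolded 3]
    show ?thesis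
      using solved_of_no_trivial_rotation[OF few] solved_of_trivial_rotation[OF few] by blast
  qed
qed

end

subsection \<open>The extremal sequence\<close>

text \<open>The largest power of two present exceeds the sum of all smaller ones, so it determines
  the sign of the total.\<close>

lemma signed_sum_powers_of_2:
  assumes "A \<subseteq># image_mset (\<lambda>i. (2 ^ i, False)) (mset_set {..<k})" "signed_sum A s t"
  shows "\<bar>s\<bar> < 2 ^ k \<and> (A \<noteq> {#} \<longrightarrow> s \<noteq> 0)"
  using assms
proof (induction k arbitrary: A s t)
  case (Suc k)
  let ?e = "(2 ^ k, False) :: int \<times> bool"
  let ?M = "image_mset (\<lambda>i. (2 ^ i, False)) (mset_set {..<k}) :: (int \<times> bool) multiset"
  have A: "A \<subseteq># add_mset ?e ?M" using Suc.prems(1) by (simp add: lessThan_Suc)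
  show ?case
  proof (cases "?e \<in># A")
    case True
    then obtain A' where A': "A = add_mset ?e A'" by (metis insert_DiffM)
    then have sub: "A' \<subseteq># ?M" using A by simp
    have "signed_sum A' (s - 2 ^ k) t \<or> signed_sum A' (s + 2 ^ k) t"
      using Suc.prems(2) signed_sum_add_mset_rotation[of ?e A'] A' by simp
    then show ?thesis using Suc.IH[OF sub] by fastforce
  next
    case False
    then have "A \<subseteq># ?M" using A by (metis diff_single_trivial subset_eq_diff_conv add_mset_add_single)
    then have "\<bar>s\<bar> < 2 ^ k \<and> (A \<noteq> {#} \<longrightarrow> s \<noteq> 0)" using Suc.IH Suc.prems(2) by blast
    then show ?thesis by auto
  qed
qed auto

lemma wt_filter_rotations:
  "\<forall>e\<in>#T. snd e \<longrightarrow> fst e = 0 \<Longrightarrow> wt (filter_mset (\<lambda>e. \<not> snd e) T) = wt T"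
  by (induction T) auto

lemma signed_sum_filter_rotations:
  assumes "\<forall>e\<in>#T. snd e \<longrightarrow> fst e = 0" "signed_sum T s t"
  shows "signed_sum (filter_mset (\<lambda>e. \<not> snd e) T) s 0"
proof -
  obtain T1 T2 where T: "T = T1 + T2" "s = wt T1 - wt T2" using assms(2) by (auto simp: signed_sum_def)
  have "refls (filter_mset (\<lambda>e. \<not> snd e) T') = 0" for T' by (simp add: refls_eq_0_iff)
  then show ?thesis unfolding signed_sum_def
    using T wt_filter_rotations[of T1] wt_filter_rotations[of T2] assms(1)
    by (intro exI[of _ "filter_mset (\<lambda>e. \<not> snd e) T1"] exI[of _ "filter_mset (\<lambda>e. \<not> snd e) T2"]) auto
qed

definition extremal_sequence :: "nat \<Rightarrow> nat \<Rightarrow> (int \<times> bool) multiset" where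
  "extremal_sequence n k =
     replicate_mset (2 * n - 1) (0, True) + image_mset (\<lambda>i. (2 ^ i, False)) (mset_set {..<k})"

text \<open>Reflections have exponent zero, so the signed sum stems from rotations and is below
  \<open>n\<close> in absolute value; hence \<open>T\<close> consists of reflections. Their even
  number, divisible by the odd \<open>n\<close>, would be at least \<open>2 * n\<close>, one more
  than are available.\<close>

lemma extremal_sequence_no_solution:
  assumes "n > 0" "odd n" "2 ^ k \<le> n" and T: "T \<subseteq># extremal_sequence n k" "T \<noteq> {#}"
    and "even (refls T)" "signed_sum T s t" "int n dvd s"
  shows "\<not> n dvd size T"
proof
  assume dvd: "n dvd size T"
  let ?P = "image_mset (\<lambda>i. (2 ^ i, False)) (mset_set {..<k}) :: (int \<times> bool) multiset"
  define A where "A = filter_mset (\<lambda>e. \<not> snd e) T"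
  have "\<forall>e\<in>#extremal_sequence n k. snd e \<longrightarrow> fst e = 0"
    by (auto simp: extremal_sequence_def)
  then have "\<forall>e\<in>#T. snd e \<longrightarrow> fst e = 0" using T(1) by (meson mset_subset_eqD)
  then have s: "signed_sum A s 0" using signed_sum_filter_rotations assms(7) by (simp add: A_def)
  have "filter_mset (\<lambda>e. \<not> snd e) (extremal_sequence n k) = ?P"
  proof -
    have "filter_mset (\<lambda>e. \<not> snd e) (replicate_mset (2 * n - 1) (0, True)) = ({#} :: (int \<times> bool) multiset)"
      by (auto simp: filter_mset_eq_conv)
    moreover have "filter_mset (\<lambda>e. \<not> snd e) ?P = ?P" unfolding filter_mset_eq_conv by auto
    ultimately show ?thesis unfolding extremal_sequence_def filter_union_mset by (metis add_0)
  qed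
  then have "A \<subseteq># ?P" using multiset_filter_mono[OF T(1)] unfolding A_def by metis
  then have bound: "\<bar>s\<bar> < 2 ^ k" "A \<noteq> {#} \<longrightarrow> s \<noteq> 0" using signed_sum_powers_of_2[OF _ s] by auto
  have "\<bar>s\<bar> < int n" using bound(1) assms(3) by (metis of_nat_le_iff of_nat_numeral of_nat_power order_less_le_trans)
  then have "s = 0" using assms(8) dvd_imp_le_int[of s "int n"] by linarith
  then have "A = {#}" using bound(2) by blast
  then have size: "size T = refls T" using size_eq_rots_refls[of T] by (simp add: rots_def A_def)
  have "refls T \<le> refls (extremal_sequence n k)" by (rule refls_mono[OF T(1)])
  also have "refls (extremal_sequence n k) = 2 * n - 1"
    unfolding extremal_sequence_def refls_simps
    using refls_eq_size[of "replicate_mset (2 * n - 1) (0, True)"] refls_eq_0_iff[of ?P] by auto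
  finally have le: "size T \<le> 2 * n - 1" using size by simp
  have "2 dvd size T" using assms(6) size by simp
  moreover have "coprime 2 n" using assms(2) by simp
  ultimately have "2 * n dvd size T" using dvd by (simp add: divides_mult)
  moreover have "size T > 0" using T(2) by (simp add: nonempty_has_size)
  ultimately have "2 * n \<le> size T" by (rule dvd_imp_le)
  then show False using le assms(1) by simp
qed

section \<open>Transfer to the dihedral group\<close>

context dihedral_group
begin

lemma ex_one_product_subseq:
  assumes "n \<ge> 3" "odd n" "2 ^ k \<le> n" "n < 2 ^ (k + 1)"
    and S: "set_mset S \<subseteq> carrier G" "2 * n + k \<le> size S"
  shows "\<exists>T. T \<subseteq># S \<and> T \<noteq> {#} \<and> one_product_seq G T \<and> [size T = 0] (mod n)"
proof -
  let ?nf = "\<lambda>e. nf (fst e) (snd e)"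
  \<comment> \<open>The counting arguments presuppose length exactly
    \<open>2 * n + k\<close>.\<close>
  obtain S1 where S1: "S1 \<subseteq># S" "size S1 = 2 * n + k" using ex_submset_size[OF S(2)] by blast
  have "\<exists>e. ?nf e = g" if "g \<in> carrier G" for g
    using that generate_imp_nf generated by (metis fst_conv snd_conv)
  then obtain f where f: "\<And>g. g \<in> carrier G \<Longrightarrow> ?nf (f g) = g" by metis
  have "?nf (f g) = g" if "g \<in># S1" for g using that S1(1) S(1) f by (meson mset_subset_eqD subsetD)
  then have img: "image_mset ?nf (image_mset f S1) = S1"
    by (simp add: image_mset.compositionality comp_def multiset.map_ident_strong)
  interpret long_sequence n k "image_mset f S1"
    using assms S1(2) by unfold_locales auto
  obtain T where T: "T \<subseteq># image_mset f S1" "size T = n \<or> size T = 2 * n" "solvable n T"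
    using solved by (auto simp: solved_def)
  have "image_mset ?nf T \<subseteq># S1" using image_mset_subseteq_mono[OF T(1), of ?nf] by (simp only: img)
  then have "image_mset ?nf T \<subseteq># S" using S1(1) by (rule subset_mset.order_trans)
  moreover have "image_mset ?nf T \<noteq> {#}" using T(2) assms(1) by auto
  moreover have "[size (image_mset ?nf T) = 0] (mod n)" using T(2) by (auto simp: cong_def)
  ultimately show ?thesis using one_product_seq_of_solvable[OF T(3)] by blast
qed

lemma ex_long_sequence_without_one_product_subseq:
  assumes "n > 0" "odd n" "2 ^ k \<le> n"
  shows "\<exists>S. set_mset S \<subseteq> carrier G \<and> size S = 2 * n - 1 + k \<and>
    (\<forall>T. T \<subseteq># S \<longrightarrow> T \<noteq> {#} \<longrightarrow> one_product_seq G T \<longrightarrow> \<not> [size T = 0] (mod n))"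
proof (intro exI conjI allI impI)
  let ?nf = "\<lambda>e. nf (fst e) (snd e)"
  show "set_mset (image_mset ?nf (extremal_sequence n k)) \<subseteq> carrier G" by auto
  show "size (image_mset ?nf (extremal_sequence n k)) = 2 * n - 1 + k"
    by (simp add: extremal_sequence_def)
  fix T assume T: "T \<subseteq># image_mset ?nf (extremal_sequence n k)" "T \<noteq> {#}" "one_product_seq G T"
  obtain T' where T': "T' \<subseteq># extremal_sequence n k" "T = image_mset ?nf T'"
    using subset_image_mset_obtain[OF T(1)] by blast
  then obtain s t where "even (refls T')" "signed_sum T' s t" "int n dvd s"
    using signed_sum_of_one_product_seq[OF assms(1)] T(3) by blast
  then have "\<not> n dvd size T'"
    using extremal_sequence_no_solution[OF assms T'(1)] T(2) T'(2) by auto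
  then show "\<not> [size T = 0] (mod n)" using T'(2) by (simp add: cong_0_iff)
qed

end

theorem theorem3p3:
  fixes G :: "('a, 'b) monoid_scheme" and n :: nat and x y :: 'a
  assumes "n \<ge> 3" and "odd n"
    and "dihedral_group G n x y"
  shows "s_dN n G = enat (2 * n + nat \<lfloor>log 2 (real n)\<rfloor>)"
proof -
  interpret dihedral_group G n x y by fact
  obtain k where k: "2 ^ k \<le> n" "n < 2 ^ (k + 1)"
    using ex_power_ivl1[of 2 n] assms(1) by auto
  then have "\<lfloor>log 2 (real n)\<rfloor> = int k" using floor_log_nat_eq_if[of 2 k n] by simp
  then have eq: "nat \<lfloor>log 2 (real n)\<rfloor> = k" by simp
  show ?thesis unfolding s_dN_def eq
  proof (rule Least_equality)
    show "\<forall>S. set_mset S \<subseteq> carrier G \<and> enat (2 * n + k) \<le> enat (size S) \<longrightarrow>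
      (\<exists>T. T \<subseteq># S \<and> T \<noteq> {#} \<and> one_product_seq G T \<and> [size T = 0] (mod n))"
      using ex_one_product_subseq[OF assms(1,2) k] by simp
  next
    fix l :: enat
    assume l: "\<forall>S. set_mset S \<subseteq> carrier G \<and> l \<le> enat (size S) \<longrightarrow>
      (\<exists>T. T \<subseteq># S \<and> T \<noteq> {#} \<and> one_product_seq G T \<and> [size T = 0] (mod n))"
    have n0: "n > 0" using assms(1) by simp
    obtain S where S: "set_mset S \<subseteq> carrier G" "size S = 2 * n - 1 + k"
      "\<And>T. T \<subseteq># S \<Longrightarrow> T \<noteq> {#} \<Longrightarrow> one_product_seq G T \<Longrightarrow> \<not> [size T = 0] (mod n)"
      using ex_long_sequence_without_one_product_subseq[OF n0 assms(2) k(1)] by blast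
    have "\<not> l \<le> enat (size S)" using l S(1,3) by blast
    then have "enat (2 * n - 1 + k) < l" using S(2) by (simp add: not_le)
    then have "eSuc (enat (2 * n - 1 + k)) \<le> l" by (rule ileI1)
    then show "enat (2 * n + k) \<le> l" using n0 by (simp add: eSuc_enat)
  qed
qed

end
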